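(* For every integer $k\ge 2$ and every real number $N>k(k+1)-2$, there are at least $2(k-2)+2$ distinct radial solutions $u$ of $$-\Delta u=(1+|x|^2)^N e^{2u}\ \text{ in }\mathbb R^2,\qquad \int_{\mathbb R^2}(1+|x|^2)^N e^{2u}\,dx=\lambda,$$ with $\lambda=2\pi(N+2)$, one of them being the function $u_N^*(r)=\frac12\log\left(\frac{2(N+2)}{(1+r^2)^{N+2}}\right)$, $r=|x|$.
   Context: Solutions are classical ($C^2$) functions $u:\mathbb R^2\to\mathbb R$; radial means that $u(x)$ depends only on $r=|x|$. *)

theory Defs
  imports "HOL-Analysis.Analysis"
begin

definition partial_deriv :: "'a::euclidean_space \<Rightarrow> ('a \<Rightarrow> real) \<Rightarrow> 'a \<Rightarrow> real" where
  "partial_deriv b u x = frechet_derivative u (at x) b"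

definition C1_fun :: "('a::euclidean_space \<Rightarrow> real) \<Rightarrow> bool" where
  "C1_fun u \<longleftrightarrow> (\<forall>x. u differentiable (at x)) \<and> (\<forall>b\<in>Basis. continuous_on UNIV (partial_deriv b u))"

definition C2_fun :: "('a::euclidean_space \<Rightarrow> real) \<Rightarrow> bool" where
  "C2_fun u \<longleftrightarrow> C1_fun u \<and> (\<forall>b\<in>Basis. C1_fun (partial_deriv b u))"

definition laplacian :: "('a::euclidean_space \<Rightarrow> real) \<Rightarrow> 'a \<Rightarrow> real" where
  "laplacian u x = (\<Sum>b\<in>Basis. partial_deriv b (partial_deriv b u) x)"

definition radial :: "('a::real_normed_vector \<Rightarrow> real) \<Rightarrow> bool" where
  "radial u \<longleftrightarrow> (\<exists>v. \<forall>x. u x = v (norm x))"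

definition liouville_solution :: "real \<Rightarrow> real \<Rightarrow> (real ^ 2 \<Rightarrow> real) \<Rightarrow> bool" where
  "liouville_solution N lam u \<longleftrightarrow>
     C2_fun u \<and>
     (\<forall>x. - laplacian u x = (1 + (norm x)\<^sup>2) powr N * exp (2 * u x)) \<and>
     has_bochner_integral lborel (\<lambda>x. (1 + (norm x)\<^sup>2) powr N * exp (2 * u x)) lam"

definition u_star :: "real \<Rightarrow> real ^ 2 \<Rightarrow> real" where
  "u_star N x = 1/2 * ln (2 * (N + 2) / (1 + (norm x)\<^sup>2) powr (N + 2))"

end

theory Submission
  imports Defs "HOL-Computational_Algebra.Polynomial"
begin

text \<open>Write \<open>u(x) = u\<^sup>*(x) + w(|x|\<^sup>2)\<close> and \<open>\<mu> = N + 2\<close>. In the variable \<open>t = |x|\<^sup>2\<close> the equation becomes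
  \<open>(t w')' = - \<mu>/2 (1 + t)\<^sup>-\<^sup>2 (e\<^bsup>2w\<^esup> - 1)\<close>, the axially symmetric form of a problem on the sphere, and the
  mass is \<open>2 \<pi> \<mu>\<close> iff \<open>t w' \<rightarrow> 0\<close> at infinity. Let \<open>w\<^sub>a\<close> be the solution with \<open>w\<^sub>a(0) = a\<close> and let
  \<open>Z(a)\<close> be its number of zeros. The polar angle of \<open>(w\<^sub>a, t w\<^sub>a')\<close> is strictly monotone, so zeros
  can only appear or disappear at infinity; the tail analysis shows that they do so one at a time and only
  at parameters where \<open>t w\<^sub>a' \<rightarrow> 0\<close>. For \<open>a\<close> near \<open>0\<close>, Sturm comparison of the linearisation with the
  Legendre polynomial \<open>P\<^sub>k\<close> gives \<open>Z(a) > k\<close>, while \<open>Z(a) \<le> 2\<close> for very negative \<open>a\<close>. Hence there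
  are solutions with \<open>a < 0\<close> and \<open>Z(a) = 2, \<dots>, k\<close>. The inversion \<open>t \<mapsto> 1/t\<close> turns the one with three zeros
  into a solution with \<open>a > 0\<close>, from where the same argument gives solutions with \<open>a > 0\<close> and
  \<open>Z(a) = 3, \<dots>, k\<close>. To treat \<open>a = 0\<close> uniformly, the family is parametrised as \<open>w\<^sub>a = a Y\<^sub>a\<close> with
  \<open>Y\<^sub>a(0) = 1\<close>.\<close>

section \<open>A singular Volterra equation with a parameter\<close>

text \<open>The obstacle is the unbounded half-line. On \<open>[0, X]\<close> zeros are counted by
  an angle continuous in \<open>a\<close>, so having at most \<open>m\<close> zeros is a closed
  condition on \<open>a\<close>; it is open only where no zero arrives from infinity. The proof
  therefore works with the closed sets \<open>atmost m\<close>: going from a member towards 0, which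
  is not a member, the last member is a boundary point, hence a regular parameter with exactly
  \<open>m\<close> zeros. Non-membership of 0 is where \<open>\<mu>\<close> > k(k+1) enters: k(k+1)
  is the Legendre eigenvalue of P_k, whose k zeros cut the half-line into k+1 gaps, and faster
  oscillation puts a zero into each gap. At \<open>a = 0\<close> only \<open>Y\<close> can be
  counted, since \<open>W\<close> vanishes identically there while \<open>Y\<close> solves the
  linearised equation. Nothing is estimated for large positive \<open>a\<close>; the inverted
  solution is the seed there. For it to have a positive value at 0, the original must end positive,
  which for \<open>a < 0\<close> requires an odd number of zeros, and three is the first odd number
  at hand. The k-1 negative and k-2 positive parameters, together with \<open>u_star\<close>, make
  2k-2 solutions.\<close>

lemma continuous_on_average:
  fixes h :: "real \<times> real \<Rightarrow> real"
  assumes "continuous_on UNIV h"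
  shows "continuous_on UNIV (\<lambda>p. integral {0..1} (\<lambda>s. h (fst p, snd p * s)))"
proof -
  have "continuous_on (UNIV \<times> cbox 0 1) (\<lambda>(p, s). h (fst p, snd p * s))"
    unfolding split_beta
    by (intro continuous_on_compose2[OF assms]) (auto intro!: continuous_intros)
  from integral_continuous_on_param[OF this] show ?thesis by simp
qed

lemma integrable_average:
  fixes h :: "real \<times> real \<Rightarrow> real"
  assumes "continuous_on UNIV h"
  shows "(\<lambda>s. h (a, x * s)) integrable_on {0..1}"
  by (intro integrable_continuous_real continuous_on_compose2[OF assms])
     (auto intro!: continuous_intros)

lemma integral_power_unit: "integral {0..1} (\<lambda>s::real. s ^ n) = 1 / (real n + 1)"
proof -
  have "((\<lambda>s::real. s ^ n) has_integral (1 ^ Suc n / (real n + 1) - 0 ^ Suc n / (real n + 1))) {0..1}"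
  proof (rule fundamental_theorem_of_calculus)
    fix x :: real
    have "((\<lambda>s. s ^ Suc n) has_real_derivative (real n + 1) * x ^ n) (at x within {0..1})"
      by (auto intro!: derivative_eq_intros simp del: power_Suc)
    from DERIV_cdivide[OF this, of "real n + 1"]
    have "((\<lambda>s. s ^ Suc n / (real n + 1)) has_real_derivative x ^ n) (at x within {0..1})"
      by (simp add: add_nonneg_eq_0_iff)
    then show "((\<lambda>s. s ^ Suc n / (real n + 1)) has_vector_derivative x ^ n) (at x within {0..1})"
      by (simp add: has_real_derivative_iff_has_vector_derivative)
  qed simp
  then show ?thesis by (auto dest: integral_unique)
qed

text \<open>An error vanishing like \<open>\<bar>z\<bar> ^ n\<close> gains a factor 1/(n+1) under
  averaging. Iterated, these factors build the factorial that makes the Picard series converge for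
  every \<open>x\<close>.\<close>

lemma average_diff_le:
  fixes h k :: "real \<times> real \<Rightarrow> real"
  assumes "continuous_on UNIV h" "continuous_on UNIV k"
    and "\<And>z. \<bar>z\<bar> \<le> \<bar>x\<bar> \<Longrightarrow> \<bar>h (a, z) - k (a, z)\<bar> \<le> C * \<bar>z\<bar> ^ n"
  shows "\<bar>integral {0..1} (\<lambda>s. h (a, x * s)) - integral {0..1} (\<lambda>s. k (a, x * s))\<bar>
           \<le> C * \<bar>x\<bar> ^ n / (real n + 1)"
proof -
  have "integral {0..1} (\<lambda>s. h (a, x * s)) - integral {0..1} (\<lambda>s. k (a, x * s))
      = integral {0..1} (\<lambda>s. h (a, x * s) - k (a, x * s))"
    by (rule integral_diff[symmetric]) (intro integrable_average assms)+
  also have "norm \<dots> \<le> integral {0..1} (\<lambda>s. C * \<bar>x\<bar> ^ n * s ^ n)"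
  proof (rule integral_norm_bound_integral)
    show "(\<lambda>s. h (a, x * s) - k (a, x * s)) integrable_on {0..1}"
      by (intro integrable_diff integrable_average assms)
    show "(\<lambda>s. C * \<bar>x\<bar> ^ n * s ^ n) integrable_on {0..1}"
      by (intro integrable_continuous_real continuous_intros)
    show "norm (h (a, x * s) - k (a, x * s)) \<le> C * \<bar>x\<bar> ^ n * s ^ n" if "s \<in> {0..1}" for s
    proof -
      have "\<bar>x * s\<bar> \<le> \<bar>x\<bar>" using that by (auto simp: abs_mult intro: mult_left_le)
      from assms(3)[OF this] that show ?thesis
        by (simp add: abs_mult power_mult_distrib mult.assoc)
    qed
  qed
  also have "\<dots> = C * \<bar>x\<bar> ^ n / (real n + 1)"
    by (simp add: integral_power_unit)
  finally show ?thesis by simp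
qed

text \<open>The problem (x y')' = g, y(0) = 1, is integrated twice: y' is the mean of g over [0, x],
  and y - 1 is x times the mean of y'. Writing means over the unit interval keeps the singular point
  0 and negative x in a single formula. Joint continuity in (a, x) comes from uniform convergence of
  the iteration on squares.\<close>

lemma volterra_exists:
  fixes g :: "real \<Rightarrow> real \<Rightarrow> real \<Rightarrow> real"
  assumes cont: "continuous_on UNIV (\<lambda>(a, x, y). g a x y)"
    and lip: "\<And>R. \<exists>L\<ge>0. \<forall>a x y z. \<bar>a\<bar> \<le> R \<longrightarrow> \<bar>x\<bar> \<le> R \<longrightarrow> \<bar>g a x y - g a x z\<bar> \<le> L * \<bar>y - z\<bar>"
  shows "\<exists>Y V. continuous_on UNIV Y \<and> continuous_on UNIV V
    \<and> (\<forall>a x. Y (a, x) = 1 + x * integral {0..1} (\<lambda>s. V (a, x * s)))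
    \<and> (\<forall>a x. V (a, x) = integral {0..1} (\<lambda>s. g a (x * s) (Y (a, x * s))))"
proof -
  define force where "force y p = g (fst p) (snd p) (y p)" for y p
  define slope where "slope y p = integral {0..1} (\<lambda>s. force y (fst p, snd p * s))" for y p
  define step where "step y p = 1 + snd p * integral {0..1} (\<lambda>s. slope y (fst p, snd p * s))" for y p
  have cont_force: "continuous_on UNIV (force y)" if "continuous_on UNIV y" for y
  proof -
    have "continuous_on UNIV (\<lambda>p. (case (fst p, snd p, y p) of (a, x, y) \<Rightarrow> g a x y))"
      using that by (intro continuous_on_compose2[OF cont]) (auto intro!: continuous_intros)
    then show ?thesis by (simp add: force_def[abs_def])
  qed
  have cont_slope: "continuous_on UNIV (slope y)" if "continuous_on UNIV y" for y
    unfolding slope_def[abs_def] by (intro continuous_on_average cont_force that)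
  have cont_step: "continuous_on UNIV (step y)" if "continuous_on UNIV y" for y
    unfolding step_def[abs_def]
    by (intro continuous_intros continuous_on_average cont_slope that)
  \<comment> \<open>Used twice: with growing \<open>n\<close> for the convergence of the iteration,
    and with \<open>n = 0\<close> to pass to the limit inside \<open>step\<close>.\<close>
  have step_diff: "\<bar>step y (a, x) - step z (a, x)\<bar> \<le> L * C * \<bar>x\<bar> ^ Suc n / (real n + 1)"
    if y: "continuous_on UNIV y" and z: "continuous_on UNIV z" and L: "0 \<le> L"
      and Lip: "\<forall>a x y z. \<bar>a\<bar> \<le> R \<longrightarrow> \<bar>x\<bar> \<le> R \<longrightarrow> \<bar>g a x y - g a x z\<bar> \<le> L * \<bar>y - z\<bar>"
      and a: "\<bar>a\<bar> \<le> R" and x: "\<bar>x\<bar> \<le> R" and C: "0 \<le> C"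
      and bd: "\<And>t. \<bar>t\<bar> \<le> \<bar>x\<bar> \<Longrightarrow> \<bar>y (a, t) - z (a, t)\<bar> \<le> C * \<bar>t\<bar> ^ n"
    for y z L R a x C n
  proof -
    have 1: "\<bar>force y (a, t) - force z (a, t)\<bar> \<le> L * C * \<bar>t\<bar> ^ n" if "\<bar>t\<bar> \<le> \<bar>x\<bar>" for t
    proof -
      have "\<bar>force y (a, t) - force z (a, t)\<bar> \<le> L * \<bar>y (a, t) - z (a, t)\<bar>"
        using Lip a x that by (simp add: force_def)
      also have "\<dots> \<le> L * (C * \<bar>t\<bar> ^ n)" using bd[OF that] L by (rule mult_left_mono)
      finally show ?thesis by (simp add: mult.assoc)
    qed
    have 2: "\<bar>slope y (a, t) - slope z (a, t)\<bar> \<le> L * C * \<bar>t\<bar> ^ n" if "\<bar>t\<bar> \<le> \<bar>x\<bar>" for t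
    proof -
      have "\<bar>slope y (a, t) - slope z (a, t)\<bar> \<le> L * C * \<bar>t\<bar> ^ n / (real n + 1)"
        unfolding slope_def fst_conv snd_conv
        by (rule average_diff_le) (use 1 that cont_force y z in auto)
      also have "\<dots> \<le> L * C * \<bar>t\<bar> ^ n / 1"
        using L C by (intro divide_left_mono) auto
      finally show ?thesis by simp
    qed
    have "\<bar>step y (a, x) - step z (a, x)\<bar>
      = \<bar>x\<bar> * \<bar>integral {0..1} (\<lambda>s. slope y (a, x * s)) - integral {0..1} (\<lambda>s. slope z (a, x * s))\<bar>"
      by (simp add: step_def abs_mult flip: right_diff_distrib)
    also have "\<dots> \<le> \<bar>x\<bar> * (L * C * \<bar>x\<bar> ^ n / (real n + 1))"
      by (intro mult_left_mono average_diff_le) (use 2 cont_slope y z in auto)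
    finally show ?thesis by (simp add: mult_ac)
  qed
  define pic where "pic n = (step ^^ n) (\<lambda>_. 1)" for n
  have pic_Suc: "pic (Suc n) = step (pic n)" for n by (simp add: pic_def)
  have cont_pic: "continuous_on UNIV (pic n)" for n
    by (induction n) (auto simp: pic_Suc cont_step, simp add: pic_def)
  define K where "K R = {-R..R} \<times> {-R..R :: real}" for R :: real
  have "\<exists>y. uniform_limit (K R) pic y sequentially" for R
  proof -
    obtain L where L: "0 \<le> L"
      and Lip: "\<forall>a x y z. \<bar>a\<bar> \<le> R \<longrightarrow> \<bar>x\<bar> \<le> R \<longrightarrow> \<bar>g a x y - g a x z\<bar> \<le> L * \<bar>y - z\<bar>"
      using lip by blast
    have "compact (K R)" unfolding K_def by (intro compact_Times compact_Icc)
    moreover have "continuous_on (K R) (\<lambda>p. pic 1 p - pic 0 p)"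
      by (intro continuous_intros continuous_on_subset[OF cont_pic]) auto
    ultimately have "bounded ((\<lambda>p. pic 1 p - pic 0 p) ` K R)"
      by (intro compact_imp_bounded compact_continuous_image)
    then obtain C where C: "0 < C" "\<And>p. p \<in> K R \<Longrightarrow> \<bar>pic 1 p - pic 0 p\<bar> \<le> C"
      unfolding bounded_pos by auto
    have est: "\<bar>pic (Suc n) (a, x) - pic n (a, x)\<bar> \<le> C * L ^ n / fact n * \<bar>x\<bar> ^ n"
      if "\<bar>a\<bar> \<le> R" "\<bar>x\<bar> \<le> R" for n a x
      using that
    proof (induction n arbitrary: x)
      case 0
      then show ?case using C(2)[of "(a, x)"] by (simp add: K_def abs_le_iff)
    next
      case (Suc n)
      have "\<bar>step (pic (Suc n)) (a, x) - step (pic n) (a, x)\<bar>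
          \<le> L * (C * L ^ n / fact n) * \<bar>x\<bar> ^ Suc n / (real n + 1)"
        by (rule step_diff[OF cont_pic cont_pic L Lip Suc.prems]) (use C L Suc in auto)
      then show ?case by (simp add: pic_Suc mult_ac add.commute)
    qed
    have "uniform_limit (K R) (\<lambda>n p. \<Sum>i<n. pic (Suc i) p - pic i p)
        (\<lambda>p. \<Sum>i. pic (Suc i) p - pic i p) sequentially"
    proof (rule Weierstrass_m_test)
      show "norm (pic (Suc n) p - pic n p) \<le> C * ((L * R) ^ n /\<^sub>R fact n)" if "p \<in> K R" for n p
      proof -
        define a x where "a = fst p" and "x = snd p"
        then have p: "p = (a, x)" "\<bar>a\<bar> \<le> R" "\<bar>x\<bar> \<le> R"
          using that by (auto simp: K_def abs_le_iff)
        have "\<bar>pic (Suc n) p - pic n p\<bar> \<le> C * L ^ n / fact n * \<bar>x\<bar> ^ n"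
          using est[OF p(2,3)] p(1) by simp
        also have "\<dots> \<le> C * L ^ n / fact n * R ^ n"
          using C L p by (intro mult_left_mono power_mono) auto
        finally show ?thesis by (simp add: power_mult_distrib divide_inverse mult_ac)
      qed
      show "summable (\<lambda>n. C * ((L * R) ^ n /\<^sub>R fact n))"
        by (intro summable_mult summable_exp_generic)
    qed
    then have "uniform_limit (K R) (\<lambda>n p. pic 0 p + (\<Sum>i<n. pic (Suc i) p - pic i p))
        (\<lambda>p. pic 0 p + (\<Sum>i. pic (Suc i) p - pic i p)) sequentially"
      by (intro uniform_limit_intros)
    moreover have "(\<lambda>n p. pic 0 p + (\<Sum>i<n. pic (Suc i) p - pic i p)) = pic"
      using sum_lessThan_telescope[of "\<lambda>i. pic i _"] by (intro ext) simp
    ultimately have "uniform_limit (K R) pic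
        (\<lambda>p. pic 0 p + (\<Sum>i. pic (Suc i) p - pic i p)) sequentially"
      by simp
    then show ?thesis by blast
  qed
  then obtain y where y: "\<And>R. uniform_limit (K R) pic (y R) sequentially" by metis
  \<comment> \<open>The uniform limits on the various squares are all equal to this pointwise limit,
    which glues them together.\<close>
  define Y where "Y p = lim (\<lambda>n. pic n p)" for p
  have Y: "uniform_limit (K R) pic Y sequentially" for R
  proof -
    have "Y p = y R p" if "p \<in> K R" for p
      using tendsto_uniform_limitI[OF y that] unfolding Y_def by (rule limI)
    then show ?thesis using y[of R] uniform_limit_cong'[of "K R" pic pic Y "y R"] by simp
  qed
  have inK: "p \<in> interior (K (\<bar>fst p\<bar> + \<bar>snd p\<bar> + 1))" for p
    by (auto simp: K_def interior_Times mem_Times_iff)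
  have cont_Y: "continuous_on UNIV Y"
  proof (rule continuous_at_imp_continuous_on, intro ballI)
    fix p
    have "continuous_on (K (\<bar>fst p\<bar> + \<bar>snd p\<bar> + 1)) Y"
      by (rule uniform_limit_theorem[OF _ Y])
         (auto intro!: always_eventually continuous_on_subset[OF cont_pic])
    then show "isCont Y p" using inK by (rule continuous_on_interior)
  qed
  have fix_Y: "step Y p = Y p" for p
  proof -
    obtain a x where p: "p = (a, x)" by (cases p)
    define R where "R = \<bar>a\<bar> + \<bar>x\<bar> + 1"
    have R: "\<bar>a\<bar> \<le> R" "\<bar>x\<bar> \<le> R" "R > 0" by (auto simp: R_def)
    obtain L where L: "0 \<le> L"
      and Lip: "\<forall>a x y z. \<bar>a\<bar> \<le> R \<longrightarrow> \<bar>x\<bar> \<le> R \<longrightarrow> \<bar>g a x y - g a x z\<bar> \<le> L * \<bar>y - z\<bar>"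
      using lip by blast
    have "(\<lambda>n. step (pic n) p) \<longlonglongrightarrow> step Y p"
    proof (rule LIMSEQ_I)
      fix e :: real assume e: "e > 0"
      define d where "d = e / (L * R + 1)"
      have LR: "L * R + 1 > 0" using L R by (intro add_nonneg_pos) auto
      have d: "d > 0" using e LR by (simp add: d_def)
      have "\<forall>\<^sub>F n in sequentially. \<forall>q\<in>K R. dist (pic n q) (Y q) < d"
        using uniform_limitD[OF Y d] .
      then obtain n0 where n0: "\<And>n q. n \<ge> n0 \<Longrightarrow> q \<in> K R \<Longrightarrow> \<bar>pic n q - Y q\<bar> < d"
        by (auto simp: eventually_sequentially dist_real_def)
      show "\<exists>n0. \<forall>n\<ge>n0. norm (step (pic n) p - step Y p) < e"
      proof (intro exI allI impI)
        fix n assume n: "n \<ge> n0"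
        have "\<bar>step (pic n) (a, x) - step Y (a, x)\<bar> \<le> L * d * \<bar>x\<bar> ^ Suc 0 / (real 0 + 1)"
        proof (rule step_diff[OF cont_pic cont_Y L Lip R(1,2)])
          show "0 \<le> d" using d by simp
          show "\<bar>pic n (a, t) - Y (a, t)\<bar> \<le> d * \<bar>t\<bar> ^ 0" if "\<bar>t\<bar> \<le> \<bar>x\<bar>" for t
          proof -
            have "(a, t) \<in> K R" using R that by (auto simp: K_def abs_le_iff)
            from n0[OF n this] show ?thesis by simp
          qed
        qed
        also have "\<dots> \<le> L * d * R" using L d R by (simp add: mult_left_mono)
        also have "\<dots> < (L * R + 1) * d" using d by (simp add: algebra_simps)
        also have "\<dots> = e" using LR by (simp add: d_def)
        finally show "norm (step (pic n) p - step Y p) < e" by (simp add: p)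
      qed
    qed
    moreover have "(\<lambda>n. step (pic n) p) \<longlonglongrightarrow> Y p"
    proof -
      have "p \<in> K R" using R p by (auto simp: K_def abs_le_iff)
      from LIMSEQ_Suc[OF tendsto_uniform_limitI[OF Y this]] show ?thesis by (simp add: pic_Suc)
    qed
    ultimately show ?thesis by (rule LIMSEQ_unique)
  qed
  show ?thesis
  proof (intro exI conjI allI)
    show "continuous_on UNIV Y" by (rule cont_Y)
    show "continuous_on UNIV (slope Y)" by (intro cont_slope cont_Y)
    show "Y (a, x) = 1 + x * integral {0..1} (\<lambda>s. slope Y (a, x * s))" for a x
      using fix_Y[of "(a, x)"] by (simp add: step_def)
    show "slope Y (a, x) = integral {0..1} (\<lambda>s. g a (x * s) (Y (a, x * s)))" for a x
      by (simp add: slope_def force_def)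
  qed
qed

text \<open>By the substitution \<open>y * s\<close> the product is the antiderivative of
  \<open>V\<close> vanishing at 0, for arguments of either sign; hence the derivative at 0 is
  two-sided.\<close>

lemma has_real_derivative_mult_average:
  fixes V :: "real \<Rightarrow> real"
  assumes "continuous_on UNIV V"
  shows "((\<lambda>x. x * integral {0..1} (\<lambda>s. V (x * s))) has_real_derivative V x) (at x)"
proof -
  define R where "R = \<bar>x\<bar> + 1"
  obtain F where F: "\<And>y. y \<in> {-R..R} \<Longrightarrow> (F has_vector_derivative V y) (at y within {-R..R})"
    using antiderivative_continuous[OF continuous_on_subset[OF assms]] by (metis subset_UNIV)
  have F': "(F has_real_derivative V y) (at y)" if "\<bar>y\<bar> < R" for y
  proof -
    have "at y within {-R..R} = at y"
      using that by (intro at_within_interior) auto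
    then show ?thesis
      using F[of y] that by (simp add: abs_less_iff has_real_derivative_iff_has_vector_derivative)
  qed
  have eq: "y * integral {0..1} (\<lambda>s. V (y * s)) = F y - F 0" if y: "\<bar>y\<bar> < R" for y
  proof -
    have "((\<lambda>s. y * V (y * s)) has_integral (F (y * 1) - F (y * 0))) {0..1}"
    proof (rule fundamental_theorem_of_calculus)
      fix s :: real assume s: "s \<in> {0..1}"
      have "\<bar>y * s\<bar> \<le> \<bar>y\<bar>" using s by (auto simp: abs_mult intro: mult_left_le)
      then have "(F has_real_derivative V (y * s)) (at (y * s))" using F' y by simp
      from DERIV_chain2[where g = "\<lambda>s. y * s" and x = s and s = UNIV and Db = y, OF this]
      have "((\<lambda>s. F (y * s)) has_real_derivative V (y * s) * y) (at s)"
        by (auto intro!: derivative_eq_intros)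
      then show "((\<lambda>s. F (y * s)) has_vector_derivative y * V (y * s)) (at s within {0..1})"
        by (simp add: has_real_derivative_iff_has_vector_derivative[symmetric] mult.commute
            has_field_derivative_at_within)
    qed simp
    from integral_unique[OF this] show ?thesis by simp
  qed
  have "((\<lambda>y. F y - F 0) has_real_derivative V x) (at x)"
    using DERIV_diff[OF F'[of x] DERIV_const[of "F 0"]] by (simp add: R_def)
  then show ?thesis
  proof (rule has_field_derivative_transform_within_open)
    show "open {-R<..<R}" "x \<in> {-R<..<R}" by (auto simp: R_def)
    show "F y - F 0 = y * integral {0..1} (\<lambda>s. V (y * s))" if "y \<in> {-R<..<R}" for y
      using eq[of y] that by auto
  qed
qed

section \<open>The shooting family\<close>

lemma DERIV_reciprocal: "0 < t \<Longrightarrow> ((\<lambda>x::real. 1 / x) has_real_derivative - (1 / t\<^sup>2)) (at t)"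
  and DERIV_reciprocal_plus1: "-1 < t \<Longrightarrow> ((\<lambda>x::real. 1 / (1 + x)) has_real_derivative - (1 / (1 + t)\<^sup>2)) (at t)"
  by (auto intro!: derivative_eq_intros simp: power2_eq_square)

text \<open>The entire function (e^z - 1)/z. Since e^(2aY) - 1 = 2aY \<open>expquot\<close> (2aY),
  the equation for W = aY can be divided by \<open>a\<close>, and the result still makes sense at
  \<open>a = 0\<close>, where it is the linearisation.\<close>

definition expquot :: "real \<Rightarrow> real" where
  "expquot z = (if z = 0 then 1 else (exp z - 1) / z)"

lemma expquot_0 [simp]: "expquot 0 = 1"
  by (simp add: expquot_def)

lemma mult_expquot: "z * expquot z = exp z - 1"
  by (simp add: expquot_def)

lemma expquot_pos: "expquot z > 0"
  by (auto simp: expquot_def zero_less_divide_iff)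

lemma expquot_le: "0 \<le> c \<Longrightarrow> expquot c \<le> exp c"
proof (cases "c = 0")
  case False
  assume "0 \<le> c"
  have "1 - c \<le> exp (- c)" using exp_ge_add_one_self[of "- c"] by simp
  then have "exp c * (1 - c) \<le> exp c * exp (- c)" by (intro mult_left_mono) auto
  then have "exp c - 1 \<le> exp c * c" by (simp add: algebra_simps flip: exp_add)
  then show ?thesis using False \<open>0 \<le> c\<close> by (simp add: expquot_def divide_simps)
qed simp

lemma isCont_expquot: "isCont expquot z"
proof (cases "z = 0")
  case True
  have "((\<lambda>h. (exp (0 + h) - exp 0) / h) \<longlongrightarrow> exp 0) (at (0::real))"
    using DERIV_exp[of "0::real"] by (simp add: DERIV_def)
  then have "((\<lambda>h. (exp h - 1) / h) \<longlongrightarrow> 1) (at (0::real))" by simp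
  then have "(expquot \<longlongrightarrow> 1) (at 0)"
    by (rule tendsto_cong[THEN iffD1, rotated])
       (auto simp: expquot_def eventually_at_filter)
  then show ?thesis using True by (simp add: isCont_def)
next
  case False
  then have "isCont (\<lambda>z. (exp z - 1) / z) z" by (intro continuous_intros)
  moreover have "\<forall>\<^sub>F y in nhds z. expquot y = (exp y - 1) / y"
    using False by (auto simp: expquot_def eventually_nhds intro!: exI[of _ "- {0}"])
  ultimately show ?thesis by (rule isCont_cong[THEN iffD2, rotated])
qed

lemma continuous_on_expquot [continuous_intros]:
  "continuous_on S f \<Longrightarrow> continuous_on S (\<lambda>x. expquot (f x))"
  by (rule continuous_on_compose2[of UNIV expquot])
     (auto intro: continuous_at_imp_continuous_on isCont_expquot)

text \<open>Below \<open>c\<close> the function is e^u - 1, with slope at most e^c; above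
  \<open>c\<close> it is linear with slope \<open>expquot c\<close>, again at most e^c. When the two
  arguments lie on different sides, the difference is split at \<open>c\<close>.\<close>

lemma truncated_exp_lipschitz:
  fixes u v c :: real
  assumes c: "0 \<le> c"
  shows "\<bar>u * expquot (min u c) - v * expquot (min v c)\<bar> \<le> exp c * \<bar>u - v\<bar>"
proof -
  have *: "\<bar>u * expquot (min u c) - v * expquot (min v c)\<bar> \<le> exp c * \<bar>u - v\<bar>"
    if uv: "u \<le> v" for u v :: real
  proof -
    have low: "\<bar>exp u - exp v\<bar> \<le> exp c * \<bar>u - v\<bar>" if "u \<le> v" "v \<le> c" for u v :: real
    proof -
      have "1 + (u - v) \<le> exp (u - v)" by (rule exp_ge_add_one_self)
      then have "exp v * (1 + (u - v)) \<le> exp v * exp (u - v)" by (intro mult_left_mono) auto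
      then have "exp v - exp u \<le> exp v * (v - u)" by (simp add: algebra_simps flip: exp_add)
      also have "\<dots> \<le> exp c * (v - u)" using that by (intro mult_right_mono) auto
      finally show ?thesis using that by auto
    qed
    consider "v \<le> c" | "c \<le> u" | "u < c" "c < v" by linarith
    then show ?thesis
    proof cases
      case 1
      then show ?thesis using low[OF uv] uv by (simp add: min_absorb1 mult_expquot)
    next
      case 2
      then have "\<bar>u * expquot (min u c) - v * expquot (min v c)\<bar> = expquot c * \<bar>u - v\<bar>"
        using uv expquot_pos[of c] by (simp add: min_absorb2 abs_mult mult.commute flip: left_diff_distrib)
      then show ?thesis using expquot_le[OF c] by (simp add: mult_right_mono)
    next
      case 3
      have "u * expquot u - v * expquot c = (u * expquot u - c * expquot c) - (v - c) * expquot c"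
        by (simp add: algebra_simps)
      also have "\<bar>\<dots>\<bar> \<le> \<bar>u * expquot u - c * expquot c\<bar> + \<bar>(v - c) * expquot c\<bar>" by linarith
      also have "\<dots> \<le> exp c * (c - u) + exp c * (v - c)"
      proof (rule add_mono)
        show "\<bar>u * expquot u - c * expquot c\<bar> \<le> exp c * (c - u)"
          using low[of u c] 3 by (simp add: mult_expquot)
        have "(v - c) * expquot c \<le> (v - c) * exp c"
          using 3 expquot_le[OF c] by (intro mult_left_mono) auto
        then show "\<bar>(v - c) * expquot c\<bar> \<le> exp c * (v - c)"
          using 3 expquot_pos[of c] by (simp add: abs_mult mult.commute)
      qed
      also have "\<dots> = exp c * \<bar>u - v\<bar>" using 3 by (simp add: algebra_simps)
      finally show ?thesis using 3 by (simp add: min_absorb1 min_absorb2)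
    qed
  qed
  show ?thesis
  proof (cases "u \<le> v")
    case False
    then show ?thesis using *[of v u] by (simp add: abs_minus_commute)
  qed (rule *)
qed

text \<open>\<open>V\<close> is the derivative of Y, kept as a function of its own because it is
  continuous through the singular point. The last assumption is a by-product of the construction and
  serves as the a priori bound on the height of W.\<close>

locale shooting =
  fixes \<mu> :: real and Y V :: "real \<Rightarrow> real \<Rightarrow> real"
  assumes mu_pos: "\<mu> > 0"
    and cont_Y: "continuous_on UNIV (\<lambda>p. Y (fst p) (snd p))"
    and cont_V: "continuous_on UNIV (\<lambda>p. V (fst p) (snd p))"
    and Y_0 [simp]: "Y a 0 = 1"
    and deriv_Y: "0 \<le> x \<Longrightarrow> (Y a has_real_derivative V a x) (at x)"
    and deriv_Q: "0 \<le> x \<Longrightarrow>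
      ((\<lambda>x. x * V a x) has_real_derivative - (\<mu> / (1 + x)\<^sup>2 * expquot (2 * a * Y a x)) * Y a x) (at x)"
    and aY_le: "0 \<le> x \<Longrightarrow> a * Y a x \<le> a + \<mu> / 2 * ln (1 + x)"

text \<open>The exponential is not globally Lipschitz, so the Volterra lemma is applied to a force
  truncated at a height that the solutions turn out never to exceed.\<close>

lemma shooting_exists:
  fixes \<mu> :: real
  assumes mu: "\<mu> > 0"
  shows "\<exists>Y V. shooting \<mu> Y V"
proof -
  \<comment> \<open>Height of the truncation: x (aY)' grows at most like \<open>\<mu>\<close> / 2
    times x / (1 + x), so aY gains at most \<open>\<mu>\<close> / 2 times ln (1 + x). The absolute
    values make the force continuous on the whole plane and \<open>B\<close> nonnegative.\<close>
  define B where "B a x = \<bar>a\<bar> + \<mu> / 2 * ln (1 + \<bar>x\<bar>)" for a x :: real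
  define g where "g a x y = - (\<mu> / (1 + \<bar>x\<bar>)\<^sup>2 * expquot (min (2 * a * y) (2 * B a x))) * y" for a x y
  have B_nonneg: "0 \<le> B a x" for a x using mu by (simp add: B_def)
  have cont: "continuous_on UNIV (\<lambda>(a, x, y). g a x y)"
    unfolding g_def B_def split_beta by (intro continuous_intros) (auto simp: add_nonneg_eq_0_iff)
  have lip: "\<exists>L\<ge>0. \<forall>a x y z. \<bar>a\<bar> \<le> R \<longrightarrow> \<bar>x\<bar> \<le> R \<longrightarrow> \<bar>g a x y - g a x z\<bar> \<le> L * \<bar>y - z\<bar>" for R
  proof (intro exI conjI allI impI)
    show "0 \<le> \<mu> * exp (2 * B R R)" using mu by simp
    fix a x y z :: real assume a: "\<bar>a\<bar> \<le> R" and x: "\<bar>x\<bar> \<le> R"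
    define F where "F y = y * expquot (min (2 * a * y) (2 * B a x))" for y
    have F: "\<bar>F y - F z\<bar> \<le> exp (2 * B a x) * \<bar>y - z\<bar>"
    \<comment> \<open>For nonzero \<open>a\<close> the scalar estimate applies to 2ay and 2az, and
      the factor 2a is cancelled afterwards; at \<open>a = 0\<close> the force is linear.\<close>
    proof (cases "a = 0")
      case True
      have "1 * \<bar>y - z\<bar> \<le> exp (2 * B a x) * \<bar>y - z\<bar>"
        using B_nonneg[of a x] by (intro mult_right_mono) auto
      then show ?thesis using True B_nonneg[of 0 x] by (simp add: F_def min_absorb1)
    next
      case False
      have "\<bar>2 * a\<bar> * \<bar>F y - F z\<bar> = \<bar>2 * a * F y - 2 * a * F z\<bar>"
        by (metis abs_mult right_diff_distrib)
      also have "\<dots> \<le> exp (2 * B a x) * \<bar>2 * a * y - 2 * a * z\<bar>"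
        using truncated_exp_lipschitz[of "2 * B a x" "2 * a * y" "2 * a * z"] B_nonneg[of a x]
        by (simp add: F_def mult.assoc)
      also have "\<dots> = \<bar>2 * a\<bar> * (exp (2 * B a x) * \<bar>y - z\<bar>)"
      proof -
        have "2 * a * y - 2 * a * z = 2 * a * (y - z)" by (simp add: right_diff_distrib)
        then show ?thesis by (simp only: abs_mult mult_ac)
      qed
      finally show ?thesis using False by simp
    qed
    have BR: "B a x \<le> B R R"
      unfolding B_def using a x mu by (intro add_mono mult_left_mono) auto
    have "\<bar>g a x y - g a x z\<bar> = \<mu> / (1 + \<bar>x\<bar>)\<^sup>2 * \<bar>F y - F z\<bar>"
    proof -
      have "g a x y - g a x z = - (\<mu> / (1 + \<bar>x\<bar>)\<^sup>2) * (F y - F z)"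
        by (simp add: g_def F_def algebra_simps)
      then show ?thesis using mu by (simp add: abs_mult)
    qed
    also have "\<dots> \<le> \<mu> * (exp (2 * B R R) * \<bar>y - z\<bar>)"
    proof (rule mult_mono)
      have "1 \<le> (1 + \<bar>x\<bar>)\<^sup>2" by simp
      then show "\<mu> / (1 + \<bar>x\<bar>)\<^sup>2 \<le> \<mu>" using mu by (simp add: divide_le_eq)
      have "exp (2 * B a x) * \<bar>y - z\<bar> \<le> exp (2 * B R R) * \<bar>y - z\<bar>"
        using BR by (intro mult_right_mono) auto
      then show "\<bar>F y - F z\<bar> \<le> exp (2 * B R R) * \<bar>y - z\<bar>" using F by linarith
    qed (use mu in auto)
    finally show "\<bar>g a x y - g a x z\<bar> \<le> \<mu> * exp (2 * B R R) * \<bar>y - z\<bar>" by (simp add: mult.assoc)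
  qed
  obtain Y V where YV: "continuous_on UNIV Y \<and> continuous_on UNIV V
    \<and> (\<forall>a x. Y (a, x) = 1 + x * integral {0..1} (\<lambda>s. V (a, x * s)))
    \<and> (\<forall>a x. V (a, x) = integral {0..1} (\<lambda>s. g a (x * s) (Y (a, x * s))))"
    using volterra_exists[OF cont lip] by (elim exE) (rule that)
  from YV have cY: "continuous_on UNIV Y" and cV: "continuous_on UNIV V"
    and Y: "Y (a, x) = 1 + x * integral {0..1} (\<lambda>s. V (a, x * s))"
    and V: "V (a, x) = integral {0..1} (\<lambda>s. g a (x * s) (Y (a, x * s)))" for a x
    by blast+
  have cVa: "continuous_on UNIV (\<lambda>x. V (a, x))" for a
    by (intro continuous_on_compose2[OF cV] continuous_intros) auto
  have cg: "continuous_on UNIV (\<lambda>x. g a x (Y (a, x)))" for a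
  proof -
    have "continuous_on UNIV (\<lambda>x. (case (a, x, Y (a, x)) of (a, x, y) \<Rightarrow> g a x y))"
      by (intro continuous_on_compose2[OF cont] continuous_intros continuous_on_compose2[OF cY]) auto
    then show ?thesis by simp
  qed
  have dY: "((\<lambda>x. Y (a, x)) has_real_derivative V (a, x)) (at x)" for a x
    using DERIV_add[OF DERIV_const[of 1] has_real_derivative_mult_average[OF cVa, of a x]]
    by (simp only: Y[symmetric] add_0)
  have dQ: "((\<lambda>x. x * V (a, x)) has_real_derivative g a x (Y (a, x))) (at x)" for a x
    using has_real_derivative_mult_average[OF cg, of a x] by (simp only: V[symmetric])
  txt \<open>The truncation is inactive: where \<open>a Y > 0\<close> the force pulls down, elsewhere it is at most
    \<open>\<mu> / 2 / (1 + x)\<^sup>2\<close>, so \<open>a Y\<close> grows at most like the logarithm in \<open>B\<close>.\<close>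
  have ag_le: "a * g a x y \<le> \<mu> / 2 / (1 + x)\<^sup>2" if "0 \<le> x" for a x y
  proof -
    define e where "e = expquot (min (2 * a * y) (2 * B a x))"
    have *: "-1 \<le> 2 * a * y * e"
    proof (cases "2 * a * y \<le> 2 * B a x")
      case True
      then have "e = expquot (2 * a * y)" by (simp add: e_def min_absorb1)
      then have "2 * a * y * e = exp (2 * a * y) - 1" by (simp only: mult_expquot)
      then show ?thesis by simp
    next
      case False
      then have "0 \<le> 2 * a * y" using B_nonneg[of a x] by linarith
      moreover have "0 \<le> e" unfolding e_def by (rule less_imp_le[OF expquot_pos])
      ultimately have "0 \<le> 2 * a * y * e" by (rule mult_nonneg_nonneg)
      then show ?thesis by linarith
    qed
    have "g a x y = - (\<mu> / (1 + x)\<^sup>2 * e) * y" using that by (simp add: g_def e_def)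
    then have "a * g a x y = - (\<mu> / 2 / (1 + x)\<^sup>2) * (2 * a * y * e)" by simp
    also have "\<dots> \<le> - (\<mu> / 2 / (1 + x)\<^sup>2) * (-1)"
      using mu by (intro mult_left_mono_neg *) auto
    finally show ?thesis by simp
  qed
  have aQ: "a * (x * V (a, x)) \<le> \<mu> / 2 * (x / (1 + x))" if "0 \<le> x" for a x
  proof -
    have "0 * V (a, 0) - 0 \<le> \<mu> / 2 * (x / (1 + x)) - a * (x * V (a, x))"
    proof -
      have "\<mu> / 2 * (0 / (1 + 0)) - a * (0 * V (a, 0)) \<le> \<mu> / 2 * (x / (1 + x)) - a * (x * V (a, x))"
      proof (rule DERIV_nonneg_imp_nondecreasing[OF that])
        fix y :: real assume y: "0 \<le> y" "y \<le> x"
        have "((\<lambda>y. \<mu> / 2 * (y / (1 + y)) - a * (y * V (a, y))) has_real_derivative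
                \<mu> / 2 * (1 / (1 + y)\<^sup>2) - a * g a y (Y (a, y))) (at y)"
        proof -
          have "((\<lambda>y. y / (1 + y)) has_real_derivative 1 / (1 + y)\<^sup>2) (at y)"
            using y by (auto intro!: derivative_eq_intros simp: power2_eq_square)
          from DERIV_diff[OF DERIV_cmult[OF this] DERIV_cmult[OF dQ]] show ?thesis .
        qed
        moreover have "0 \<le> \<mu> / 2 * (1 / (1 + y)\<^sup>2) - a * g a y (Y (a, y))"
          using ag_le[of y a "Y (a, y)"] y by simp
        ultimately show "\<exists>D. ((\<lambda>y. \<mu> / 2 * (y / (1 + y)) - a * (y * V (a, y))) has_real_derivative D) (at y)
           \<and> 0 \<le> D" by blast
      qed
      then show ?thesis by simp
    qed
    then show ?thesis by simp
  qed
  have aY: "a * Y (a, x) \<le> a + \<mu> / 2 * ln (1 + x)" if "0 \<le> x" for a x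
  proof -
    have "\<mu> / 2 * ln (1 + 0) - a * Y (a, 0) \<le> \<mu> / 2 * ln (1 + x) - a * Y (a, x)"
    proof (rule DERIV_nonneg_imp_increasing_open[OF that])
      fix y :: real assume y: "0 < y" "y < x"
      have "((\<lambda>y. \<mu> / 2 * ln (1 + y) - a * Y (a, y)) has_real_derivative
              \<mu> / 2 * (1 / (1 + y)) - a * V (a, y)) (at y)"
      proof -
        have "((\<lambda>y. ln (1 + y)) has_real_derivative 1 / (1 + y)) (at y)"
          using y by (auto intro!: derivative_eq_intros)
        from DERIV_diff[OF DERIV_cmult[OF this] DERIV_cmult[OF dY]] show ?thesis .
      qed
      moreover have "y * (a * V (a, y)) \<le> y * (\<mu> / 2 * (1 / (1 + y)))"
        using aQ[of y a] y by (simp add: mult_ac)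
      then have "0 \<le> \<mu> / 2 * (1 / (1 + y)) - a * V (a, y)"
        using y(1) by (simp only: mult_le_cancel_left_pos diff_ge_0_iff_ge)
      ultimately show "\<exists>D. ((\<lambda>y. \<mu> / 2 * ln (1 + y) - a * Y (a, y)) has_real_derivative D) (at y)
           \<and> 0 \<le> D" by blast
    next
      show "continuous_on {0..x} (\<lambda>x. \<mu> / 2 * ln (1 + x) - a * Y (a, x))"
        by (intro continuous_intros continuous_on_compose2[OF cY]) auto
    qed
    then show ?thesis using Y[of a 0] by simp
  qed
  have inactive: "g a x (Y (a, x)) = - (\<mu> / (1 + x)\<^sup>2 * expquot (2 * a * Y (a, x))) * Y (a, x)"
    if "0 \<le> x" for a x
  proof -
    have "2 * a * Y (a, x) \<le> 2 * B a x" using aY[OF that, of a] that by (simp add: B_def)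
    then show ?thesis using that by (simp add: g_def min_absorb1)
  qed
  have "shooting \<mu> (\<lambda>a x. Y (a, x)) (\<lambda>a x. V (a, x))"
  proof
    show "((\<lambda>x. x * V (a, x)) has_real_derivative
        - (\<mu> / (1 + x)\<^sup>2 * expquot (2 * a * Y (a, x))) * Y (a, x)) (at x)" if "0 \<le> x" for a x
      using dQ[of a x] inactive[OF that] by simp
  qed (use mu cY cV dY aY Y[of _ 0] in auto)
  then show ?thesis by blast
qed

section \<open>The phase plane of (Y, Q): polar angle and counting of zeros\<close>

context shooting
begin

text \<open>In the notation of the introduction, \<open>W a\<close> is \<open>w\<^sub>a\<close> and \<open>R a\<close> is \<open>t w\<^sub>a'\<close>.\<close>

definition Q where "Q a x = x * V a x"
definition W where "W a x = a * Y a x"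
definition R where "R a x = a * Q a x"
text \<open>The equation becomes (x Y')' = - \<open>coeff\<close> Y, formally linear with a positive
  potential that depends on the solution. The polar angle needs only this sign.\<close>

definition coeff where "coeff a x = \<mu> / (1 + x)\<^sup>2 * expquot (2 * a * Y a x)"

lemma W_0 [simp]: "W a 0 = a" and Q_0 [simp]: "Q a 0 = 0" and R_0 [simp]: "R a 0 = 0"
  by (simp_all add: W_def Q_def R_def)

lemma coeff_pos: "0 \<le> x \<Longrightarrow> coeff a x > 0"
  using mu_pos by (simp add: coeff_def expquot_pos)

lemma DERIV_Q: "0 \<le> x \<Longrightarrow> (Q a has_real_derivative - coeff a x * Y a x) (at x)"
  using deriv_Q[of x a] by (simp add: Q_def[abs_def] coeff_def)

lemma DERIV_W: "0 < x \<Longrightarrow> (W a has_real_derivative R a x / x) (at x)"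
  using DERIV_cmult[OF deriv_Y[of x a], of a] by (simp add: W_def[abs_def] R_def Q_def)

lemma DERIV_minus_W: "0 < x \<Longrightarrow> ((\<lambda>x. - W a x) has_real_derivative - R a x / x) (at x)"
  using DERIV_minus[OF DERIV_W[of x a]] by simp

lemma DERIV_R: "0 \<le> x \<Longrightarrow> (R a has_real_derivative - (\<mu> / 2 / (1 + x)\<^sup>2) * (exp (2 * W a x) - 1)) (at x)"
proof -
  assume x: "0 \<le> x"
  have "a * (- coeff a x * Y a x) = - (\<mu> / 2 / (1 + x)\<^sup>2) * (2 * a * Y a x * expquot (2 * a * Y a x))"
    by (simp add: coeff_def)
  also have "\<dots> = - (\<mu> / 2 / (1 + x)\<^sup>2) * (exp (2 * W a x) - 1)"
    by (subst mult_expquot) (simp add: W_def mult.assoc)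
  finally show ?thesis using DERIV_cmult[OF DERIV_Q[OF x], of a a] by (simp add: R_def[abs_def])
qed

lemma continuous_on_Y2 [continuous_intros]:
  "continuous_on S f \<Longrightarrow> continuous_on S g \<Longrightarrow> continuous_on S (\<lambda>p. Y (f p) (g p))"
  using continuous_on_compose2[OF cont_Y, of S "\<lambda>p. (f p, g p)"] by (simp add: continuous_on_Pair)

lemma continuous_on_V2 [continuous_intros]:
  "continuous_on S f \<Longrightarrow> continuous_on S g \<Longrightarrow> continuous_on S (\<lambda>p. V (f p) (g p))"
  using continuous_on_compose2[OF cont_V, of S "\<lambda>p. (f p, g p)"] by (simp add: continuous_on_Pair)

lemma continuous_on_Q2 [continuous_intros]:
  "continuous_on S f \<Longrightarrow> continuous_on S g \<Longrightarrow> continuous_on S (\<lambda>p. Q (f p) (g p))"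
  unfolding Q_def by (intro continuous_intros)

lemma continuous_on_W2 [continuous_intros]:
  "continuous_on S f \<Longrightarrow> continuous_on S g \<Longrightarrow> continuous_on S (\<lambda>p. W (f p) (g p))"
  unfolding W_def by (intro continuous_intros)

lemma continuous_on_R2 [continuous_intros]:
  "continuous_on S f \<Longrightarrow> continuous_on S g \<Longrightarrow> continuous_on S (\<lambda>p. R (f p) (g p))"
  unfolding R_def by (intro continuous_intros)

lemma tendsto_W: "((\<lambda>a. W a x) \<longlongrightarrow> W a x) (nhds a)"
  and tendsto_R: "((\<lambda>a. R a x) \<longlongrightarrow> R a x) (nhds a)"
proof -
  have "continuous_on UNIV (\<lambda>a. W a x)" "continuous_on UNIV (\<lambda>a. R a x)"
    by (intro continuous_intros)+
  then show "((\<lambda>a. W a x) \<longlongrightarrow> W a x) (nhds a)" "((\<lambda>a. R a x) \<longlongrightarrow> R a x) (nhds a)"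
    using tendsto_at_iff_tendsto_nhds[of "\<lambda>a. W a x" a] tendsto_at_iff_tendsto_nhds[of "\<lambda>a. R a x" a]
    by (auto simp: continuous_on_eq_continuous_at isCont_def)
qed

text \<open>Backward uniqueness for the linear system Y' = Q/x, Q' = - \<open>coeff\<close> Y: a
  common zero at \<open>x0\<close> would force Y = 0 on (0, x0), against Y(0) = 1.\<close>

lemma Y_Q_nonzero:
  assumes x0: "0 \<le> x0"
  shows "(Y a x0)\<^sup>2 + (Q a x0)\<^sup>2 > 0"
proof (rule ccontr)
  assume "\<not> ?thesis"
  then have "(Y a x0)\<^sup>2 + (Q a x0)\<^sup>2 = 0"
    using sum_power2_ge_zero[of "Y a x0" "Q a x0"] by linarith
  then have zero: "Y a x0 = 0" "Q a x0 = 0" by (auto simp: sum_power2_eq_zero_iff)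
  then have pos: "0 < x0" using x0 Y_0[of a] by (cases "x0 = 0") auto
  have "compact (coeff a ` {0..x0})"
    unfolding coeff_def by (intro compact_continuous_image continuous_intros) auto
  then obtain M where M: "\<And>x. x \<in> {0..x0} \<Longrightarrow> \<bar>coeff a x\<bar> \<le> M"
    using compact_imp_bounded bounded_real by (metis image_eqI)
  have vanish: "Y a e = 0" if e: "0 < e" "e < x0" for e
  proof -
    \<comment> \<open>\<open>K\<close> bounds 1/x - \<open>coeff\<close> on [e, x0], so the weighted
      square norm \<open>E\<close> is nondecreasing there. It depends on \<open>e\<close> because
      1/x is unbounded near 0; afterwards \<open>e\<close> is sent to 0.\<close>
    define K where "K = 1 / e + M"
    define E where "E x = ((Y a x)\<^sup>2 + (Q a x)\<^sup>2) * exp (K * x)" for x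
    have "E e \<le> E x0"
    proof (rule DERIV_nonneg_imp_nondecreasing[of e x0 E])
      fix x assume x: "e \<le> x" "x \<le> x0"
      have x': "0 \<le> x" "0 < x" using x e by auto
      define D where "D = 2 * Y a x * V a x - 2 * Q a x * coeff a x * Y a x"
      have "(E has_real_derivative (D + K * ((Y a x)\<^sup>2 + (Q a x)\<^sup>2)) * exp (K * x)) (at x)"
        unfolding E_def D_def
        by (auto intro!: derivative_eq_intros deriv_Y[OF x'(1)] DERIV_Q[OF x'(1)]
            simp: algebra_simps power2_eq_square)
      moreover have "0 \<le> D + K * ((Y a x)\<^sup>2 + (Q a x)\<^sup>2)"
      proof -
        have D: "D = 2 * (Y a x * Q a x) * (1 / x - coeff a x)"
          using x' by (simp add: D_def Q_def algebra_simps)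
        have "\<bar>1 / x - coeff a x\<bar> \<le> 1 / x + M"
        proof -
          have "0 < 1 / x" using x' by simp
          moreover have "\<bar>coeff a x\<bar> \<le> M" using M[of x] x x' by simp
          ultimately show ?thesis by linarith
        qed
        also have "\<dots> \<le> K" unfolding K_def using x e by (simp add: frac_le)
        finally have k: "\<bar>1 / x - coeff a x\<bar> \<le> K" .
        have "2 * \<bar>Y a x * Q a x\<bar> \<le> (Y a x)\<^sup>2 + (Q a x)\<^sup>2"
          using sum_squares_bound[of "\<bar>Y a x\<bar>" "\<bar>Q a x\<bar>"] by (simp add: abs_mult)
        then have "(2 * \<bar>Y a x * Q a x\<bar>) * \<bar>1 / x - coeff a x\<bar> \<le> ((Y a x)\<^sup>2 + (Q a x)\<^sup>2) * K"
          using k by (intro mult_mono) auto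
        then have "\<bar>D\<bar> \<le> K * ((Y a x)\<^sup>2 + (Q a x)\<^sup>2)"
          unfolding D by (simp add: abs_mult mult.commute)
        then show ?thesis by linarith
      qed
      ultimately show "\<exists>y. (E has_real_derivative y) (at x) \<and> 0 \<le> y" by fastforce
    qed (use e in simp)
    also have "E x0 = 0" by (simp add: E_def zero)
    finally have "(Y a e)\<^sup>2 + (Q a e)\<^sup>2 \<le> 0" by (simp add: E_def mult_le_0_iff)
    then show ?thesis using sum_power2_ge_zero[of "Y a e" "Q a e"]
      by (metis antisym sum_power2_eq_zero_iff)
  qed
  have "(Y a \<longlongrightarrow> Y a 0) (at_right 0)"
    using DERIV_isCont[OF deriv_Y[of 0 a]] by (simp add: isCont_def filterlim_at_split)
  moreover have "(Y a \<longlongrightarrow> 0) (at_right 0)"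
    by (rule tendsto_eventually) (use vanish pos in \<open>auto simp: eventually_at_right_field\<close>)
  ultimately have "Y a 0 = 0" by (intro tendsto_unique[OF _ _ ]) auto
  then show False by simp
qed

text \<open>\<open>ang\<close> is the polar angle of \<open>(Y, Q)\<close>, i.e. the imaginary part of \<open>\<integral> c' / c\<close> for \<open>c = Y + i Q\<close>.\<close>

definition ang' where
  "ang' a x = - (coeff a x * (Y a x)\<^sup>2 + V a x * Q a x) / ((Y a x)\<^sup>2 + (Q a x)\<^sup>2)"

definition ang where "ang a x = integral {0..x} (ang' a)"

lemma continuous_on_ang': "continuous_on (UNIV \<times> {0..X}) (\<lambda>(a, x). ang' a x)"
proof -
  have "(Y a x)\<^sup>2 + (Q a x)\<^sup>2 \<noteq> 0" if "0 \<le> x" for a x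
    using Y_Q_nonzero[OF that, of a] by linarith
  then show ?thesis
    unfolding ang'_def coeff_def split_beta by (intro continuous_intros) auto
qed

lemma continuous_on_ang'_slice: "continuous_on {0..X} (ang' a)"
  using continuous_on_compose2[OF continuous_on_ang'[of X], of "{0..X}" "\<lambda>x. (a, x)"]
  by (auto simp: continuous_on_Pair)

lemma DERIV_ang: "x \<in> {0..X} \<Longrightarrow> (ang a has_real_derivative ang' a x) (at x within {0..X})"
  unfolding ang_def[abs_def] by (rule integral_has_real_derivative[OF continuous_on_ang'_slice])

lemma continuous_on_ang: "continuous_on {0..X} (ang a)"
  using DERIV_ang DERIV_continuous_on by blast

lemma continuous_on_ang_param: "0 \<le> X \<Longrightarrow> continuous_on UNIV (\<lambda>a. ang a X)"
  unfolding ang_def using integral_continuous_on_param[of UNIV 0 X ang'] continuous_on_ang'[of X] by simp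

lemma ang_0 [simp]: "ang a 0 = 0" by (simp add: ang_def)

text \<open>V Q = x V^2, so the numerator is minus a sum of two nonnegative terms, which cannot both
  vanish where (Y, Q) is nonzero.\<close>

lemma ang'_neg: "0 < x \<Longrightarrow> ang' a x < 0"
proof -
  assume x: "0 < x"
  have "V a x * Q a x = x * (V a x)\<^sup>2" by (simp add: Q_def power2_eq_square)
  moreover have "0 < coeff a x * (Y a x)\<^sup>2 + x * (V a x)\<^sup>2"
  proof (cases "Y a x = 0")
    case True
    then show ?thesis using Y_Q_nonzero[of x a] x by (simp add: Q_def)
  next
    case False
    then show ?thesis using coeff_pos[of x a] x by (intro add_pos_nonneg) auto
  qed
  ultimately show ?thesis using Y_Q_nonzero[of x a] x
    by (simp add: ang'_def divide_neg_pos)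
qed

lemma ang_strict_decreasing:
  assumes "0 \<le> x" "x < y"
  shows "ang a y < ang a x"
proof (rule DERIV_neg_imp_decreasing_open[OF assms(2), of "ang a"])
  fix z assume z: "x < z" "z < y"
  have "at z within {0..y} = at z" using z assms by (intro at_within_interior) auto
  then show "\<exists>D. (ang a has_real_derivative D) (at z) \<and> D < 0"
    using DERIV_ang[of z y a] ang'_neg[of z a] z assms by auto
next
  show "continuous_on {x..y} (ang a)"
    by (rule continuous_on_subset[OF continuous_on_ang[of y a]]) (use assms in auto)
qed

lemma ang_nonpos: "0 \<le> x \<Longrightarrow> ang a x \<le> 0"
  using ang_strict_decreasing[of 0 x a] by (cases "x = 0") auto

text \<open>Rotating (Y, Q) back by the angle gives (A, B), and both components satisfy the same
  scalar equation as the radius \<open>sqrt (S x)\<close>. The quotients are therefore constant,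
  equal to 1 and 0 as at the origin. Only the cosine component is recorded: it decides the zeros and
  the sign of Y.\<close>

lemma polar:
  assumes X: "0 \<le> X"
  shows "Y a X = sqrt ((Y a X)\<^sup>2 + (Q a X)\<^sup>2) * cos (ang a X)"
proof -
  define S where "S x = (Y a x)\<^sup>2 + (Q a x)\<^sup>2" for x
  define k where "k x = (Y a x * V a x - coeff a x * Y a x * Q a x) / S x" for x
  define A where "A x = Y a x * cos (ang a x) + Q a x * sin (ang a x)" for x
  define B where "B x = Q a x * cos (ang a x) - Y a x * sin (ang a x)" for x
  have S: "S x > 0" if "0 \<le> x" for x using Y_Q_nonzero[OF that] by (simp add: S_def)
  have *: "((\<lambda>x. A x / sqrt (S x)) has_real_derivative 0) (at x within {0..X})"
    "((\<lambda>x. B x / sqrt (S x)) has_real_derivative 0) (at x within {0..X})" if x: "x \<in> {0..X}" for x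
  proof -
    have x0: "0 \<le> x" using x by simp
    note d [derivative_intros] = DERIV_ang[OF x, of a]
      has_field_derivative_at_within[OF deriv_Y[OF x0, of a], of "{0..X}"]
      has_field_derivative_at_within[OF DERIV_Q[OF x0, of a], of "{0..X}"]
    have t: "ang' a x = - (coeff a x * Y a x * Y a x + V a x * Q a x) / S x"
      by (simp add: ang'_def S_def power2_eq_square)
    \<comment> \<open>With the rotation removed, the velocity of (Y, Q) is purely radial, with rate
      \<open>k x\<close>.\<close>
    have i: "V a x + Q a x * ang' a x = Y a x * k x"
      "- coeff a x * Y a x - Y a x * ang' a x = Q a x * k x"
    proof -
      have s: "S x \<noteq> 0" "S x = Y a x * Y a x + Q a x * Q a x"
        using S[OF x0] by (linarith, simp add: S_def power2_eq_square)
      have "v + q * (- (c * y * y + v * q) / s) = y * ((y * v - c * y * q) / s)"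
        "- c * y - y * (- (c * y * y + v * q) / s) = q * ((y * v - c * y * q) / s)"
        if "s \<noteq> 0" "s = y * y + q * q" for s v q c y :: real
      proof -
        have "v * s + q * (- (c * y * y + v * q)) = y * (y * v - c * y * q)"
          "- c * y * s - y * (- (c * y * y + v * q)) = q * (y * v - c * y * q)"
          unfolding that(2) by algebra+
        then show "v + q * (- (c * y * y + v * q) / s) = y * ((y * v - c * y * q) / s)"
          "- c * y - y * (- (c * y * y + v * q) / s) = q * ((y * v - c * y * q) / s)"
          using that(1) by (simp_all add: divide_simps mult.commute)
      qed
      from this[OF s] show "V a x + Q a x * ang' a x = Y a x * k x"
        "- coeff a x * Y a x - Y a x * ang' a x = Q a x * k x"
        unfolding t k_def by blast+
    qed
    have "(A has_real_derivative (V a x + Q a x * ang' a x) * cos (ang a x)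
        + (- coeff a x * Y a x - Y a x * ang' a x) * sin (ang a x)) (at x within {0..X})"
      unfolding A_def by (auto intro!: derivative_eq_intros d simp: algebra_simps)
    then have A: "(A has_real_derivative k x * A x) (at x within {0..X})"
      unfolding i by (simp add: A_def algebra_simps)
    have "(B has_real_derivative (- coeff a x * Y a x - Y a x * ang' a x) * cos (ang a x)
        - (V a x + Q a x * ang' a x) * sin (ang a x)) (at x within {0..X})"
      unfolding B_def by (auto intro!: derivative_eq_intros d simp: algebra_simps)
    then have B: "(B has_real_derivative k x * B x) (at x within {0..X})"
      unfolding i by (simp add: B_def algebra_simps)
    have dS: "(S has_real_derivative 2 * k x * S x) (at x within {0..X})"
    proof -
      have "(S has_real_derivative 2 * (Y a x * V a x - coeff a x * Y a x * Q a x)) (at x within {0..X})"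
        unfolding S_def by (auto intro!: derivative_eq_intros d simp: algebra_simps)
      then show ?thesis using S[OF x0] by (simp add: k_def)
    qed
    have r: "S x / sqrt (S x) = sqrt (S x)" by (rule real_div_sqrt[OF less_imp_le[OF S[OF x0]]])
    have "inverse r / 2 * (2 * k x * S x) = k x * (S x / r)" for r
      by (simp add: inverse_eq_divide)
    from this[of "sqrt (S x)", unfolded r]
    have e: "inverse (sqrt (S x)) / 2 * (2 * k x * S x) = k x * sqrt (S x)" .
    have sq: "((\<lambda>x. sqrt (S x)) has_real_derivative k x * sqrt (S x)) (at x within {0..X})"
      using DERIV_chain2[where f = sqrt and g = S, OF DERIV_real_sqrt[OF S[OF x0]] dS] unfolding e .
    have nz: "sqrt (S x) \<noteq> 0" using S[OF x0] by simp
    show "((\<lambda>x. A x / sqrt (S x)) has_real_derivative 0) (at x within {0..X})"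
      using DERIV_divide[OF A sq nz] by (simp add: mult_ac)
    show "((\<lambda>x. B x / sqrt (S x)) has_real_derivative 0) (at x within {0..X})"
      using DERIV_divide[OF B sq nz] by (simp add: mult_ac)
  qed
  obtain c1 where c1: "\<forall>x\<in>{0..X}. A x / sqrt (S x) = c1"
    using has_field_derivative_zero_constant[OF convex_real_interval(5) *(1)] by blast
  obtain c2 where c2: "\<forall>x\<in>{0..X}. B x / sqrt (S x) = c2"
    using has_field_derivative_zero_constant[OF convex_real_interval(5) *(2)] by blast
  have "c1 = 1" "c2 = 0" using bspec[OF c1, of 0] bspec[OF c2, of 0] X by (simp_all add: A_def B_def S_def)
  moreover have "X \<in> {0..X}" using X by simp
  ultimately have "A X / sqrt (S X) = 1" "B X / sqrt (S X) = 0"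
    using bspec[OF c1, of X] bspec[OF c2, of X] by blast+
  then have AB: "A X = sqrt (S X)" "B X = 0"
    using real_sqrt_gt_zero[OF S[OF X]] by (auto simp only: divide_eq_eq mult_1 divide_eq_0_iff)
  have "A X * cos (ang a X) - B X * sin (ang a X) = Y a X * ((cos (ang a X))\<^sup>2 + (sin (ang a X))\<^sup>2)"
    unfolding A_def B_def by algebra
  then show ?thesis unfolding AB by (simp add: S_def)
qed

text \<open>The angle starts at 0 and decreases, so Y vanishes when it passes an odd multiple of
  -pi/2; counting from 0, \<open>level i\<close> belongs to zero number i + 1.\<close>

definition level :: "nat \<Rightarrow> real" where "level i = - (pi / 2) - real i * pi"

lemma Y_eq_0_iff:
  assumes x: "0 \<le> x"
  shows "Y a x = 0 \<longleftrightarrow> (\<exists>i. ang a x = level i)"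
proof -
  have "Y a x = 0 \<longleftrightarrow> cos (ang a x) = 0"
  proof -
    have "sqrt ((Y a x)\<^sup>2 + (Q a x)\<^sup>2) \<noteq> 0"
      using real_sqrt_gt_zero[OF Y_Q_nonzero[OF x, of a]] by linarith
    then show ?thesis using polar[OF x, of a] by (metis mult_eq_0_iff)
  qed
  also have "\<dots> \<longleftrightarrow> (\<exists>i. ang a x = level i)"
  proof
    assume "cos (ang a x) = 0"
    then obtain i where i: "odd i" "ang a x = of_int i * (pi / 2)"
      using cos_zero_iff_int by blast
    have "of_int i * (pi / 2) \<le> 0" using i ang_nonpos[OF x, of a] by simp
    have "i \<le> 0"
    proof (rule ccontr)
      assume "\<not> i \<le> 0"
      then have "0 < of_int i * (pi / 2)" by simp
      then show False using \<open>of_int i * (pi / 2) \<le> 0\<close> by linarith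
    qed
    obtain j where j: "i = 2 * j + 1" using i(1) by (elim oddE)
    have "j < 0" using \<open>i \<le> 0\<close> j by linarith
    have "ang a x = level (nat (- j - 1))"
      using i(2) \<open>j < 0\<close> by (simp add: level_def j algebra_simps)
    then show "\<exists>i. ang a x = level i" by blast
  next
    assume "\<exists>i. ang a x = level i"
    then obtain i where "ang a x = level i" by blast
    then show "cos (ang a x) = 0"
      by (simp add: level_def cos_diff sin_pi_half cos_pi_half sin_npi sin_npi2)
  qed
  finally show ?thesis .
qed

definition zeros where "zeros a = {x. 0 \<le> x \<and> Y a x = 0}"

text \<open>The zeros in [0, X] correspond to the levels that are at least \<open>ang a X\<close>,
  and these form an initial segment. The inequality is strict since a zero at X itself
  counts.\<close>

lemma zeros_upto:
  assumes X: "0 \<le> X"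
  shows "finite (zeros a \<inter> {..X})" and "card (zeros a \<inter> {..X}) \<le> m \<longleftrightarrow> level m < ang a X"
proof -
  define N where "N = {i. ang a X \<le> level i}"
  define Z where "Z = zeros a \<inter> {..X}"
  have "inj_on (ang a) Z"
    by (rule inj_onI) (metis IntE Z_def zeros_def mem_Collect_eq ang_strict_decreasing linorder_neqE_linordered_idom order_less_irrefl)
  moreover have img: "ang a ` Z = level ` N"
  proof (intro equalityI subsetI)
    fix t assume "t \<in> ang a ` Z"
    then obtain x where x: "0 \<le> x" "x \<le> X" "Y a x = 0" "t = ang a x" by (auto simp: Z_def zeros_def)
    then obtain i where "ang a x = level i" using Y_eq_0_iff by blast
    moreover have "ang a X \<le> ang a x" using x ang_strict_decreasing[of x X a] by (cases "x = X") auto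
    ultimately show "t \<in> level ` N" using x by (auto simp: N_def)
  next
    fix t assume "t \<in> level ` N"
    then obtain i where i: "t = level i" "ang a X \<le> level i" by (auto simp: N_def)
    have "0 \<le> real i * pi" by simp
    then have "level i \<le> ang a 0" using pi_gt_zero unfolding level_def ang_0 by linarith
    then obtain x where "0 \<le> x" "x \<le> X" "ang a x = level i"
      using IVT2'[of "ang a" X "level i" 0] i X continuous_on_ang by blast
    then show "t \<in> ang a ` Z" using i Y_eq_0_iff by (auto simp: Z_def zeros_def intro!: image_eqI[of _ _ x])
  qed
  moreover have injl: "inj_on level N" by (auto simp: inj_on_def level_def)
  obtain n where n: "real n * pi > - ang a X" using reals_Archimedean3[of pi] by auto
  have subn: "N \<subseteq> {..<n}"
  proof
    fix i assume "i \<in> N"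
    then have "ang a X \<le> - (pi / 2) - real i * pi" by (simp add: N_def level_def)
    then have "real i * pi < real n * pi" using n pi_gt_zero by linarith
    then show "i \<in> {..<n}" by simp
  qed
  then have finN: "finite N" using finite_subset by blast
  ultimately have "finite Z" using finite_imageD[of "ang a" Z] by simp
  then show "finite (zeros a \<inter> {..X})" by (simp add: Z_def)
  have "card Z = card N"
    using card_image[OF \<open>inj_on (ang a) Z\<close>] card_image[OF injl] img by simp
  moreover have "card N \<le> m \<longleftrightarrow> m \<notin> N"
  proof
    assume c: "card N \<le> m"
    show "m \<notin> N"
    proof
      assume m: "m \<in> N"
      have "{..m} \<subseteq> N"
      proof
        fix i assume "i \<in> {..m}"
        then have "real i * pi \<le> real m * pi" by (intro mult_right_mono) auto
        then show "i \<in> N" using m unfolding N_def level_def mem_Collect_eq by linarith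
      qed
      then have "card {..m} \<le> card N" using finN by (rule card_mono[rotated])
      then show False using c by simp
    qed
  next
    assume m: "m \<notin> N"
    have "N \<subseteq> {..<m}"
    proof
      fix i assume i: "i \<in> N"
      show "i \<in> {..<m}"
      proof (rule ccontr)
        assume "i \<notin> {..<m}"
        then have "real m * pi \<le> real i * pi" by (intro mult_right_mono) auto
        then show False using i m unfolding N_def level_def mem_Collect_eq by linarith
      qed
    qed
    then show "card N \<le> m" using card_mono[of "{..<m}" N] by simp
  qed
  ultimately show "card (zeros a \<inter> {..X}) \<le> m \<longleftrightarrow> level m < ang a X"
    by (simp add: Z_def N_def not_le)
qed

text \<open>Finiteness is demanded separately because \<open>card\<close> of an infinite set is
  0.\<close>

definition atmost where "atmost m = {a. finite (zeros a) \<and> card (zeros a) \<le> m}"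

lemma atmost_mono: "m \<le> n \<Longrightarrow> atmost m \<subseteq> atmost n"
  by (auto simp: atmost_def)

lemma card_zeros_inter_le: "a \<in> atmost m \<Longrightarrow> card (zeros a \<inter> S) \<le> m"
  using card_mono[of "zeros a" "zeros a \<inter> S"] by (auto simp: atmost_def)

text \<open>Strict monotonicity of the angle turns the strict bound for every X into a non-strict
  one, which is a closed condition on \<open>a\<close>.\<close>

lemma atmost_iff: "a \<in> atmost m \<longleftrightarrow> (\<forall>X\<ge>0. level m \<le> ang a X)"
proof -
  have "a \<in> atmost m \<longleftrightarrow> (\<forall>X\<ge>0. card (zeros a \<inter> {..X}) \<le> m)"
  proof
    show "\<forall>X\<ge>0. card (zeros a \<inter> {..X}) \<le> m" if "a \<in> atmost m"
      using card_zeros_inter_le[OF that] by blast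
  next
    assume *: "\<forall>X\<ge>0. card (zeros a \<inter> {..X}) \<le> m"
    show "a \<in> atmost m"
    proof (rule ccontr)
      assume "a \<notin> atmost m"
      then have "infinite (zeros a) \<or> Suc m \<le> card (zeros a)" by (auto simp: atmost_def)
      then have "\<exists>F. F \<subseteq> zeros a \<and> finite F \<and> card F = Suc m"
      proof
        assume "infinite (zeros a)"
        then show ?thesis using infinite_arbitrarily_large[of "zeros a" "Suc m"] by blast
      next
        assume "Suc m \<le> card (zeros a)"
        then show ?thesis by (rule obtain_subset_with_card_n) blast
      qed
      then obtain F where F: "F \<subseteq> zeros a" "finite F" "card F = Suc m" by blast
      then have "F \<noteq> {}" by auto
      with F have M: "Max F \<in> F" by simp
      then have "0 \<le> Max F" using F(1) by (auto simp: zeros_def)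
      moreover have "F \<subseteq> zeros a \<inter> {..Max F}" using F by auto
      ultimately have "Suc m \<le> card (zeros a \<inter> {..Max F})"
        using card_mono[OF zeros_upto(1)] F(3) by metis
      then show False using *[rule_format, OF \<open>0 \<le> Max F\<close>] by simp
    qed
  qed
  also have "\<dots> \<longleftrightarrow> (\<forall>X\<ge>0. level m < ang a X)" using zeros_upto(2) by simp
  also have "\<dots> \<longleftrightarrow> (\<forall>X\<ge>0. level m \<le> ang a X)"
  proof
    assume *: "\<forall>X\<ge>0. level m \<le> ang a X"
    show "\<forall>X\<ge>0. level m < ang a X"
    proof (intro allI impI)
      fix X :: real assume X: "0 \<le> X"
      have "level m \<le> ang a (X + 1)" using * X by simp
      also have "\<dots> < ang a X" using X by (intro ang_strict_decreasing) auto
      finally show "level m < ang a X" .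
    qed
  qed (auto intro: less_imp_le)
  finally show ?thesis .
qed

text \<open>In a limit of parameters zeros may escape to infinity, but none can be created.\<close>

lemma closed_atmost: "closed (atmost m)"
proof -
  have "atmost m = (\<Inter>X\<in>{0..}. {a. level m \<le> ang a X})" by (auto simp: atmost_iff)
  also have "closed \<dots>"
    by (intro closed_INT ballI closed_Collect_le continuous_on_ang_param continuous_intros) auto
  finally show ?thesis .
qed

text \<open>Any surplus zero of a nearby solution must lie beyond X. Openness questions are thereby
  reduced to the behaviour after a fixed late point, which \<open>atmost_by_tail\<close> then
  evaluates.\<close>

lemma eventually_card_zeros_upto:
  assumes "a \<in> atmost m" "0 \<le> X"
  shows "\<forall>\<^sub>F b in nhds a. card (zeros b \<inter> {..X}) \<le> m"
proof -
  have "card (zeros a \<inter> {..X}) \<le> m"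
    by (rule card_zeros_inter_le[OF assms(1)])
  then have "level m < ang a X" using zeros_upto(2)[OF assms(2)] by simp
  moreover have "((\<lambda>b. ang b X) \<longlongrightarrow> ang a X) (nhds a)"
    using continuous_on_ang_param[OF assms(2)] tendsto_at_iff_tendsto_nhds[of "\<lambda>b. ang b X" a]
    by (auto simp: continuous_on_eq_continuous_at isCont_def)
  ultimately have "\<forall>\<^sub>F b in nhds a. level m < ang b X" by (rule order_tendstoD(1)[rotated])
  then show ?thesis using zeros_upto(2)[OF assms(2)] by simp
qed

lemma atmost_by_tail:
  assumes X: "0 \<le> X" and c: "card (zeros a \<inter> {..X}) \<le> m"
  shows "(\<And>x. X < x \<Longrightarrow> Y a x \<noteq> 0) \<Longrightarrow> a \<in> atmost m"
    and "(\<And>x y. X < x \<Longrightarrow> x < y \<Longrightarrow> Y a x = 0 \<Longrightarrow> Y a y \<noteq> 0) \<Longrightarrow> a \<in> atmost (Suc m)"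
proof -
  assume "\<And>x. X < x \<Longrightarrow> Y a x \<noteq> 0"
  then have "zeros a = zeros a \<inter> {..X}" by (auto simp: zeros_def not_less[symmetric])
  then show "a \<in> atmost m" using c zeros_upto(1)[OF X, of a] by (simp add: atmost_def)
next
  assume *: "\<And>x y. X < x \<Longrightarrow> x < y \<Longrightarrow> Y a x = 0 \<Longrightarrow> Y a y \<noteq> 0"
  have "\<exists>z. zeros a \<subseteq> insert z (zeros a \<inter> {..X})"
  proof (cases "\<exists>z>X. Y a z = 0")
    case True
    then obtain z where "X < z" "Y a z = 0" by blast
    then have "zeros a \<subseteq> insert z (zeros a \<inter> {..X})"
      using * by (auto simp: zeros_def) (metis linorder_cases not_less)
    then show ?thesis by blast
  next
    case False
    then have "zeros a \<subseteq> insert X (zeros a \<inter> {..X})" by (force simp: zeros_def not_less[symmetric])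
    then show ?thesis by blast
  qed
  then obtain z where z: "zeros a \<subseteq> insert z (zeros a \<inter> {..X})" by blast
  have fin: "finite (insert z (zeros a \<inter> {..X}))" using zeros_upto(1)[OF X] by simp
  have "card (zeros a) \<le> card (insert z (zeros a \<inter> {..X}))" using z fin by (rule card_mono[rotated])
  also have "\<dots> \<le> Suc m" using c fin by (simp add: card_insert_if)
  finally show "a \<in> atmost (Suc m)" using finite_subset[OF z fin] by (simp add: atmost_def)
qed

end

section \<open>Growth and tail estimates in the logarithmic variable\<close>

lemma first_nonneg:
  fixes f :: "real \<Rightarrow> real"
  assumes cont: "continuous_on {a..b} f" and "a \<le> b" and fa: "f a < 0" and fb: "0 \<le> f b"
  obtains c where "a < c" "c \<le> b" "f c = 0" "\<And>t. a \<le> t \<Longrightarrow> t < c \<Longrightarrow> f t < 0"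
proof -
  define S where "S = {a..b} \<inter> f -` {0..}"
  have "closed S" unfolding S_def
    by (intro continuous_closed_preimage cont) auto
  moreover have "bounded S" unfolding S_def by (rule bounded_subset[of "{a..b}"]) auto
  moreover have "b \<in> S" using assms by (simp add: S_def)
  ultimately obtain c where c: "c \<in> S" "\<And>t. t \<in> S \<Longrightarrow> c \<le> t"
    using compact_attains_inf[of S] by (auto simp: compact_eq_bounded_closed)
  have ab: "a \<le> c" "c \<le> b" "0 \<le> f c" using c(1) by (auto simp: S_def)
  have neg: "f t < 0" if "a \<le> t" "t < c" for t
    using c(2)[of t] that ab by (force simp: S_def)
  have "a \<noteq> c" using fa ab by auto
  have "f c = 0"
  proof (rule ccontr)
    assume "f c \<noteq> 0"
    then have "0 < f c" using ab by simp
    have "continuous_on {a..c} f" using cont ab by (auto intro: continuous_on_subset)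
    then obtain t where "a \<le> t" "t \<le> c" "f t = 0"
      using IVT'[of f a 0 c] fa ab by auto
    then show False using neg[of t] \<open>0 < f c\<close> by (cases "t = c") auto
  qed
  then show thesis using that[of c] ab \<open>a \<noteq> c\<close> neg by simp
qed

text \<open>\<open>r\<close> is the slope of \<open>f\<close> with respect to ln x; all tail
  estimates are made in this variable.\<close>

lemma log_growth_le:
  fixes f r :: "real \<Rightarrow> real"
  assumes X: "0 < X" "X \<le> x"
    and f: "\<And>t. X \<le> t \<Longrightarrow> t \<le> x \<Longrightarrow> (f has_real_derivative r t / t) (at t)"
    and r: "\<And>t. X \<le> t \<Longrightarrow> t \<le> x \<Longrightarrow> r t \<le> q"
  shows "f x \<le> f X + q * (ln x - ln X)"
proof -
  have "f x - q * ln x \<le> f X - q * ln X"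
  proof (rule DERIV_nonpos_imp_nonincreasing[OF X(2), of "\<lambda>x. f x - q * ln x"])
    fix t assume t: "X \<le> t" "t \<le> x"
    have t0: "0 < t" using t X by simp
    then have "((\<lambda>x. q * ln x) has_real_derivative q / t) (at t)"
      by (auto intro!: derivative_eq_intros)
    from DERIV_diff[OF f[OF t] this]
    show "\<exists>y. ((\<lambda>x. f x - q * ln x) has_real_derivative y) (at t) \<and> y \<le> 0"
      using r[OF t] t0 by (intro exI[of _ "r t / t - q / t"]) (simp add: divide_right_mono)
  qed
  then show ?thesis by (simp add: algebra_simps)
qed

text \<open>A negative slope with respect to ln x that never increases would drive \<open>f\<close>
  down to 0 in finite time.\<close>

lemma nonneg_slope_of_positive_tail:
  fixes f r :: "real \<Rightarrow> real"
  assumes x: "0 < x"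
    and f: "\<And>t. x \<le> t \<Longrightarrow> (f has_real_derivative r t / t) (at t)"
    and r: "\<And>t. x \<le> t \<Longrightarrow> r t \<le> r x"
    and pos: "\<And>t. x \<le> t \<Longrightarrow> 0 < f t"
  shows "0 \<le> r x"
proof (rule ccontr)
  assume "\<not> 0 \<le> r x"
  then have neg: "r x < 0" by simp
  \<comment> \<open>The point where the line in ln x through (x, f x) with slope \<open>r x\<close>
    reaches 0.\<close>
  define y where "y = x * exp (f x / (- r x))"
  have "0 \<le> f x / (- r x)" by (rule divide_nonneg_pos) (use neg pos[of x] in simp_all)
  then have "1 \<le> exp (f x / (- r x))" by (simp only: one_le_exp_iff)
  then have y: "x \<le> y" using x by (simp add: y_def)
  have "f y \<le> f x + r x * (ln y - ln x)"
    by (rule log_growth_le[OF x y f r])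
  also have "ln y - ln x = f x / (- r x)" using x by (simp add: y_def ln_mult)
  finally have "f y \<le> 0" using neg by simp
  then show False using pos[OF y] by simp
qed

context shooting
begin

lemma continuous_on_W: "continuous_on S (W a)" and continuous_on_R: "continuous_on S (R a)"
  by (intro continuous_intros)+

lemma W_le: "0 \<le> x \<Longrightarrow> W a x \<le> a + \<mu> / 2 * ln (1 + x)"
  using aY_le[of x a] by (simp add: W_def)

lemma W_R_nonzero: "a \<noteq> 0 \<Longrightarrow> 0 \<le> x \<Longrightarrow> W a x = 0 \<Longrightarrow> R a x \<noteq> 0"
  using Y_Q_nonzero[of x a] by (auto simp: W_def R_def)

text \<open>Since e^(2W) is nonnegative, R' is at most \<open>\<mu>\<close> / 2 / (1 + t)^2. After X
  the quantity R can thus gain at most \<open>\<mu>\<close> / 2 / (1 + X), whatever W does.\<close>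

lemma R_growth:
  assumes "0 \<le> X" "X \<le> x"
  shows "R a x \<le> R a X + \<mu> / 2 / (1 + X) - \<mu> / 2 / (1 + x)"
proof -
  define f where "f x = - (\<mu> / 2 / (1 + x)) - R a x" for x
  have "f X \<le> f x"
  proof (rule DERIV_nonneg_imp_nondecreasing[OF assms(2), of f])
    fix t assume t: "X \<le> t" "t \<le> x"
    have t0: "0 \<le> t" using t assms by simp
    have "((\<lambda>x. - (\<mu> / 2 / (1 + x))) has_real_derivative \<mu> / 2 / (1 + t)\<^sup>2) (at t)"
    proof -
      have "-1 < t" using t0 by simp
      from DERIV_cmult[OF DERIV_reciprocal_plus1[OF this], of "- (\<mu> / 2)"] show ?thesis by (simp add: mult.commute)
    qed
    from DERIV_diff[OF this DERIV_R[OF t0, of a]]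
    have "(f has_real_derivative \<mu> / 2 / (1 + t)\<^sup>2 - - (\<mu> / 2 / (1 + t)\<^sup>2) * (exp (2 * W a t) - 1)) (at t)"
      unfolding f_def .
    moreover have "k - - k * (e - 1) = k * e" for k e :: real by (simp add: algebra_simps)
    ultimately have "(f has_real_derivative \<mu> / 2 / (1 + t)\<^sup>2 * exp (2 * W a t)) (at t)" by metis
    moreover have "0 \<le> \<mu> / 2 / (1 + t)\<^sup>2 * exp (2 * W a t)" using mu_pos by simp
    ultimately show "\<exists>y. (f has_real_derivative y) (at t) \<and> 0 \<le> y" by blast
  qed
  then show ?thesis by (simp add: f_def)
qed

text \<open>The counterpart for the downward pull, which is at most \<open>\<mu>\<close> / 2 times E
  / t^2. It controls R just after a crossing, and the decay of R when read from infinity.\<close>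

lemma R_lower:
  assumes X: "0 < X" "X \<le> x" and E: "\<And>t. X \<le> t \<Longrightarrow> t \<le> x \<Longrightarrow> exp (2 * W a t) \<le> E"
  shows "R a X - \<mu> / 2 * E * (1 / X) \<le> R a x - \<mu> / 2 * E * (1 / x)"
proof (rule DERIV_nonneg_imp_nondecreasing[OF X(2), of "\<lambda>t. R a t - \<mu> / 2 * E * (1 / t)"])
  fix t assume t: "X \<le> t" "t \<le> x"
  have t0: "0 < t" using t X by simp
  have E0: "0 \<le> E" using E[OF t] exp_ge_zero[of "2 * W a t"] by linarith
  have "exp (2 * W a t) - 1 \<le> E" using E[OF t] by linarith
  then have "\<mu> / 2 / (1 + t)\<^sup>2 * (exp (2 * W a t) - 1) \<le> \<mu> / 2 / (1 + t)\<^sup>2 * E"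
    using mu_pos by (intro mult_left_mono) auto
  also have "\<dots> \<le> \<mu> / 2 / t\<^sup>2 * E"
    using mu_pos t0 E0 by (intro mult_right_mono divide_left_mono power_mono) auto
  finally have "0 \<le> - (\<mu> / 2 / (1 + t)\<^sup>2) * (exp (2 * W a t) - 1) - \<mu> / 2 * E * - (1 / t\<^sup>2)"
    by simp
  then show "\<exists>y. ((\<lambda>t. R a t - \<mu> / 2 * E * (1 / t)) has_real_derivative y) (at t) \<and> 0 \<le> y"
    using DERIV_diff[OF DERIV_R[OF less_imp_le[OF t0], of a]
        DERIV_cmult[OF DERIV_reciprocal[OF t0], of "\<mu> / 2 * E"]] by blast
qed

lemma R_le: "0 \<le> x \<Longrightarrow> R a x \<le> \<mu> / 2"
proof -
  assume x: "0 \<le> x"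
  have "0 \<le> \<mu> / 2 / (1 + x)" using mu_pos x by simp
  then show ?thesis using R_growth[of 0 x a] x by simp
qed

lemma R_decreasing:
  assumes "0 \<le> X" "X \<le> x" and "\<And>t. X \<le> t \<Longrightarrow> t \<le> x \<Longrightarrow> 0 \<le> W a t"
  shows "R a x \<le> R a X"
proof (rule DERIV_nonpos_imp_nonincreasing[OF assms(2), of "R a"])
  fix t assume t: "X \<le> t" "t \<le> x"
  have "- (\<mu> / 2 / (1 + t)\<^sup>2) * (exp (2 * W a t) - 1) \<le> 0"
    using assms(3)[OF t] mu_pos by (intro mult_nonpos_nonneg) auto
  then show "\<exists>y. (R a has_real_derivative y) (at t) \<and> y \<le> 0"
    using DERIV_R[of t a] t assms by force
qed

lemma R_increasing:
  assumes "0 \<le> X" "X \<le> x" and "\<And>t. X \<le> t \<Longrightarrow> t \<le> x \<Longrightarrow> W a t \<le> 0"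
  shows "R a X \<le> R a x"
proof (rule DERIV_nonneg_imp_nondecreasing[OF assms(2), of "R a"])
  fix t assume t: "X \<le> t" "t \<le> x"
  have "0 \<le> - (\<mu> / 2 / (1 + t)\<^sup>2) * (exp (2 * W a t) - 1)"
    using assms(3)[OF t] mu_pos by (intro mult_nonpos_nonpos) auto
  then show "\<exists>y. (R a has_real_derivative y) (at t) \<and> 0 \<le> y"
    using DERIV_R[of t a] t assms by force
qed

lemma W_log_le:
  assumes "0 < X" "X \<le> x" and "\<And>t. X \<le> t \<Longrightarrow> t \<le> x \<Longrightarrow> R a t \<le> q"
  shows "W a x \<le> W a X + q * (ln x - ln X)"
  by (rule log_growth_le[OF assms(1,2) DERIV_W assms(3)]) (use assms(1) in auto)

lemma W_log_ge:
  assumes "0 < X" "X \<le> x" and "\<And>t. X \<le> t \<Longrightarrow> t \<le> x \<Longrightarrow> q \<le> R a t"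
  shows "W a X + q * (ln x - ln X) \<le> W a x"
proof -
  have "- W a x \<le> - W a X + - q * (ln x - ln X)"
    by (rule log_growth_le[OF assms(1,2) DERIV_minus_W]) (use assms in auto)
  then show ?thesis by simp
qed

lemma W_strict_increasing:
  assumes "0 < X" "X < x" and "\<And>t. X \<le> t \<Longrightarrow> t \<le> x \<Longrightarrow> 0 < R a t"
  shows "W a X < W a x"
proof (rule DERIV_pos_imp_increasing[OF assms(2), of "W a"])
  fix t assume t: "X \<le> t" "t \<le> x"
  then show "\<exists>y. (W a has_real_derivative y) (at t) \<and> 0 < y"
    using DERIV_W[of t a] assms(1) assms(3)[OF t] by (intro exI[of _ "R a t / t"]) simp
qed

lemma W_strict_decreasing:
  assumes "0 < X" "X < x" and "\<And>t. X \<le> t \<Longrightarrow> t \<le> x \<Longrightarrow> R a t < 0"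
  shows "W a x < W a X"
proof (rule DERIV_neg_imp_decreasing[OF assms(2), of "W a"])
  fix t assume t: "X \<le> t" "t \<le> x"
  then show "\<exists>y. (W a has_real_derivative y) (at t) \<and> y < 0"
    using DERIV_W[of t a] assms(1) assms(3)[OF t]
    by (intro exI[of _ "R a t / t"]) (simp add: divide_neg_pos)
qed

text \<open>Escape to \<open>-\<infinity>\<close>: the remaining upward push is at most \<open>\<mu> / 2 / (1 + X)\<close>.\<close>

lemma tail_negative:
  assumes X: "0 < X" "W a X \<le> 0" and R: "R a X \<le> - (\<mu> / 2 / (1 + X))" and x: "X < x"
  shows "W a x < 0"
proof -
  have "R a t < 0" if "X \<le> t" for t
  proof -
    have "0 < \<mu> / 2 / (1 + t)" using mu_pos that X by simp
    then show ?thesis using R_growth[of X t a] X R that by linarith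
  qed
  then have "W a x < W a X" using W_strict_decreasing[OF X(1) x] by blast
  then show ?thesis using X by simp
qed

text \<open>Escape to \<open>+\<infinity>\<close> with slope below \<open>1/2\<close>: the remaining downward pull is integrable and
  bounded by the quantity in the last assumption.\<close>

lemma tail_positive:
  assumes X: "0 < X" "0 \<le> W a X" and q: "0 < R a X" "R a X < 1 / 2"
    and small: "\<mu> / 2 * (exp (2 * W a X) / (1 - 2 * R a X) - 1) < X * R a X"
    and x: "X < x"
  shows "0 < W a x"
proof -
  define q0 where "q0 = R a X"
  define K where "K = exp (2 * W a X) / (1 - 2 * q0)"
  have K1: "1 \<le> K"
  proof -
    have "1 - 2 * q0 \<le> 1" "1 \<le> exp (2 * W a X)" using q X by (simp_all add: q0_def)
    then have "1 - 2 * q0 \<le> exp (2 * W a X)" by linarith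
    then show ?thesis using q by (simp add: K_def q0_def le_divide_eq)
  qed
  have pos: "0 < R a y" if y: "X \<le> y" for y
  proof (rule ccontr)
    assume "\<not> 0 < R a y"
    then have "0 \<le> - R a y" by simp
    moreover have "continuous_on {X..y} (\<lambda>x. - R a x)" by (intro continuous_intros)
    ultimately obtain c where c: "X < c" "c \<le> y" "- R a c = 0" "\<And>t. X \<le> t \<Longrightarrow> t < c \<Longrightarrow> - R a t < 0"
      using first_nonneg[of X y "\<lambda>x. - R a x"] y q(1) by auto
    have Rpos: "0 \<le> R a t" if "X \<le> t" "t \<le> c" for t
      using c(3) c(4)[of t] that by (cases "t = c") auto
    have Wpos: "W a X \<le> W a t" if "X \<le> t" "t \<le> c" for t
      using W_log_ge[of X t 0 a] X that Rpos by auto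
    have Rle: "R a t \<le> q0" if "X \<le> t" "t \<le> c" for t
      unfolding q0_def by (rule R_decreasing) (use X that Wpos in force)+
    have Wle: "W a t \<le> W a X + q0 * (ln t - ln X)" if "X \<le> t" "t \<le> c" for t
      by (rule W_log_le) (use X that Rle in auto)
    \<comment> \<open>An antiderivative of the majorant of the pull, in which W is replaced by its
      upper bound with constant slope \<open>q0\<close>. The growth (t/X)^(2 q0) / t^2 is integrable
      because 2 q0 < 1, and \<open>K\<close> is the constant for which K (1 - 2 q0) = e^(2
      W(X)).\<close>
    define G where "G t = \<mu> / 2 * (1 - K * exp (2 * q0 * (ln t - ln X))) / t" for t
    have "R a X + G X \<le> R a c + G c"
    proof (rule DERIV_nonneg_imp_nondecreasing[of X c "\<lambda>t. R a t + G t"])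
      fix t assume t: "X \<le> t" "t \<le> c"
      have t0: "0 < t" using t X by simp
      define e where "e = exp (2 * q0 * (ln t - ln X))"
      have "((\<lambda>t. exp (2 * q0 * (ln t - ln X))) has_real_derivative e * (2 * q0 / t)) (at t)"
        unfolding e_def using t0 by (auto intro!: derivative_eq_intros)
      from DERIV_cmult[OF DERIV_diff[OF DERIV_const[of 1] DERIV_cmult[OF this, of K]], of "\<mu> / 2"]
      have "((\<lambda>t. \<mu> / 2 * (1 - K * exp (2 * q0 * (ln t - ln X)))) has_real_derivative
          \<mu> / 2 * (0 - K * (e * (2 * q0 / t)))) (at t)" .
      from DERIV_divide[OF this DERIV_ident] t0
      have "(G has_real_derivative (\<mu> / 2 * (0 - K * (e * (2 * q0 / t))) * t - \<mu> / 2 * (1 - K * e) * 1) / (t * t)) (at t)"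
        unfolding G_def[abs_def] e_def by simp
      also have "(\<mu> / 2 * (0 - K * (e * (2 * q0 / t))) * t - \<mu> / 2 * (1 - K * e) * 1) / (t * t)
          = \<mu> / 2 / t\<^sup>2 * (K * (1 - 2 * q0) * e - 1)"
        using t0 by (simp add: power2_eq_square field_simps)
      also have "K * (1 - 2 * q0) * e = exp (2 * (W a X + q0 * (ln t - ln X)))"
      proof -
        have "K * (1 - 2 * q0) = exp (2 * W a X)" using q by (simp add: K_def q0_def)
        then have "K * (1 - 2 * q0) * e = exp (2 * W a X) * e" by (simp only:)
        also have "\<dots> = exp (2 * W a X + 2 * q0 * (ln t - ln X))" by (simp only: e_def exp_add)
        also have "2 * W a X + 2 * q0 * (ln t - ln X) = 2 * (W a X + q0 * (ln t - ln X))"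
          by (simp only: distrib_left mult.assoc)
        finally show ?thesis .
      qed
      finally have dG: "(G has_real_derivative \<mu> / 2 / t\<^sup>2 * (exp (2 * (W a X + q0 * (ln t - ln X))) - 1)) (at t)" .
      have "\<mu> / 2 / (1 + t)\<^sup>2 * (exp (2 * W a t) - 1)
          \<le> \<mu> / 2 / t\<^sup>2 * (exp (2 * (W a X + q0 * (ln t - ln X))) - 1)"
      proof (rule mult_mono)
        show "\<mu> / 2 / (1 + t)\<^sup>2 \<le> \<mu> / 2 / t\<^sup>2"
          using mu_pos t0 by (intro divide_left_mono power_mono) auto
        show "exp (2 * W a t) - 1 \<le> exp (2 * (W a X + q0 * (ln t - ln X))) - 1"
          using Wle[OF t] by simp
        show "0 \<le> \<mu> / 2 / t\<^sup>2" using mu_pos by simp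
        show "0 \<le> exp (2 * W a t) - 1" using Wpos[OF t] X by simp
      qed
      then show "\<exists>y. ((\<lambda>t. R a t + G t) has_real_derivative y) (at t) \<and> 0 \<le> y"
        using DERIV_add[OF DERIV_R[OF less_imp_le[OF t0], of a] dG] by fastforce
    qed (use c in simp)
    moreover have "G c \<le> 0"
    proof -
      have "1 * 1 \<le> K * exp (2 * q0 * (ln c - ln X))"
      proof (rule mult_mono)
        have "0 \<le> 2 * q0 * (ln c - ln X)"
          using less_imp_le[OF q(1)] c X by (intro mult_nonneg_nonneg) (simp_all add: q0_def)
        then show "1 \<le> exp (2 * q0 * (ln c - ln X))" by (simp only: one_le_exp_iff)
      qed (use K1 in auto)
      then have "\<mu> / 2 * (1 - K * exp (2 * q0 * (ln c - ln X))) \<le> 0"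
        using mu_pos by (intro mult_nonneg_nonpos) auto
      then show ?thesis unfolding G_def using c X by (intro divide_nonpos_pos) auto
    qed
    \<comment> \<open>\<open>- G X\<close> is the integral of the majorant over the whole ray, since
      G tends to 0; the hypothesis \<open>small\<close> says that it does not use up the slope at
      X.\<close>
    moreover have "- G X < R a X"
    proof -
      have "- G X = \<mu> / 2 * (K - 1) / X"
        by (simp add: G_def right_diff_distrib minus_divide_left)
      moreover have "\<mu> / 2 * (K - 1) < X * R a X" using small by (simp add: K_def q0_def)
      ultimately show ?thesis using X(1) by (simp only: pos_divide_less_eq mult.commute)
    qed
    ultimately show False using c(3) by linarith
  qed
  then have "W a X < W a x" using W_strict_increasing[OF X(1) x] by blast
  then show ?thesis using X by simp
qed

text \<open>\<open>W\<close> is concave in \<open>ln x\<close> while positive, so it can only come back down from a positive height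
  at a late \<open>X\<close> with a slope that the remaining push cannot reverse.\<close>

lemma one_zero_after_positive:
  assumes X: "0 < X" "0 < W a X" and big: "\<mu> / 2 \<le> X * W a X"
    and z: "X < x" "x < y" "W a x = 0"
  shows "W a y \<noteq> 0"
proof -
  have "continuous_on {X..x} (\<lambda>t. - W a t)" by (intro continuous_intros)
  then obtain c where c: "X < c" "c \<le> x" "- W a c = 0" "\<And>t. X \<le> t \<Longrightarrow> t < c \<Longrightarrow> - W a t < 0"
    using first_nonneg[of X x "\<lambda>t. - W a t"] X z by auto
  have Wpos: "0 \<le> W a t" if "X \<le> t" "t \<le> c" for t
    using c(3) c(4)[of t] that by (cases "t = c") auto
  have "R a c \<le> R a t" if "X \<le> t" "t \<le> c" for t
    by (rule R_decreasing) (use X that Wpos in auto)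
  then have "W a X + R a c * (ln c - ln X) \<le> W a c"
    by (intro W_log_ge) (use X c in auto)
  then have 1: "R a c * (ln c - ln X) \<le> - W a X" using c by simp
  have ln_pos: "0 < ln c - ln X" using c X by simp
  have neg: "R a c < 0"
  proof (rule ccontr)
    assume "\<not> R a c < 0"
    then have "0 \<le> R a c * (ln c - ln X)" using ln_pos by (intro mult_nonneg_nonneg) auto
    then show False using 1 X by simp
  qed
  \<comment> \<open>Trading the logarithmic distance for c / X turns the lost height W(X) into c
    R(c) <= - X W(X), and \<open>big\<close> makes this steep enough for
    \<open>tail_negative\<close>.\<close>
  have "ln c - ln X \<le> c / X"
    using ln_le_minus_one[of "c / X"] c X by (simp add: ln_div)
  then have "R a c * (c / X) \<le> R a c * (ln c - ln X)" using neg by (intro mult_left_mono_neg) auto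
  then have "R a c * (c / X) \<le> - W a X" using 1 by linarith
  then have "R a c * c \<le> - (X * W a X)" using X by (simp add: divide_le_eq mult.commute)
  then have "R a c * c \<le> - (\<mu> / 2)" using big by linarith
  moreover have "0 < c" using c X by simp
  ultimately have "R a c \<le> - (\<mu> / 2) / c" by (simp only: pos_le_divide_eq)
  also have "\<dots> \<le> - (\<mu> / 2 / (1 + c))" using mu_pos c X by (simp add: frac_le)
  finally have "R a c \<le> - (\<mu> / 2 / (1 + c))" .
  then have tail: "W a t < 0" if "c < t" for t using tail_negative[of c a t] c X that by simp
  show ?thesis using tail[of y] c z by simp
qed

text \<open>While W is negative, R increases, but by less than \<open>\<mu>\<close> / 2 / (1 + X),
  so the first crossing \<open>c\<close> has slope between 0 and 1/4. There W = 0, and the quantity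
  required to be small by \<open>tail_positive\<close> is below 2 \<open>\<mu>\<close> R(c), hence
  below c R(c). Zero slope at the crossing is excluded by uniqueness, which needs \<open>a\<close>
  nonzero.\<close>

lemma one_zero_after_negative:
  assumes a: "a \<noteq> 0" and X: "0 < X" "W a X < 0" and slope: "R a X + \<mu> / 2 / (1 + X) < 1 / 4"
    and big: "2 * \<mu> \<le> X" and z: "X < x" "x < y" "W a x = 0"
  shows "W a y \<noteq> 0"
proof -
  obtain c where c: "X < c" "c \<le> x" "W a c = 0" "\<And>t. X \<le> t \<Longrightarrow> t < c \<Longrightarrow> W a t < 0"
    using first_nonneg[of X x "W a"] X z continuous_on_W by auto
  have Wneg: "W a t \<le> 0" if "X \<le> t" "t \<le> c" for t
    using c(3) c(4)[of t] that by (cases "t = c") auto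
  have up: "R a t \<le> R a c" if "X \<le> t" "t \<le> c" for t
    by (rule R_increasing) (use X that Wneg in auto)
  have "R a c \<noteq> 0" using W_R_nonzero[OF a, of c] c X by simp
  moreover have "\<not> R a c < 0"
  proof
    assume "R a c < 0"
    then have "W a c \<le> W a X + 0 * (ln c - ln X)"
      using up c X by (intro W_log_le) force+
    then show False using c X by simp
  qed
  ultimately have q: "0 < R a c" by simp
  have "0 < \<mu> / 2 / (1 + c)" using mu_pos c X by simp
  then have q4: "R a c < 1 / 4" using R_growth[of X c a] c X slope by linarith
  have "\<mu> / 2 * (exp (2 * W a c) / (1 - 2 * R a c) - 1) < c * R a c"
  proof -
    have "exp (2 * W a c) / (1 - 2 * R a c) - 1 = 2 * R a c / (1 - 2 * R a c)"
      using q4 c(3) by (simp add: field_simps)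
    also have "\<dots> < 2 * R a c / (1 / 2)" using q q4 by (intro divide_strict_left_mono) auto
    finally have "\<mu> / 2 * (exp (2 * W a c) / (1 - 2 * R a c) - 1) < \<mu> / 2 * (2 * R a c / (1 / 2))"
      using mu_pos by (intro mult_strict_left_mono) auto
    also have "\<dots> = 2 * \<mu> * R a c" by simp
    also have "\<dots> \<le> c * R a c" using big c q by (intro mult_right_mono) auto
    finally show ?thesis .
  qed
  then have tail: "0 < W a t" if "c < t" for t
    using tail_positive[of c a t] c X q q4 that by simp
  show ?thesis using tail[of y] c z by simp
qed

lemma nonzero_tail:
  assumes "a \<in> atmost m"
  shows "\<exists>X>0. \<forall>x\<ge>X. Y a x \<noteq> 0"
proof -
  define X where "X = Max (insert 0 (zeros a)) + 1"
  have fin: "finite (insert 0 (zeros a))" using assms by (simp add: atmost_def)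
  have le: "t < X" if "t \<in> insert 0 (zeros a)" for t
    using Max_ge[OF fin that] by (simp add: X_def)
  have "0 < X" using le by simp
  moreover have "Y a x \<noteq> 0" if "X \<le> x" for x
    using le[of x] \<open>0 < X\<close> that by (auto simp: zeros_def)
  ultimately show ?thesis by blast
qed

lemma sign_tail:
  assumes "a \<in> atmost m" "a \<noteq> 0"
  obtains (pos) X where "0 < X" "\<And>x. X \<le> x \<Longrightarrow> 0 < W a x"
    | (neg) X where "0 < X" "\<And>x. X \<le> x \<Longrightarrow> W a x < 0"
proof -
  obtain X where X: "0 < X" "\<forall>x\<ge>X. Y a x \<noteq> 0" using nonzero_tail[OF assms(1)] by blast
  have nz: "W a x \<noteq> 0" if "X \<le> x" for x using X(2) that assms(2) by (simp add: W_def)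
  show thesis
  proof (cases "0 < W a X")
    case True
    have "0 < W a x" if x: "X \<le> x" for x
    proof (rule ccontr)
      assume "\<not> 0 < W a x"
      then obtain t where "X \<le> t" "t \<le> x" "W a t = 0"
        using IVT2'[of "W a" x 0 X] x True continuous_on_W by auto
      then show False using nz by blast
    qed
    then show thesis using pos X by blast
  next
    case False
    have "W a x < 0" if x: "X \<le> x" for x
    proof (rule ccontr)
      assume "\<not> W a x < 0"
      then obtain t where "X \<le> t" "t \<le> x" "W a t = 0"
        using IVT'[of "W a" X 0 x] x False continuous_on_W by auto
      then show False using nz by blast
    qed
    then show thesis using neg X by blast
  qed
qed

lemma R_nonneg_tail:
  assumes X: "0 < X" "\<And>x. X \<le> x \<Longrightarrow> 0 < W a x" and x: "X \<le> x"
  shows "0 \<le> R a x"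
proof (rule nonneg_slope_of_positive_tail[of x "W a"])
  show "R a t \<le> R a x" if "x \<le> t" for t
  proof (rule R_decreasing)
    show "0 \<le> W a s" if "x \<le> s" for s using X(2)[of s] x that by simp
  qed (use X(1) x that in auto)
qed (use X x DERIV_W in auto)

lemma R_nonpos_tail:
  assumes X: "0 < X" "\<And>x. X \<le> x \<Longrightarrow> W a x < 0" and x: "X \<le> x"
  shows "R a x \<le> 0"
proof -
  have "0 \<le> - R a x"
  proof (rule nonneg_slope_of_positive_tail[of x "\<lambda>x. - W a x" "\<lambda>x. - R a x"])
    have "R a x \<le> R a t" if "x \<le> t" for t
    proof (rule R_increasing)
      show "W a s \<le> 0" if "x \<le> s" for s using X(2)[of s] x that by simp
    qed (use X(1) x that in auto)
    then show "- R a t \<le> - R a x" if "x \<le> t" for t using that by simp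
  qed (use X x DERIV_minus_W in auto)
  then show ?thesis by simp
qed

end

section \<open>Uniqueness at the singular point, and stability of the number of zeros\<close>

lemma nondecreasing_limit_0:
  fixes f :: "real \<Rightarrow> real"
  assumes "\<And>t. X \<le> t \<Longrightarrow> \<exists>D. (f has_real_derivative D) (at t) \<and> 0 \<le> D"
    and "(f \<longlongrightarrow> 0) at_top"
  shows "f X \<le> 0"
proof (rule tendsto_lowerbound[OF assms(2)])
  have "f X \<le> f y" if "X \<le> y" for y
    by (rule DERIV_nonneg_imp_nondecreasing[OF that, of f]) (use assms(1) in auto)
  then show "\<forall>\<^sub>F y in at_top. f X \<le> f y" by (auto simp: eventually_at_top_linorder)
qed simp

lemma decreasing_bounded_away:
  fixes f :: "real \<Rightarrow> real"
  assumes "\<And>x. X \<le> x \<Longrightarrow> 0 \<le> f x" and dec: "\<And>x y. X \<le> x \<Longrightarrow> x \<le> y \<Longrightarrow> f y \<le> f x"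
    and "\<not> (f \<longlongrightarrow> 0) at_top"
  shows "\<exists>\<eta>>0. \<forall>x\<ge>X. \<eta> \<le> f x"
proof (rule ccontr)
  assume none: "\<not> ?thesis"
  have "(f \<longlongrightarrow> 0) at_top"
  proof (rule tendstoI)
    fix e :: real assume "0 < e"
    then obtain x where x: "X \<le> x" "f x < e" using none by (meson not_le)
    show "\<forall>\<^sub>F y in at_top. dist (f y) 0 < e"
    proof (rule eventually_at_top_linorderI)
      fix y assume y: "x \<le> y"
      have "f y < e" "0 \<le> f y" using dec[OF x(1) y] assms(1)[of y] x y by linarith+
      then show "dist (f y) 0 < e" by (simp add: dist_real_def)
    qed
  qed
  then show False using assms(3) by simp
qed

text \<open>Uniqueness at the singular point \<open>0\<close>, by Gronwall for the energy \<open>d\<^sup>2 + D\<^sup>2 / t\<close> of the difference.\<close>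

lemma singular_uniqueness:
  fixes w1 w2 r1 r2 :: "real \<Rightarrow> real"
  assumes mu: "0 < \<mu>" and X: "0 < X" and M: "0 \<le> M"
    and w1: "\<And>t. 0 < t \<Longrightarrow> t \<le> X \<Longrightarrow> (w1 has_real_derivative r1 t / t) (at t)"
    and w2: "\<And>t. 0 < t \<Longrightarrow> t \<le> X \<Longrightarrow> (w2 has_real_derivative r2 t / t) (at t)"
    and r1: "\<And>t. 0 < t \<Longrightarrow> t \<le> X \<Longrightarrow>
      (r1 has_real_derivative - (\<mu> / 2 / (1 + t)\<^sup>2) * (exp (2 * w1 t) - 1)) (at t)"
    and r2: "\<And>t. 0 < t \<Longrightarrow> t \<le> X \<Longrightarrow>
      (r2 has_real_derivative - (\<mu> / 2 / (1 + t)\<^sup>2) * (exp (2 * w2 t) - 1)) (at t)"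
    and le: "\<And>t. 0 < t \<Longrightarrow> t \<le> X \<Longrightarrow> w1 t \<le> M" "\<And>t. 0 < t \<Longrightarrow> t \<le> X \<Longrightarrow> w2 t \<le> M"
    and lim: "((\<lambda>t. (w1 t - w2 t)\<^sup>2 + (r1 t - r2 t)\<^sup>2 / t) \<longlongrightarrow> 0) (at_right 0)"
  shows "w1 X = w2 X"
proof -
  define E where "E t = (w1 t - w2 t)\<^sup>2 + (r1 t - r2 t)\<^sup>2 / t" for t
  define L where "L = \<mu> * exp (2 * M)"
  define K where "K = (1 + L)\<^sup>2"
  have L0: "0 \<le> L" using mu by (simp add: L_def)
  have E_le: "E X * exp (- K * X) \<le> E e" if e: "0 < e" "e < X" for e
  proof -
    have "E X * exp (- K * X) \<le> E e * exp (- K * e)"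
    proof (rule DERIV_nonpos_imp_nonincreasing[of e X "\<lambda>t. E t * exp (- K * t)"])
      fix t assume t: "e \<le> t" "t \<le> X"
      have t0: "0 < t" using t e by simp
      define k where "k = \<mu> / 2 / (1 + t)\<^sup>2"
      define d where "d = w1 t - w2 t"
      define D where "D = r1 t - r2 t"
      define G where "G = k * (exp (2 * w1 t) - exp (2 * w2 t))"
      have dd: "((\<lambda>t. w1 t - w2 t) has_real_derivative D / t) (at t)"
        using DERIV_diff[OF w1[OF t0 t(2)] w2[OF t0 t(2)]] by (simp add: D_def diff_divide_distrib)
      have "- k * (exp (2 * w1 t) - 1) - - k * (exp (2 * w2 t) - 1) = - G"
        by (simp add: G_def algebra_simps)
      then have dD: "((\<lambda>t. r1 t - r2 t) has_real_derivative - G) (at t)"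
        using DERIV_diff[OF r1[OF t0 t(2)] r2[OF t0 t(2)]] unfolding k_def by simp
      have "((\<lambda>t. (w1 t - w2 t)\<^sup>2) has_real_derivative 2 * d * (D / t)) (at t)"
        unfolding power2_eq_square using DERIV_mult[OF dd dd] by (simp add: d_def algebra_simps)
      moreover have "((\<lambda>t. (r1 t - r2 t)\<^sup>2 / t) has_real_derivative - 2 * (D / t) * G - (D / t)\<^sup>2) (at t)"
      proof -
        have "((\<lambda>t. (r1 t - r2 t)\<^sup>2) has_real_derivative - 2 * D * G) (at t)"
          unfolding power2_eq_square using DERIV_mult[OF dD dD] by (simp add: D_def algebra_simps)
        from DERIV_divide[OF this DERIV_ident] t0
        have "((\<lambda>t. (r1 t - r2 t)\<^sup>2 / t) has_real_derivative
            (- 2 * D * G * t - D\<^sup>2 * 1) / (t * t)) (at t)"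
          by (simp add: D_def)
        moreover have "(- 2 * D * G * t - D\<^sup>2 * 1) / (t * t) = - 2 * (D / t) * G - (D / t)\<^sup>2"
          using t0 by (simp add: power2_eq_square field_simps)
        ultimately show ?thesis by simp
      qed
      ultimately have dE: "(E has_real_derivative
          2 * d * (D / t) + (- 2 * (D / t) * G - (D / t)\<^sup>2)) (at t)"
        unfolding E_def[abs_def] by (rule DERIV_add)
      have G: "\<bar>G\<bar> \<le> L * \<bar>d\<bar>"
      proof -
        have "\<bar>exp (2 * w1 t) - exp (2 * w2 t)\<bar> \<le> exp (2 * M) * \<bar>2 * w1 t - 2 * w2 t\<bar>"
        proof -
          have m: "min (2 * w1 t) (2 * M) = 2 * w1 t" "min (2 * w2 t) (2 * M) = 2 * w2 t"
            using le[OF t0 t(2)] by simp_all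
          show ?thesis
            using truncated_exp_lipschitz[of "2 * M" "2 * w1 t" "2 * w2 t"] M
            unfolding m mult_expquot by simp
        qed
        also have "2 * w1 t - 2 * w2 t = 2 * d" by (simp add: d_def)
        also have "\<bar>2 * d\<bar> = 2 * \<bar>d\<bar>" by (simp add: abs_mult)
        finally have "k * \<bar>exp (2 * w1 t) - exp (2 * w2 t)\<bar> \<le> (\<mu> / 2) * (exp (2 * M) * (2 * \<bar>d\<bar>))"
        proof (rule mult_mono[rotated])
          have "1 \<le> (1 + t)\<^sup>2" using t0 by simp
          then show "k \<le> \<mu> / 2" using mu t0 unfolding k_def by (intro divide_le_eq[THEN iffD2]) simp_all
        qed (use mu in auto)
        moreover have "\<bar>G\<bar> = k * \<bar>exp (2 * w1 t) - exp (2 * w2 t)\<bar>"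
          using mu by (simp add: G_def abs_mult k_def)
        ultimately show ?thesis by (simp add: L_def)
      qed
      define h where "h = D / t"
      \<comment> \<open>The term - h^2 produced by differentiating 1/t absorbs the singular cross
        terms; what remains is (1 + L)^2 d^2, which explains \<open>K\<close>.\<close>
      have "2 * d * h + (- 2 * h * G - h\<^sup>2) \<le> K * d\<^sup>2"
      proof -
        have "2 * d * h - 2 * h * G \<le> 2 * \<bar>h\<bar> * ((1 + L) * \<bar>d\<bar>)"
        proof -
          have "2 * d * h - 2 * h * G = 2 * (h * (d - G))" by (simp add: algebra_simps)
          also have "h * (d - G) \<le> \<bar>h\<bar> * \<bar>d - G\<bar>" using abs_ge_self[of "h * (d - G)"] by (simp only: abs_mult)
          also have "\<bar>h\<bar> * \<bar>d - G\<bar> \<le> \<bar>h\<bar> * ((1 + L) * \<bar>d\<bar>)"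
            using G by (intro mult_left_mono) (simp_all add: algebra_simps)
          finally show ?thesis by simp
        qed
        also have "\<dots> \<le> \<bar>h\<bar>\<^sup>2 + ((1 + L) * \<bar>d\<bar>)\<^sup>2" by (rule sum_squares_bound)
        also have "\<dots> = h\<^sup>2 + K * d\<^sup>2" by (simp add: K_def power_mult_distrib)
        finally show ?thesis by simp
      qed
      also have "\<dots> \<le> K * E t" using t0 by (intro mult_left_mono) (simp_all add: E_def d_def K_def)
      finally have neg: "2 * d * h + (- 2 * h * G - h\<^sup>2) - K * E t \<le> 0" by simp
      have "((\<lambda>t. exp (- K * t)) has_real_derivative exp (- K * t) * (- K)) (at t)"
        by (auto intro!: derivative_eq_intros)
      note DERIV_mult[OF dE this]
      moreover have "A * x + x * (- K) * z = (A - K * z) * x" for A x z :: real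
        by (simp add: algebra_simps)
      ultimately have "((\<lambda>t. E t * exp (- K * t)) has_real_derivative
          (2 * d * h + (- 2 * h * G - h\<^sup>2) - K * E t) * exp (- K * t)) (at t)"
        unfolding h_def by (simp only:)
      moreover have "(2 * d * h + (- 2 * h * G - h\<^sup>2) - K * E t) * exp (- K * t) \<le> 0"
        using neg by (intro mult_nonpos_nonneg) auto
      ultimately show "\<exists>y. ((\<lambda>t. E t * exp (- K * t)) has_real_derivative y) (at t) \<and> y \<le> 0" by blast
    qed (use e in simp)
    also have "\<dots> \<le> E e * 1"
      using e by (intro mult_left_mono) (simp_all add: K_def E_def)
    finally show ?thesis by simp
  qed
  have "E X * exp (- K * X) \<le> 0"
  proof (rule tendsto_lowerbound)
    show "(E \<longlongrightarrow> 0) (at_right 0)" using lim by (simp add: E_def[abs_def])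
    show "\<forall>\<^sub>F e in at_right 0. E X * exp (- K * X) \<le> E e"
      using X E_le by (auto simp: eventually_at_right_field)
  qed simp
  then have "E X \<le> 0" by (simp add: mult_le_0_iff)
  moreover have "0 \<le> (r1 X - r2 X)\<^sup>2 / X" using X by simp
  ultimately have "(w1 X - w2 X)\<^sup>2 \<le> 0" unfolding E_def by linarith
  then show ?thesis by simp
qed

context shooting
begin

text \<open>At a late X beyond the last zero the hypotheses of one of the two one-zero lemmas hold
  strictly, so they persist for nearby parameters: at most \<open>m\<close> zeros up to X and at
  most one more.\<close>

lemma eventually_atmost_Suc:
  assumes "a \<in> atmost m" "a \<noteq> 0"
  shows "\<forall>\<^sub>F b in nhds a. b \<in> atmost (Suc m)"
proof (cases rule: sign_tail[OF assms, case_names pos neg])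
  case (pos X0)
  \<comment> \<open>Chosen to make X W(X0) exceed \<open>\<mu>\<close>; W does not fall
    afterwards.\<close>
  define X where "X = X0 + \<mu> / W a X0"
  have d: "0 < W a X0" using pos by simp
  have "0 < \<mu> / W a X0" using d mu_pos by (rule divide_pos_pos[rotated])
  then have X: "0 < X" "X0 \<le> X" using pos(1) by (simp_all add: X_def)
  have R: "0 \<le> R a t" if "X0 \<le> t" for t using R_nonneg_tail[of X0 a t] pos that by blast
  have W: "W a X0 \<le> W a X" using W_log_ge[of X0 X 0 a] X pos R by auto
  have "\<mu> / 2 < X * W a X0"
  proof -
    have "X * W a X0 = X0 * W a X0 + \<mu>" using d by (simp add: X_def distrib_right)
    moreover have "0 < X0 * W a X0" using d pos by simp
    ultimately show ?thesis using mu_pos by linarith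
  qed
  also have "\<dots> \<le> X * W a X" using W X by (intro mult_left_mono) auto
  finally have big: "\<mu> / 2 < X * W a X" .
  have "0 < W a X" using W d by linarith
  then have "\<forall>\<^sub>F b in nhds a. 0 < W b X" by (rule order_tendstoD(1)[OF tendsto_W])
  moreover have "\<forall>\<^sub>F b in nhds a. \<mu> / 2 < X * W b X"
    by (rule order_tendstoD(1)[OF tendsto_mult[OF tendsto_const tendsto_W] big])
  moreover have "\<forall>\<^sub>F b in nhds a. card (zeros b \<inter> {..X}) \<le> m"
    using eventually_card_zeros_upto[OF assms(1)] X by simp
  ultimately show ?thesis
  proof eventually_elim
    case (elim b)
    show ?case
    proof (rule atmost_by_tail(2)[OF less_imp_le[OF X(1)] elim(3)])
      fix x y assume xy: "X < x" "x < y" "Y b x = 0"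
      then have "W b y \<noteq> 0"
        using one_zero_after_positive[of X b x y] X elim by (simp add: W_def)
      then show "Y b y \<noteq> 0" by (auto simp: W_def)
    qed
  qed
next
  case (neg X0)
  \<comment> \<open>X >= 2 \<open>\<mu>\<close> is the hypothesis \<open>big\<close>, and it also
    puts \<open>\<mu>\<close> / 2 / (1 + X) below 1/4.\<close>
  define X where "X = X0 + 2 * \<mu> + 1"
  have X: "0 < X" "X0 \<le> X" "2 * \<mu> \<le> X" using neg(1) mu_pos by (simp_all add: X_def)
  have "\<mu> / 2 / (1 + X) < 1 / 4" using X mu_pos by (simp add: divide_less_eq)
  moreover have "R a X \<le> 0" using R_nonpos_tail[of X0 a X] neg X by blast
  ultimately have slope: "R a X + \<mu> / 2 / (1 + X) < 1 / 4" by linarith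
  have "W a X < 0" using neg X by simp
  then have "\<forall>\<^sub>F b in nhds a. W b X < 0" by (rule order_tendstoD(2)[OF tendsto_W])
  moreover have "\<forall>\<^sub>F b in nhds a. R b X + \<mu> / 2 / (1 + X) < 1 / 4"
    by (rule order_tendstoD(2)[OF tendsto_add[OF tendsto_R tendsto_const] slope])
  moreover have "\<forall>\<^sub>F b in nhds a. card (zeros b \<inter> {..X}) \<le> m"
    using eventually_card_zeros_upto[OF assms(1)] X by simp
  ultimately show ?thesis
  proof eventually_elim
    case (elim b)
    then have b: "b \<noteq> 0" by (auto simp: W_def)
    show ?case
    proof (rule atmost_by_tail(2)[OF less_imp_le[OF X(1)] elim(3)])
      fix x y assume xy: "X < x" "x < y" "Y b x = 0"
      then have "W b y \<noteq> 0"
        using one_zero_after_negative[of b X x y] b X elim by (simp add: W_def)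
      then show "Y b y \<noteq> 0" by (auto simp: W_def)
    qed
  qed
qed

text \<open>In the tail R is monotone, so if it does not tend to 0 it stays away from 0 by some
  \<open>\<eta>\<close>. The solution then escapes linearly in ln x, and at a late X the hypotheses
  of a tail lemma hold strictly, which excludes new zeros for nearby parameters.\<close>

lemma eventually_atmost_same:
  assumes "a \<in> atmost m" "a \<noteq> 0" and not_lim: "\<not> (R a \<longlongrightarrow> 0) at_top"
  shows "\<forall>\<^sub>F b in nhds a. b \<in> atmost m"
proof (cases rule: sign_tail[OF assms(1,2), case_names pos neg])
  case (pos X0)
  have R0: "0 \<le> R a t" if "X0 \<le> t" for t using R_nonneg_tail[of X0 a t] pos that by blast
  have dec: "R a y \<le> R a x" if "X0 \<le> x" "x \<le> y" for x y
  proof (rule R_decreasing)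
    show "0 \<le> W a s" if "x \<le> s" for s using pos(2)[of s] that \<open>X0 \<le> x\<close> by simp
  qed (use that pos in auto)
  obtain \<eta> where eta: "0 < \<eta>" "\<And>x. X0 \<le> x \<Longrightarrow> \<eta> \<le> R a x"
    using decreasing_bounded_away[OF R0 dec not_lim] by blast
  obtain X1 where X1: "X0 \<le> X1" "R a X1 < 1 / 2"
  proof -
    \<comment> \<open>With slope at least 1/2 throughout, e^(2W) would be at least t / X0 and the
      pull at least a multiple of 1/t. Its integral diverges, so R would come down to 0.\<close>
    have "\<exists>X1\<ge>X0. R a X1 < 1 / 2"
    proof (rule ccontr)
      assume "\<not> ?thesis"
      then have half: "1 / 2 \<le> R a x" if "X0 \<le> x" for x using that by (auto simp: not_less)
      \<comment> \<open>For t >= 1 and t >= 2 X0 the pull is at least (\<open>\<mu>\<close> / 2) /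
        (2t)^2 times t / (2 X0), which is c / t.\<close>
      define c where "c = \<mu> / (16 * X0)"
      have c: "0 < c" using pos mu_pos by (simp add: c_def)
      define X2 where "X2 = 2 * X0 + 1"
      have X2: "X0 \<le> X2" "0 < X2" using pos by (simp_all add: X2_def)
      have key: "R a x + c * ln x \<le> R a X2 + c * ln X2" if x: "X2 \<le> x" for x
      proof (rule DERIV_nonpos_imp_nonincreasing[OF x, of "\<lambda>x. R a x + c * ln x"])
        fix t assume t: "X2 \<le> t" "t \<le> x"
        have t0: "0 < t" "1 \<le> t" "2 * X0 \<le> t" "X0 \<le> t" using t X2 pos by (simp_all add: X2_def)
        have "W a X0 + 1 / 2 * (ln t - ln X0) \<le> W a t"
          using W_log_ge[of X0 t "1 / 2" a] pos t0 half by auto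
        moreover have "p \<le> 2 * w" if "w0 + 1 / 2 * p \<le> w" "0 < w0" for w0 p w :: real
          using that by (simp add: field_simps)
        ultimately have "ln t - ln X0 \<le> 2 * W a t" using pos(2)[OF order_refl] by blast
        then have "exp (ln t - ln X0) \<le> exp (2 * W a t)" by simp
        moreover have "exp (ln t - ln X0) = t / X0" using t0 pos by (simp add: exp_diff)
        moreover have "t / (2 * X0) \<le> t / X0 - 1" using t0 pos by (simp add: field_simps)
        ultimately have e: "t / (2 * X0) \<le> exp (2 * W a t) - 1" by linarith
        have "c / t = \<mu> / 2 / (2 * t)\<^sup>2 * (t / (2 * X0))"
          using t0 pos by (simp add: c_def power2_eq_square field_simps)
        also have "\<dots> \<le> \<mu> / 2 / (1 + t)\<^sup>2 * (exp (2 * W a t) - 1)"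
        proof (rule mult_mono[OF _ e])
          have "(1 + t)\<^sup>2 \<le> (2 * t)\<^sup>2" using t0 by (intro power_mono) auto
          then show "\<mu> / 2 / (2 * t)\<^sup>2 \<le> \<mu> / 2 / (1 + t)\<^sup>2"
            using mu_pos t0 by (intro divide_left_mono mult_pos_pos) auto
        qed (use mu_pos t0 pos in auto)
        finally have "- (\<mu> / 2 / (1 + t)\<^sup>2) * (exp (2 * W a t) - 1) + c / t \<le> 0" by simp
        moreover have "((\<lambda>x. c * ln x) has_real_derivative c / t) (at t)"
          using t0 by (auto intro!: derivative_eq_intros)
        from DERIV_add[OF DERIV_R[OF less_imp_le[OF t0(1)], of a] this]
        have "((\<lambda>x. R a x + c * ln x) has_real_derivative
          - (\<mu> / 2 / (1 + t)\<^sup>2) * (exp (2 * W a t) - 1) + c / t) (at t)" .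
        ultimately show "\<exists>y. ((\<lambda>x. R a x + c * ln x) has_real_derivative y) (at t) \<and> y \<le> 0" by blast
      qed
      define x where "x = X2 * exp (R a X2 / c)"
      have "0 \<le> R a X2 / c" using R0[OF X2(1)] c by simp
      then have "1 \<le> exp (R a X2 / c)" by (simp only: one_le_exp_iff)
      then have "X2 \<le> x" using X2 by (simp add: x_def)
      moreover have "c * ln x = c * ln X2 + R a X2" using X2 c by (simp add: x_def ln_mult distrib_left)
      ultimately have "R a x \<le> 0" using key[of x] by linarith
      then show False using half[of x] X2 \<open>X2 \<le> x\<close> by linarith
    qed
    then show thesis using that by blast
  qed
  define q where "q = R a X1"
  have q: "0 < q" "q < 1 / 2" using eta X1 by (auto simp: q_def intro: less_le_trans)
  have X1_pos: "0 < X1" using X1 pos by simp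
  \<comment> \<open>At X = e^L the pull in \<open>tail_positive\<close> is below C X^(2q), against a
    slope term of at least \<open>\<eta>\<close> X. As 2q < 1, a large X wins; \<open>L\<close> is
    taken so that 1 + z <= e^z yields C < \<open>\<eta>\<close> e^((1-2q) L).\<close>
  define C where "C = \<mu> / 2 * (exp (2 * W a X1 - 2 * q * ln X1) / (1 - 2 * q))"
  define L where "L = max (ln X1) (C / (\<eta> * (1 - 2 * q)))"
  define X where "X = exp L"
  have X: "X1 \<le> X" "0 < X"
  proof -
    have "exp (ln X1) \<le> exp L" by (simp add: L_def)
    then show "X1 \<le> X" using X1_pos by (simp add: X_def)
  qed (simp add: X_def)
  have small: "\<mu> / 2 * (exp (2 * W a X) / (1 - 2 * R a X) - 1) < X * R a X"
  proof -
    have RX: "R a X \<le> q" "\<eta> \<le> R a X" using dec[of X1 X] eta(2)[of X] X X1 by (simp_all add: q_def)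
    have "W a X \<le> W a X1 + q * (ln X - ln X1)"
      using W_log_le[of X1 X a q] X X1_pos dec[OF X1(1)] by (auto simp: q_def)
    then have "2 * W a X \<le> (2 * W a X1 - 2 * q * ln X1) + 2 * q * L"
      by (simp add: X_def algebra_simps)
    then have "exp (2 * W a X) \<le> exp (2 * W a X1 - 2 * q * ln X1) * exp (2 * q * L)"
      by (simp flip: exp_add)
    then have "exp (2 * W a X) / (1 - 2 * R a X)
        \<le> exp (2 * W a X1 - 2 * q * ln X1) * exp (2 * q * L) / (1 - 2 * q)"
      using RX q by (intro frac_le) auto
    then have "\<mu> / 2 * (exp (2 * W a X) / (1 - 2 * R a X))
        \<le> \<mu> / 2 * (exp (2 * W a X1 - 2 * q * ln X1) * exp (2 * q * L) / (1 - 2 * q))"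
      using mu_pos by (intro mult_left_mono) auto
    also have "\<dots> = C * exp (2 * q * L)" by (simp add: C_def)
    also have "\<dots> < \<eta> * exp ((1 - 2 * q) * L) * exp (2 * q * L)"
    proof (rule mult_strict_right_mono)
      have "C / (\<eta> * (1 - 2 * q)) \<le> L" by (simp add: L_def)
      then have "C \<le> \<eta> * ((1 - 2 * q) * L)" using q eta by (simp add: divide_le_eq mult_ac)
      also have "\<dots> < \<eta> * exp ((1 - 2 * q) * L)"
        using eta exp_ge_add_one_self[of "(1 - 2 * q) * L"] by (intro mult_strict_left_mono) linarith+
      finally show "C < \<eta> * exp ((1 - 2 * q) * L)" .
    qed simp
    also have "\<dots> = \<eta> * X" by (simp add: X_def left_diff_distrib exp_diff mult.assoc)
    also have "\<dots> \<le> R a X * X" using RX X by (intro mult_right_mono) auto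
    finally show ?thesis using mu_pos by (simp add: right_diff_distrib mult.commute)
  qed
  have WX: "0 < W a X" using pos X X1 by simp
  have RX: "0 < R a X" "R a X < 1 / 2" using eta(2)[of X] eta(1) dec[of X1 X] X X1 by simp_all
  have "\<forall>\<^sub>F b in nhds a. 0 < W b X" by (rule order_tendstoD(1)[OF tendsto_W WX])
  moreover have "\<forall>\<^sub>F b in nhds a. 0 < R b X" by (rule order_tendstoD(1)[OF tendsto_R RX(1)])
  moreover have "\<forall>\<^sub>F b in nhds a. R b X < 1 / 2" by (rule order_tendstoD(2)[OF tendsto_R RX(2)])
  moreover have "\<forall>\<^sub>F b in nhds a. \<mu> / 2 * (exp (2 * W b X) / (1 - 2 * R b X) - 1) - X * R b X < 0"
  proof (rule order_tendstoD(2))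
    show "((\<lambda>b. \<mu> / 2 * (exp (2 * W b X) / (1 - 2 * R b X) - 1) - X * R b X)
      \<longlongrightarrow> \<mu> / 2 * (exp (2 * W a X) / (1 - 2 * R a X) - 1) - X * R a X) (nhds a)"
      using RX by (intro tendsto_intros tendsto_W tendsto_R) auto
    show "\<mu> / 2 * (exp (2 * W a X) / (1 - 2 * R a X) - 1) - X * R a X < 0" using small by simp
  qed
  moreover have "\<forall>\<^sub>F b in nhds a. card (zeros b \<inter> {..X}) \<le> m"
    using eventually_card_zeros_upto[OF assms(1)] X by simp
  ultimately show ?thesis
  proof eventually_elim
    case (elim b)
    show ?case
    proof (rule atmost_by_tail(1)[OF less_imp_le[OF X(2)] elim(5)])
      fix x assume "X < x"
      then have "0 < W b x" using tail_positive[of X b x] X elim by simp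
      then show "Y b x \<noteq> 0" by (auto simp: W_def)
    qed
  qed
next
  case (neg X0)
  have R0: "R a t \<le> 0" if "X0 \<le> t" for t using R_nonpos_tail[of X0 a t] neg that by blast
  have inc: "R a x \<le> R a y" if "X0 \<le> x" "x \<le> y" for x y
  proof (rule R_increasing)
    show "W a s \<le> 0" if "x \<le> s" for s using neg(2)[of s] that \<open>X0 \<le> x\<close> by simp
  qed (use that neg in auto)
  obtain \<eta> where eta: "0 < \<eta>" "\<And>x. X0 \<le> x \<Longrightarrow> R a x \<le> - \<eta>"
  proof -
    have "\<not> ((\<lambda>x. - R a x) \<longlongrightarrow> 0) at_top" using not_lim tendsto_minus_cancel_left[of "R a" 0] by simp
    then have "\<exists>\<eta>>0. \<forall>x\<ge>X0. \<eta> \<le> - R a x"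
      using R0 inc by (intro decreasing_bounded_away) auto
    then show thesis using that by fastforce
  qed
  \<comment> \<open>Late enough for the remaining push \<open>\<mu>\<close> / 2 / (1 + X) to be less
    than \<open>\<eta>\<close>.\<close>
  define X where "X = X0 + \<mu> / \<eta>"
  have "0 < \<mu> / \<eta>" using eta(1) mu_pos by (rule divide_pos_pos[rotated])
  then have X: "0 < X" "X0 \<le> X" using neg(1) by (simp_all add: X_def)
  have "\<mu> / 2 / (1 + X) < \<eta>"
  proof -
    have "0 < \<eta> * (1 + X0)" using eta(1) neg(1) by (intro mult_pos_pos) simp_all
    moreover have "\<eta> * (1 + X) = \<eta> * (1 + X0) + \<mu>"
      using eta(1) by (simp add: X_def distrib_left)
    ultimately have "\<mu> < \<eta> * (1 + X)" by linarith
    then have "\<mu> / 2 < \<eta> * (1 + X)" using mu_pos by linarith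
    moreover have "0 < 1 + X" using X by simp
    ultimately show ?thesis by (simp only: pos_divide_less_eq)
  qed
  then have low: "R a X < - (\<mu> / 2 / (1 + X))" using eta(2)[OF X(2)] by linarith
  have WX: "W a X < 0" using neg X by simp
  have "\<forall>\<^sub>F b in nhds a. W b X < 0" by (rule order_tendstoD(2)[OF tendsto_W WX])
  moreover have "\<forall>\<^sub>F b in nhds a. R b X < - (\<mu> / 2 / (1 + X))"
    by (rule order_tendstoD(2)[OF tendsto_R low])
  moreover have "\<forall>\<^sub>F b in nhds a. card (zeros b \<inter> {..X}) \<le> m"
    using eventually_card_zeros_upto[OF assms(1)] X by simp
  ultimately show ?thesis
  proof eventually_elim
    case (elim b)
    show ?case
    proof (rule atmost_by_tail(1)[OF less_imp_le[OF X(1)] elim(3)])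
      fix x assume "X < x"
      then have "W b x < 0" using tail_negative[of X b x] X elim by simp
      then show "Y b x \<noteq> 0" by (auto simp: W_def)
    qed
  qed
qed

end

section \<open>Very negative parameters, and the inversion\<close>

lemma tendsto_at_right_continuous:
  fixes f :: "real \<Rightarrow> real"
  assumes "continuous_on UNIV f"
  shows "(f \<longlongrightarrow> f x) (at_right x)"
proof -
  have "(f \<longlongrightarrow> f x) (at x)" using assms by (simp add: continuous_on_def)
  then show ?thesis by (rule tendsto_within_subset) simp
qed

context shooting
begin

text \<open>For very negative \<open>a\<close> the solution stays below \<open>-1\<close> until a late \<open>X1\<close>, then crosses \<open>0\<close> with a
  definite slope.\<close>

lemma exists_negative_atmost_2: "\<exists>a<0. a \<in> atmost 2"
proof -
  \<comment> \<open>Over one unit of ln x after a crossing at c > X1, the pull costs at most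
    (\<open>\<mu>\<close> / 2) e^\<open>\<mu>\<close> / c. The factor 8 e^\<open>\<mu>\<close> keeps
    this below \<open>\<mu>\<close> / 16, half of the crossing slope \<open>\<mu>\<close> /
    8.\<close>
  define X1 where "X1 = 8 * exp \<mu>"
  have X1: "8 \<le> X1" using mu_pos by (simp add: X1_def)
  \<comment> \<open>By \<open>W_le\<close> this start keeps W at or below -1 on all of
    [0, X1].\<close>
  define a where "a = - 1 - \<mu> / 2 * ln (1 + X1)"
  have ln0: "0 \<le> \<mu> / 2 * ln (1 + X1)" using mu_pos X1 by (intro mult_nonneg_nonneg) auto
  then have a: "a < 0" by (simp add: a_def)
  have Wlow: "W a t \<le> - 1" if "0 \<le> t" "t \<le> X1" for t
  proof -
    have "\<mu> / 2 * ln (1 + t) \<le> \<mu> / 2 * ln (1 + X1)"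
      using that mu_pos by (intro mult_left_mono) auto
    then show ?thesis using W_le[OF that(1), of a] by (simp add: a_def)
  qed
  \<comment> \<open>W <= -1 gives e^(2W) - 1 <= -1/2, so R' >= (\<open>\<mu>\<close> / 4) / (1 +
    t)^2, whose integral over [0, 1] is \<open>\<mu>\<close> / 8.\<close>
  have R1: "\<mu> / 8 \<le> R a 1"
  proof -
    have "R a 0 + \<mu> / 4 * (1 / (1 + 0)) \<le> R a 1 + \<mu> / 4 * (1 / (1 + 1))"
    proof (rule DERIV_nonneg_imp_nondecreasing[of 0 1 "\<lambda>t. R a t + \<mu> / 4 * (1 / (1 + t))"])
      fix t :: real assume t: "0 \<le> t" "t \<le> 1"
      have d: "((\<lambda>t. 1 / (1 + t)) has_real_derivative - (1 / (1 + t)\<^sup>2)) (at t)"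
        using t by (intro DERIV_reciprocal_plus1) simp
      have "exp (2 * W a t) \<le> exp (- 1)" using Wlow[of t] t X1 by simp
      also have "exp (- 1) \<le> 1 / (2 :: real)"
        using exp_ge_add_one_self[of "1 :: real"] by (simp add: exp_minus divide_simps)
      finally have "exp (2 * W a t) - 1 \<le> - (1 / 2)" by simp
      then have "\<mu> / 2 / (1 + t)\<^sup>2 * (exp (2 * W a t) - 1) \<le> \<mu> / 2 / (1 + t)\<^sup>2 * (- (1 / 2))"
        using mu_pos by (intro mult_left_mono) auto
      then have "0 \<le> - (\<mu> / 2 / (1 + t)\<^sup>2) * (exp (2 * W a t) - 1) + \<mu> / 4 * - (1 / (1 + t)\<^sup>2)"
        by simp
      then show "\<exists>y. ((\<lambda>t. R a t + \<mu> / 4 * (1 / (1 + t))) has_real_derivative y) (at t) \<and> 0 \<le> y"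
        using DERIV_add[OF DERIV_R[OF t(1), of a] DERIV_cmult[OF d, of "\<mu> / 4"]] by blast
    qed simp
    then show ?thesis by simp
  qed
  have "\<exists>x\<ge>0. 0 \<le> W a x"
  proof (rule ccontr)
    assume "\<not> ?thesis"
    then have neg: "W a x < 0" if "0 \<le> x" for x
      using that not_le by blast
    have "R a 1 \<le> R a t" if "1 \<le> t" for t
      by (rule R_increasing) (use that in \<open>auto intro!: less_imp_le[OF neg]\<close>)
    then have inc: "\<mu> / 8 \<le> R a t" if "1 \<le> t" for t using R1 that by (meson order_trans)
    define L where "L = - W a 1 / (\<mu> / 8)"
    have "0 \<le> L" unfolding L_def using neg[of 1] mu_pos by (intro divide_nonneg_pos) auto
    then have "1 \<le> exp L" by simp
    then have "W a 1 + \<mu> / 8 * (ln (exp L) - ln 1) \<le> W a (exp L)"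
      by (intro W_log_ge) (use inc in auto)
    then have "0 \<le> W a (exp L)" using mu_pos by (simp add: L_def)
    then show False using neg[of "exp L"] by simp
  qed
  then obtain x2 where x2: "0 \<le> x2" "0 \<le> W a x2" by blast
  obtain c where c: "0 < c" "c \<le> x2" "W a c = 0" "\<And>t. 0 \<le> t \<Longrightarrow> t < c \<Longrightarrow> W a t < 0"
    using first_nonneg[of 0 x2 "W a"] x2 a continuous_on_W by auto
  have cX: "X1 < c" using Wlow[of c] c by (cases "X1 < c") auto
  have c8: "8 \<le> c" using cX X1 by simp
  have "R a 1 \<le> R a c"
  proof (rule R_increasing)
    show "W a t \<le> 0" if "1 \<le> t" "t \<le> c" for t
      using c(3) c(4)[of t] that by (cases "t = c") auto
  qed (use c8 in auto)
  then have Rc: "\<mu> / 8 \<le> R a c" using R1 by simp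
  \<comment> \<open>One unit of ln x past the crossing. The slope stays above \<open>\<mu>\<close> /
    16 until then, so W(d) >= \<open>\<mu>\<close> / 16, and with d >= 8 this yields
    \<open>\<mu>\<close> / 2 <= d W(d). One zero up to \<open>d\<close> and at most one later make
    two.\<close>
  define d where "d = c * exp 1"
  have lnd: "ln d = ln c + 1" using c by (simp add: d_def ln_mult)
  have cd: "c < d" using c by (simp add: d_def)
  have Rpos: "\<mu> / 16 \<le> R a t" if t: "c \<le> t" "t \<le> d" for t
  proof -
    define K where "K = \<mu> / 2 * exp \<mu>"
    have "R a c - K * (1 / c) \<le> R a t - K * (1 / t)"
      unfolding K_def
    proof (rule R_lower[OF c(1) t(1)])
      fix s assume s: "c \<le> s" "s \<le> t"
      have "W a s \<le> W a c + \<mu> / 2 * (ln s - ln c)"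
      proof (rule W_log_le)
        show "R a u \<le> \<mu> / 2" if "c \<le> u" for u using R_le[of u a] that c by simp
      qed (use c s in auto)
      also have "\<dots> \<le> \<mu> / 2"
      proof -
        have "ln s \<le> ln d" using s t c by simp
        then have "\<mu> / 2 * (ln s - ln c) \<le> \<mu> / 2 * 1" using lnd mu_pos by (intro mult_left_mono) auto
        then show ?thesis using c by simp
      qed
      finally show "exp (2 * W a s) \<le> exp \<mu>" by simp
    qed
    moreover have "K * (1 / c) \<le> \<mu> / 16"
    proof -
      have "K * (1 / c) \<le> K * (1 / X1)"
        using cX X1 mu_pos by (intro mult_left_mono divide_left_mono) (auto simp: K_def)
      also have "\<dots> = \<mu> / 16" by (simp add: K_def X1_def)
      finally show ?thesis .
    qed
    moreover have "0 \<le> K * (1 / t)" using t c mu_pos by (simp add: K_def)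
    ultimately show ?thesis using Rc by linarith
  qed
  have "W a c + \<mu> / 16 * (ln d - ln c) \<le> W a d"
    by (rule W_log_ge) (use c cd Rpos in auto)
  then have Wd: "\<mu> / 16 \<le> W a d" using c lnd by simp
  have "zeros a \<inter> {..d} \<subseteq> {c}"
  proof
    fix x assume "x \<in> zeros a \<inter> {..d}"
    then have x: "0 \<le> x" "x \<le> d" "W a x = 0" by (auto simp: zeros_def W_def)
    have "\<not> x < c" using c(4)[of x] x by auto
    moreover have "\<not> c < x"
    proof
      assume "c < x"
      then have "W a c < W a x"
      proof (rule W_strict_increasing[OF c(1)])
        show "0 < R a t" if "c \<le> t" "t \<le> x" for t
          using Rpos[of t] that x mu_pos by linarith
      qed
      then show False using c x by simp
    qed
    ultimately show "x \<in> {c}" by simp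
  qed
  then have card1: "card (zeros a \<inter> {..d}) \<le> 1" using card_mono[of "{c}"] by simp
  have d0: "0 < d" using c cd by simp
  have "8 * (\<mu> / 16) \<le> d * W a d" using c8 cd Wd mu_pos by (intro mult_mono) auto
  then have big: "\<mu> / 2 \<le> d * W a d" by simp
  have Wd0: "0 < W a d" using Wd mu_pos by linarith
  have "a \<in> atmost (Suc 1)"
  proof (rule atmost_by_tail(2)[OF less_imp_le[OF d0] card1])
    fix x y assume "d < x" "x < y" "Y a x = 0"
    then have "W a y \<noteq> 0" using one_zero_after_positive[OF d0 Wd0 big, of x y] by (simp add: W_def)
    then show "Y a y \<noteq> 0" by (auto simp: W_def)
  qed
  then have "a \<in> atmost 2" by (simp add: numeral_2_eq_2)
  then show ?thesis using a by blast
qed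

text \<open>Once R < 1/4, e^(2W) is at most of order t^(1/2) and the pull of order t^(-3/2).
  Integrating from infinity, where R vanishes, gives R of order t^(-1/2), so W' = R/t is integrable
  and the increasing W is bounded.\<close>

lemma W_converges:
  assumes X0: "0 < X0" "\<And>x. X0 \<le> x \<Longrightarrow> 0 < W a x" and lim: "(R a \<longlongrightarrow> 0) at_top"
  obtains b where "0 < b" "(W a \<longlongrightarrow> b) at_top" "\<And>x. X0 \<le> x \<Longrightarrow> W a x \<le> b"
proof -
  have R0: "0 \<le> R a t" if "X0 \<le> t" for t using R_nonneg_tail[of X0 a t] X0 that by blast
  have mono: "W a x \<le> W a y" if "X0 \<le> x" "x \<le> y" for x y
    using W_log_ge[of x y 0 a] R0 that X0 by auto
  have "\<forall>\<^sub>F x in at_top. R a x < 1 / 4" by (rule order_tendstoD(2)[OF lim]) simp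
  then obtain X where "\<And>x. X \<le> x \<Longrightarrow> R a x < 1 / 4" by (auto simp: eventually_at_top_linorder)
  then obtain X1 where X1: "X0 \<le> X1" "\<And>x. X1 \<le> x \<Longrightarrow> R a x < 1 / 4"
    by (metis max.bounded_iff max.cobounded1)
  have X1_pos: "0 < X1" using X1 X0 by simp
  define C where "C = exp (2 * W a X1 - ln X1 / 2)"
  \<comment> \<open>This is t^(-1/2), written through ln and exp for differentiation.\<close>
  define h where "h t = exp (- (ln t / 2))" for t :: real
  have dh: "(h has_real_derivative - (h t / t / 2)) (at t)" if "0 < t" for t
  proof -
    have "((\<lambda>t. - (ln t / 2)) has_real_derivative - (1 / t / 2)) (at t)"
      using that by (auto intro!: derivative_eq_intros)
    from DERIV_chain2[where f = exp and g = "\<lambda>t. - (ln t / 2)", OF DERIV_exp this]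
    show ?thesis unfolding h_def by simp
  qed
  have Rh: "R a x \<le> \<mu> * C * h x" if x: "X1 \<le> x" for x
  proof -
    have "R a x - \<mu> * C * h x \<le> 0"
    proof (rule nondecreasing_limit_0[of x "\<lambda>x. R a x - \<mu> * C * h x"])
      fix t assume t: "x \<le> t"
      have t0: "0 < t" using t x X1_pos by simp
      have "W a t \<le> W a X1 + 1 / 4 * (ln t - ln X1)"
        by (rule W_log_le) (use X1 X1_pos t x in \<open>auto intro: less_imp_le\<close>)
      moreover have "2 * v \<le> (2 * v1 - l1 / 2) + l / 2" if "v \<le> v1 + 1 / 4 * (l - l1)" for v v1 l l1 :: real
        using that by (simp add: field_simps)
      ultimately have "2 * W a t \<le> (2 * W a X1 - ln X1 / 2) + ln t / 2" by blast
      then have "exp (2 * W a t) \<le> C * exp (ln t / 2)" unfolding C_def by (simp flip: exp_add)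
      then have "\<mu> / 2 / (1 + t)\<^sup>2 * (exp (2 * W a t) - 1) \<le> \<mu> / 2 / t\<^sup>2 * (C * exp (ln t / 2))"
      proof (intro mult_mono)
        show "\<mu> / 2 / (1 + t)\<^sup>2 \<le> \<mu> / 2 / t\<^sup>2"
          using mu_pos t0 by (intro divide_left_mono power_mono) auto
        show "0 \<le> exp (2 * W a t) - 1" using X0(2)[of t] X1 x t by simp
      qed (use mu_pos in auto)
      also have "exp (ln t / 2) = t * h t"
      proof -
        have "exp (ln t / 2) = exp (ln t + - (ln t / 2))" by (rule arg_cong) simp
        also have "\<dots> = t * h t" using t0 by (simp only: exp_add h_def exp_ln)
        finally show ?thesis .
      qed
      also have "\<mu> / 2 / t\<^sup>2 * (C * (t * h t)) = \<mu> * C * (h t / t / 2)"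
        using t0 by (simp add: power2_eq_square)
      finally have "0 \<le> - (\<mu> / 2 / (1 + t)\<^sup>2) * (exp (2 * W a t) - 1) - \<mu> * C * - (h t / t / 2)"
        by simp
      then show "\<exists>D. ((\<lambda>x. R a x - \<mu> * C * h x) has_real_derivative D) (at t) \<and> 0 \<le> D"
        using DERIV_diff[OF DERIV_R[OF less_imp_le[OF t0], of a] DERIV_cmult[OF dh[OF t0], of "\<mu> * C"]]
        by blast
    next
      have "(h \<longlongrightarrow> 0) at_top"
      proof -
        have "filterlim (\<lambda>t::real. 1 / 2 * ln t) at_top at_top"
          by (rule filterlim_tendsto_pos_mult_at_top[OF tendsto_const _ ln_at_top]) simp
        then have "filterlim (\<lambda>t::real. - (ln t / 2)) at_bot at_top"
          by (subst filterlim_uminus_at_bot) simp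
        then show ?thesis unfolding h_def by (rule filterlim_compose[OF exp_at_bot])
      qed
      from tendsto_diff[OF lim tendsto_mult[OF tendsto_const this]]
      show "((\<lambda>x. R a x - \<mu> * C * h x) \<longlongrightarrow> 0) at_top" by simp
    qed
    then show ?thesis by simp
  qed
  have bound: "W a x \<le> W a X1 + 2 * \<mu> * C * h X1" if x: "X1 \<le> x" for x
  proof -
    have "W a x + 2 * \<mu> * C * h x \<le> W a X1 + 2 * \<mu> * C * h X1"
    proof (rule DERIV_nonpos_imp_nonincreasing[OF x, of "\<lambda>x. W a x + 2 * \<mu> * C * h x"])
      fix t assume t: "X1 \<le> t" "t \<le> x"
      have t0: "0 < t" using t X1_pos by simp
      have "R a t / t \<le> \<mu> * C * h t / t" using Rh[OF t(1)] t0 by (intro divide_right_mono) auto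
      then have "R a t / t + 2 * \<mu> * C * - (h t / t / 2) \<le> 0" by simp
      then show "\<exists>y. ((\<lambda>x. W a x + 2 * \<mu> * C * h x) has_real_derivative y) (at t) \<and> y \<le> 0"
        using DERIV_add[OF DERIV_W[OF t0, of a] DERIV_cmult[OF dh[OF t0], of "2 * \<mu> * C"]] by blast
    qed
    moreover have "0 \<le> 2 * \<mu> * C * h x" using mu_pos by (simp add: C_def h_def)
    ultimately show ?thesis by linarith
  qed
  define b where "b = Sup (W a ` {X0..})"
  have bdd: "bdd_above (W a ` {X0..})"
  proof (rule bdd_aboveI2)
    fix x assume "x \<in> {X0..}"
    then have "W a x \<le> W a (max x X1)" by (intro mono) auto
    also have "\<dots> \<le> W a X1 + 2 * \<mu> * C * h X1" by (intro bound) simp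
    finally show "W a x \<le> W a X1 + 2 * \<mu> * C * h X1" .
  qed
  have le: "W a x \<le> b" if "X0 \<le> x" for x
    unfolding b_def using that bdd by (intro cSup_upper) auto
  have "(W a \<longlongrightarrow> b) at_top"
  proof (rule increasing_tendsto)
    show "\<forall>\<^sub>F x in at_top. W a x \<le> b" using le by (auto simp: eventually_at_top_linorder)
    fix y assume "y < b"
    then obtain x where x: "X0 \<le> x" "y < W a x"
      using less_cSup_iff[OF _ bdd] by (auto simp: b_def)
    then have "y < W a z" if "x \<le> z" for z using mono[of x z] that by linarith
    then show "\<forall>\<^sub>F z in at_top. y < W a z" by (auto simp: eventually_at_top_linorder)
  qed
  moreover have "0 < b" using le[of X0] X0(2)[of X0] by simp
  ultimately show thesis using that le by blast
qed

text \<open>The equation is invariant under the inversion \<open>x \<mapsto> 1 / x\<close>, which exchanges the values of a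
  regular solution at \<open>0\<close> and at \<open>\<infinity>\<close>.\<close>

lemma reflect:
  assumes a: "a \<in> atmost m" "a \<noteq> 0" and lim: "(R a \<longlongrightarrow> 0) at_top"
    and X0: "0 < X0" "\<And>x. X0 \<le> x \<Longrightarrow> 0 < W a x"
  shows "\<exists>b>0. b \<in> atmost m"
proof -
  obtain b where b: "0 < b" "(W a \<longlongrightarrow> b) at_top" "\<And>x. X0 \<le> x \<Longrightarrow> W a x \<le> b"
    using W_converges[OF X0 lim] by blast
  define K where "K = \<mu> / 2 * exp (2 * b)"
  have R0: "0 \<le> R a t" if "X0 \<le> t" for t using R_nonneg_tail[of X0 a t] X0 that by blast
  \<comment> \<open>Boundedness of W improves the decay of R to order 1/x. The reflected slope is
    then of order t at 0, as needed for the energy of the difference to vanish there.\<close>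
  have RK: "R a x \<le> K / x" if x: "X0 \<le> x" for x
  proof -
    have "R a x - K * (1 / x) \<le> 0"
    proof (rule tendsto_lowerbound)
      have "((\<lambda>x::real. 1 / x) \<longlongrightarrow> 0) at_top"
        using tendsto_inverse_0_at_top[OF filterlim_ident[of "at_top :: real filter"]]
        by (simp add: inverse_eq_divide)
      from tendsto_diff[OF lim tendsto_mult[OF tendsto_const this]]
      show "((\<lambda>y. R a y - K * (1 / y)) \<longlongrightarrow> 0) at_top" by simp
      have "R a x - K * (1 / x) \<le> R a y - K * (1 / y)" if "x \<le> y" for y
        unfolding K_def by (rule R_lower) (use x X0 b(3) that in auto)
      then show "\<forall>\<^sub>F y in at_top. R a x - K * (1 / x) \<le> R a y - K * (1 / y)"
        by (auto simp: eventually_at_top_linorder)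
    qed simp
    then show ?thesis by simp
  qed
  define w where "w t = W a (1 / t)" for t
  define r where "r t = - R a (1 / t)" for t
  have w': "(w has_real_derivative r t / t) (at t)" if t: "0 < t" for t
  proof -
    have "R a (1 / t) / (1 / t) * - (1 / t\<^sup>2) = r t / t"
      using t by (simp add: r_def power2_eq_square)
    moreover have "(w has_real_derivative R a (1 / t) / (1 / t) * - (1 / t\<^sup>2)) (at t)"
      unfolding w_def
      using DERIV_chain2[where f = "W a" and g = "\<lambda>t. 1 / t", OF DERIV_W DERIV_reciprocal[OF t]] t by simp
    ultimately show ?thesis by (simp only:)
  qed
  have r': "(r has_real_derivative - (\<mu> / 2 / (1 + t)\<^sup>2) * (exp (2 * w t) - 1)) (at t)" if t: "0 < t" for t
  proof -
    \<comment> \<open>The invariance itself: the measure dt / (1 + t)^2 is carried to itself by t ->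
      1/t.\<close>
    have "(1 + 1 / t)\<^sup>2 * t\<^sup>2 = (1 + t)\<^sup>2"
      using t by (simp add: power_mult_distrib[symmetric] distrib_right add.commute)
    then have "\<mu> / 2 / (1 + 1 / t)\<^sup>2 * (1 / t\<^sup>2) = \<mu> / 2 / (1 + t)\<^sup>2" by (simp add: mult.commute)
    moreover have "- (- k * e * - i) = - (k * i) * e" for k e i :: real by simp
    ultimately have "- (- (\<mu> / 2 / (1 + 1 / t)\<^sup>2) * (exp (2 * W a (1 / t)) - 1) * - (1 / t\<^sup>2))
        = - (\<mu> / 2 / (1 + t)\<^sup>2) * (exp (2 * w t) - 1)"
      unfolding w_def by metis
    moreover have "(r has_real_derivative
        - (- (\<mu> / 2 / (1 + 1 / t)\<^sup>2) * (exp (2 * W a (1 / t)) - 1) * - (1 / t\<^sup>2))) (at t)"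
      unfolding r_def
      by (rule DERIV_minus, rule DERIV_chain2[where f = "R a" and g = "\<lambda>t. 1 / t", OF DERIV_R DERIV_reciprocal[OF t]])
         (use t in simp)
    ultimately show ?thesis by (simp only:)
  qed
  have eq: "w X = W b X" if X: "0 < X" for X
  proof -
    \<comment> \<open>A common upper bound for both solutions on (0, X]: \<open>b\<close> where 1/t
      >= X0, and the a priori logarithmic bound for the rest and for \<open>W b\<close>.\<close>
    define M where "M = Max {0, b, a + \<mu> / 2 * ln (1 + X0), b + \<mu> / 2 * ln (1 + X)}"
    have M: "0 \<le> M" "b \<le> M" "a + \<mu> / 2 * ln (1 + X0) \<le> M" "b + \<mu> / 2 * ln (1 + X) \<le> M"
      by (auto simp: M_def)
    show ?thesis
    proof (rule singular_uniqueness[OF mu_pos X M(1)])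
      fix t assume t: "0 < t" "t \<le> X"
      show "(w has_real_derivative r t / t) (at t)" using w' t by blast
      show "(W b has_real_derivative R b t / t) (at t)" using DERIV_W t by blast
      show "(r has_real_derivative - (\<mu> / 2 / (1 + t)\<^sup>2) * (exp (2 * w t) - 1)) (at t)" using r' t by blast
      show "(R b has_real_derivative - (\<mu> / 2 / (1 + t)\<^sup>2) * (exp (2 * W b t) - 1)) (at t)"
        using DERIV_R t by simp
      show "w t \<le> M"
      proof (cases "X0 \<le> 1 / t")
        case True
        then show ?thesis using b(3)[of "1 / t"] M by (simp add: w_def)
      next
        case False
        have "\<mu> / 2 * ln (1 + 1 / t) \<le> \<mu> / 2 * ln (1 + X0)"
          using False t X0 mu_pos by (intro mult_left_mono) (auto simp: add_pos_pos)
        then show ?thesis using W_le[of "1 / t" a] t M by (simp add: w_def)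
      qed
      have "\<mu> / 2 * ln (1 + t) \<le> \<mu> / 2 * ln (1 + X)" using t mu_pos by (intro mult_left_mono) auto
      then show "W b t \<le> M" using W_le[of t b] t M by simp
    next
      have "filterlim (\<lambda>t::real. 1 / t) at_top (at_right 0)"
        using filterlim_inverse_at_top_right by (simp add: inverse_eq_divide)
      then have "(w \<longlongrightarrow> b) (at_right 0)" unfolding w_def by (rule filterlim_compose[OF b(2)])
      moreover have "(W b \<longlongrightarrow> W b 0) (at_right 0)"
        by (intro tendsto_at_right_continuous continuous_on_W)
      ultimately have d: "((\<lambda>t. w t - W b t) \<longlongrightarrow> b - b) (at_right 0)"
        by (intro tendsto_diff) simp_all
      have V: "((\<lambda>t. V b t) \<longlongrightarrow> V b 0) (at_right 0)"
        by (intro tendsto_at_right_continuous continuous_intros)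
      have "((\<lambda>t. t * (K + \<bar>b * V b t\<bar>)\<^sup>2) \<longlongrightarrow> 0 * (K + \<bar>b * V b 0\<bar>)\<^sup>2) (at_right 0)"
        by (intro tendsto_intros V)
      then have lim0: "((\<lambda>t. t * (K + \<bar>b * V b t\<bar>)\<^sup>2) \<longlongrightarrow> 0) (at_right 0)" by simp
      have "((\<lambda>t. (r t - R b t)\<^sup>2 / t) \<longlongrightarrow> 0) (at_right 0)"
      proof (rule Lim_null_comparison[OF _ lim0])
        have "norm ((r t - R b t)\<^sup>2 / t) \<le> t * (K + \<bar>b * V b t\<bar>)\<^sup>2" if t: "0 < t" "t < 1 / X0" for t
        proof -
          have Xt: "X0 \<le> 1 / t" using t X0 by (simp add: field_simps)
          have "\<bar>r t\<bar> \<le> K * t" using RK[OF Xt] R0[OF Xt] by (simp add: r_def)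
          moreover have "\<bar>R b t\<bar> = t * \<bar>b * V b t\<bar>" using t by (simp add: R_def Q_def abs_mult)
          ultimately have "\<bar>r t - R b t\<bar> \<le> t * (K + \<bar>b * V b t\<bar>)"
            by (simp add: distrib_left mult.commute)
          then have "(r t - R b t)\<^sup>2 \<le> (t * (K + \<bar>b * V b t\<bar>))\<^sup>2"
            by (metis abs_ge_zero power2_abs power_mono)
          also have "\<dots> = (t * (K + \<bar>b * V b t\<bar>)\<^sup>2) * t" by (simp add: power2_eq_square)
          finally have "(r t - R b t)\<^sup>2 / t \<le> t * (K + \<bar>b * V b t\<bar>)\<^sup>2"
            using t(1) by (simp only: pos_divide_le_eq)
          then show ?thesis using t by simp
        qed
        then show "\<forall>\<^sub>F t in at_right 0. norm ((r t - R b t)\<^sup>2 / t) \<le> t * (K + \<bar>b * V b t\<bar>)\<^sup>2"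
          using X0 unfolding eventually_at_right_field by (intro exI[of _ "1 / X0"]) simp
      qed
      from tendsto_add[OF tendsto_power[OF d, of 2] this]
      show "((\<lambda>t. (w t - W b t)\<^sup>2 + (r t - R b t)\<^sup>2 / t) \<longlongrightarrow> 0) (at_right 0)" by simp
    qed
  qed
  \<comment> \<open>Y b has no zero at 0, so every one of its zeros has a reciprocal, which is a
    zero of Y a.\<close>
  have "zeros b \<subseteq> (\<lambda>y. 1 / y) ` zeros a"
  proof
    fix x assume "x \<in> zeros b"
    then have x: "0 \<le> x" "Y b x = 0" by (auto simp: zeros_def)
    have "x \<noteq> 0" using x(2) Y_0[of b] by auto
    then have x0: "0 < x" using x by simp
    have "W a (1 / x) = 0" using eq[OF x0] x by (simp add: w_def W_def)
    then have "Y a (1 / x) = 0" using a by (simp add: W_def)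
    then have "1 / x \<in> zeros a" using x0 by (simp add: zeros_def)
    moreover have "x = 1 / (1 / x)" by simp
    ultimately show "x \<in> (\<lambda>y. 1 / y) ` zeros a" by blast
  qed
  moreover have fin: "finite ((\<lambda>y. 1 / y) ` zeros a)" using a by (simp add: atmost_def)
  ultimately have "finite (zeros b)" "card (zeros b) \<le> card ((\<lambda>y. 1 / y) ` zeros a)"
    by (auto intro: finite_subset card_mono)
  moreover have "card ((\<lambda>y. 1 / y) ` zeros a) \<le> card (zeros a)"
    using a by (intro card_image_le) (simp add: atmost_def)
  ultimately have "b \<in> atmost m" using a by (simp add: atmost_def)
  then show ?thesis using b by blast
qed

end

lemma constant_sign:
  fixes f :: "real \<Rightarrow> real"
  assumes "connected I" "continuous_on I f" "\<And>x. x \<in> I \<Longrightarrow> f x \<noteq> 0"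
  shows "\<exists>\<sigma>. \<forall>x\<in>I. 0 < \<sigma> * f x"
proof (cases "\<exists>x\<in>I. 0 < f x")
  case True
  then obtain x where x: "x \<in> I" "0 < f x" by blast
  have "0 < f y" if y: "y \<in> I" for y
  proof (rule ccontr)
    assume "\<not> 0 < f y"
    then have "f y \<le> 0" by simp
    moreover have "connected (f ` I)" by (rule connected_continuous_image[OF assms(2,1)])
    ultimately have "0 \<in> f ` I"
      using connected_contains_Icc[of "f ` I" "f y" "f x"] x y by auto
    then show False using assms(3) by auto
  qed
  then show ?thesis by (intro exI[of _ 1]) simp
next
  case False
  then have "0 < - 1 * f x" if "x \<in> I" for x using assms(3)[OF that] that by (auto simp: not_less less_le)
  then show ?thesis by (intro exI[of _ "- 1"]) simp
qed

lemma DERIV_nonneg_of_right_min: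
  fixes g :: "real \<Rightarrow> real"
  assumes "(g has_real_derivative D) (at z)" "z < b" "\<And>x. z < x \<Longrightarrow> x < b \<Longrightarrow> g z \<le> g x"
  shows "0 \<le> D"
proof (rule ccontr)
  assume "\<not> 0 \<le> D"
  then obtain d where d: "0 < d" "\<And>h. 0 < h \<Longrightarrow> h < d \<Longrightarrow> g (z + h) < g z"
    using DERIV_neg_dec_right[OF assms(1)] by auto
  define h where "h = min (d / 2) ((b - z) / 2)"
  have "0 < h" "h < d" "z + h < b" using d(1) assms(2) by (auto simp: h_def min_def field_simps)
  then show False using d(2)[of h] assms(3)[of "z + h"] by simp
qed

lemma DERIV_nonpos_of_left_min:
  fixes g :: "real \<Rightarrow> real"
  assumes "(g has_real_derivative D) (at z)" "a < z" "\<And>x. a < x \<Longrightarrow> x < z \<Longrightarrow> g z \<le> g x"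
  shows "D \<le> 0"
proof (rule ccontr)
  assume "\<not> D \<le> 0"
  then obtain d where d: "0 < d" "\<And>h. 0 < h \<Longrightarrow> h < d \<Longrightarrow> g (z - h) < g z"
    using DERIV_pos_inc_left[OF assms(1)] by auto
  define h where "h = min (d / 2) ((z - a) / 2)"
  have "0 < h" "h < d" "a < z - h" using d(1) assms(2) by (auto simp: h_def min_def field_simps)
  then show False using d(2)[of h] assms(3)[of "z - h"] by simp
qed

section \<open>Sturm comparison with the Legendre polynomials\<close>

text \<open>\<open>f\<close> has the larger potential and so oscillates faster: it has a zero in
  every gap of the zeros of \<open>g\<close>, where 0 and, for bounded \<open>g\<close>, infinity
  also count as ends of a gap.\<close>

locale sturm =
  fixes A B :: real and f f' g g' :: "real \<Rightarrow> real"
  assumes AB: "B < A"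
    and df: "\<And>x. 0 \<le> x \<Longrightarrow> (f has_real_derivative f' x) (at x)"
    and dg: "\<And>x. 0 \<le> x \<Longrightarrow> (g has_real_derivative g' x) (at x)"
    and dxf: "\<And>x. 0 \<le> x \<Longrightarrow> ((\<lambda>x. x * f' x) has_real_derivative - (A / (1 + x)\<^sup>2) * f x) (at x)"
    and dxg: "\<And>x. 0 \<le> x \<Longrightarrow> ((\<lambda>x. x * g' x) has_real_derivative - (B / (1 + x)\<^sup>2) * g x) (at x)"

context sturm
begin

text \<open>The weight x makes it vanish at the singular point, which can therefore serve as an end
  of a gap without any boundary condition.\<close>

definition wronskian where "wronskian x = (x * f' x) * g x - f x * (x * g' x)"

lemma DERIV_wronskian:
  "0 \<le> x \<Longrightarrow> (wronskian has_real_derivative - ((A - B) / (1 + x)\<^sup>2) * (f x * g x)) (at x)"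
proof -
  assume x: "0 \<le> x"
  note DERIV_diff[OF DERIV_mult[OF dxf[OF x] dg[OF x]] DERIV_mult[OF df[OF x] dxg[OF x]]]
  moreover have "(- (A / q) * u) * v + u' * w' * x - ((w' * x) * u' + (- (B / q) * v) * u) = - ((A - B) / q) * (u * v)"
    for q u v u' w' x :: real
    by (simp add: algebra_simps diff_divide_distrib)
  ultimately show ?thesis
    unfolding wronskian_def[abs_def] by (simp add: algebra_simps diff_divide_distrib)
qed

lemma continuous_on_f: "S \<subseteq> {0..} \<Longrightarrow> continuous_on S f"
  and continuous_on_g: "S \<subseteq> {0..} \<Longrightarrow> continuous_on S g"
  by (meson DERIV_isCont df dg atLeast_iff continuous_at_imp_continuous_on subsetD)+

lemma wronskian_decreasing:
  assumes "0 \<le> a" "a < b" and pos: "\<And>x. a < x \<Longrightarrow> x < b \<Longrightarrow> 0 < f x \<and> 0 < g x"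
  shows "wronskian b < wronskian a"
proof (rule DERIV_neg_imp_decreasing_open[OF assms(2), of wronskian])
  fix x assume x: "a < x" "x < b"
  have "0 < (A - B) / (1 + x)\<^sup>2 * (f x * g x)" using pos[OF x] AB assms(1) x by simp
  then show "\<exists>y. (wronskian has_real_derivative y) (at x) \<and> y < 0"
    using DERIV_wronskian[of x] x assms(1) by (intro exI[of _ "- ((A - B) / (1 + x)\<^sup>2) * (f x * g x)"]) simp
next
  show "continuous_on {a..b} wronskian"
    using DERIV_wronskian assms(1) by (meson DERIV_isCont atLeastAtMost_iff continuous_at_imp_continuous_on order_trans)
qed

lemma wronskian_left:
  assumes z: "0 \<le> z" "z < b" "z = 0 \<or> g z = 0" and pos: "\<And>x. z < x \<Longrightarrow> x < b \<Longrightarrow> 0 < f x \<and> 0 < g x"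
  shows "wronskian z \<le> 0"
proof (cases "z = 0")
  case False
  then have gz: "g z = 0" using z by simp
  have "0 \<le> g' z"
    by (rule DERIV_nonneg_of_right_min[OF dg[OF z(1)] z(2)]) (use gz pos in \<open>auto intro: less_imp_le\<close>)
  moreover have "0 \<le> f z"
  proof (rule tendsto_lowerbound)
    show "(f \<longlongrightarrow> f z) (at_right z)"
      using DERIV_isCont[OF df[OF z(1)]] unfolding isCont_def by (rule tendsto_within_subset) simp
    show "\<forall>\<^sub>F x in at_right z. 0 \<le> f x"
      unfolding eventually_at_right_field using z pos by (intro exI[of _ b]) (auto intro: less_imp_le)
  qed simp
  ultimately show ?thesis using gz z by (simp add: wronskian_def)
qed (simp add: wronskian_def)

text \<open>The Wronskian is at most 0 at the left end and at least 0 at the right end, where g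
  comes down to 0, yet it decreases strictly in between.\<close>

lemma no_common_interval:
  assumes z: "0 \<le> z" "z < b" "z = 0 \<or> g z = 0" and b: "g b = 0"
    and pos: "\<And>x. z < x \<Longrightarrow> x < b \<Longrightarrow> 0 < f x \<and> 0 < g x"
  shows False
proof -
  have b0: "0 \<le> b" using z by simp
  have "g' b \<le> 0"
    by (rule DERIV_nonpos_of_left_min[OF dg[OF b0] z(2)]) (use b pos in \<open>auto intro: less_imp_le\<close>)
  moreover have "0 \<le> f b"
  proof (rule tendsto_lowerbound)
    show "(f \<longlongrightarrow> f b) (at_left b)"
      using DERIV_isCont[OF df[OF b0]] unfolding isCont_def by (rule tendsto_within_subset) simp
    show "\<forall>\<^sub>F x in at_left b. 0 \<le> f x"
      unfolding eventually_at_left_field using z pos by (intro exI[of _ z]) (auto intro: less_imp_le)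
  qed simp
  ultimately have "0 \<le> - (f b * (b * g' b))"
    using b0 by (simp add: mult_nonneg_nonpos)
  then have "0 \<le> wronskian b" using b by (simp add: wronskian_def)
  then show False using wronskian_decreasing[OF z(1,2) pos] wronskian_left[OF z pos] by simp
qed

text \<open>On an unbounded interval, \<open>(f / g)' = wronskian / (x g\<^sup>2)\<close> would drive \<open>f / g\<close> to \<open>-\<infinity>\<close>.\<close>

lemma no_common_ray:
  assumes z: "0 \<le> z" "z = 0 \<or> g z = 0" and M: "\<And>x. z < x \<Longrightarrow> g x \<le> M"
    and pos: "\<And>x. z < x \<Longrightarrow> 0 < f x \<and> 0 < g x"
  shows False
proof -
  define a where "a = z + 1"
  have a: "0 < a" "z < a" using z by (simp_all add: a_def)
  define \<eta> where "\<eta> = - wronskian a"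
  have eta: "0 < \<eta>"
    using wronskian_decreasing[OF z(1) a(2)] wronskian_left[OF z(1) a(2) z(2)] pos by (simp add: \<eta>_def)
  have M0: "0 < M" using M[OF a(2)] pos[OF a(2)] by linarith
  \<comment> \<open>With Wronskian at most \<open>- \<eta>\<close> and g at most \<open>M\<close>,
    the derivative of f / g is at most - c / t, and ln is unbounded.\<close>
  define c where "c = \<eta> / M\<^sup>2"
  have c: "0 < c" using eta M0 by (simp add: c_def)
  have key: "f x / g x + c * ln x \<le> f a / g a + c * ln a" if x: "a \<le> x" for x
  proof (rule DERIV_nonpos_imp_nonincreasing[OF x, of "\<lambda>x. f x / g x + c * ln x"])
    fix t assume t: "a \<le> t" "t \<le> x"
    have t0: "0 < t" "z < t" using t a by simp_all
    have g: "0 < g t" "g t \<le> M" using pos M t0 by blast+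
    have "wronskian t \<le> - \<eta>"
    proof (cases "t = a")
      case False
      then have "wronskian t < wronskian a"
        using t a by (intro wronskian_decreasing) (auto intro!: pos)
      then show ?thesis by (simp add: \<eta>_def)
    qed (simp add: \<eta>_def)
    have "((\<lambda>x. f x / g x) has_real_derivative (f' t * g t - f t * g' t) / (g t * g t)) (at t)"
      using DERIV_divide[OF df dg] t0 g by simp
    moreover have "(f' t * g t - f t * g' t) / (g t * g t) = wronskian t / (t * (g t)\<^sup>2)"
    proof -
      have "wronskian t = t * (f' t * g t - f t * g' t)" by (simp add: wronskian_def algebra_simps)
      then show ?thesis using t0 by (simp add: power2_eq_square)
    qed
    moreover have "wronskian t / (t * (g t)\<^sup>2) \<le> - (c / t)"
    proof -
      have "c / t = \<eta> / (t * M\<^sup>2)" by (simp add: c_def mult.commute)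
      also have "\<dots> \<le> \<eta> / (t * (g t)\<^sup>2)"
        using eta t0 g M0 by (intro divide_left_mono mult_left_mono power_mono) auto
      also have "\<dots> \<le> - wronskian t / (t * (g t)\<^sup>2)"
        using \<open>wronskian t \<le> - \<eta>\<close> t0 by (intro divide_right_mono) auto
      finally show ?thesis by simp
    qed
    moreover have "((\<lambda>x. c * ln x) has_real_derivative c / t) (at t)"
      using t0 by (auto intro!: derivative_eq_intros)
    ultimately have "((\<lambda>x. f x / g x + c * ln x) has_real_derivative wronskian t / (t * (g t)\<^sup>2) + c / t) (at t)"
      "wronskian t / (t * (g t)\<^sup>2) + c / t \<le> 0"
      using DERIV_add by (metis, linarith)
    then show "\<exists>y. ((\<lambda>x. f x / g x + c * ln x) has_real_derivative y) (at t) \<and> y \<le> 0" by blast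
  qed
  define x where "x = a * exp (f a / g a / c)"
  have "0 \<le> f a / g a / c" using pos[OF a(2)] c by simp
  then have "1 \<le> exp (f a / g a / c)" by (simp only: one_le_exp_iff)
  then have "a \<le> x" using a by (simp add: x_def)
  have "c * ln x = c * ln a + f a / g a"
    using a c by (simp add: x_def ln_mult distrib_left)
  then have "f x / g x \<le> 0" using key[OF \<open>a \<le> x\<close>] by linarith
  moreover have "0 < f x / g x" using pos[of x] \<open>a \<le> x\<close> a by simp
  ultimately show False by simp
qed

lemma scaled: "sturm A B (\<lambda>x. \<sigma> * f x) (\<lambda>x. \<sigma> * f' x) (\<lambda>x. \<tau> * g x) (\<lambda>x. \<tau> * g' x)"
proof
  fix x :: real assume x: "0 \<le> x"
  show "((\<lambda>x. \<sigma> * f x) has_real_derivative \<sigma> * f' x) (at x)" by (rule DERIV_cmult[OF df[OF x]])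
  show "((\<lambda>x. \<tau> * g x) has_real_derivative \<tau> * g' x) (at x)" by (rule DERIV_cmult[OF dg[OF x]])
  show "((\<lambda>x. x * (\<sigma> * f' x)) has_real_derivative - (A / (1 + x)\<^sup>2) * (\<sigma> * f x)) (at x)"
    using DERIV_cmult[OF dxf[OF x], of \<sigma>] by (simp add: mult.left_commute)
  show "((\<lambda>x. x * (\<tau> * g' x)) has_real_derivative - (B / (1 + x)\<^sup>2) * (\<tau> * g x)) (at x)"
    using DERIV_cmult[OF dxg[OF x], of \<tau>] by (simp add: mult.left_commute)
qed (rule AB)

text \<open>On a gap \<open>I\<close> without zeros of f, both functions have constant signs.
  Scaling by \<open>\<sigma>\<close> and \<open>\<tau>\<close> makes them positive, and one of the
  two preceding lemmas applies, according to whether g has a further zero.\<close>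

lemma zero_before_next:
  assumes S: "S = {x. 0 < x \<and> g x = 0}" "finite S" and M: "\<And>x. 0 \<le> x \<Longrightarrow> \<bar>g x\<bar> \<le> M"
    and z: "z \<in> insert 0 S"
  shows "\<exists>t>z. f t = 0 \<and> (\<forall>s\<in>S. z < s \<longrightarrow> t < s)"
proof (rule ccontr)
  assume none: "\<not> ?thesis"
  have z0: "0 \<le> z" "z = 0 \<or> g z = 0" using z S by auto
  define I where "I = {x. z < x \<and> (\<forall>s\<in>S. z < s \<longrightarrow> x < s)}"
  have I: "I \<subseteq> {0..}" using z0 by (auto simp: I_def)
  have "is_interval I" unfolding is_interval_1 I_def by (auto intro: less_le_trans le_less_trans)
  then have conn: "connected I" by (rule is_interval_connected)
  have "f x \<noteq> 0" if "x \<in> I" for x using none that unfolding I_def by blast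
  then obtain \<sigma> where \<sigma>: "\<forall>x\<in>I. 0 < \<sigma> * f x"
    using constant_sign[OF conn continuous_on_f[OF I]] by blast
  have "g x \<noteq> 0" if x: "x \<in> I" for x
  proof
    assume "g x = 0"
    moreover have "z < x" using x by (simp add: I_def)
    ultimately have "x \<in> S" using z0 by (simp add: S(1))
    then show False using x \<open>z < x\<close> by (auto simp: I_def)
  qed
  then obtain \<tau> where \<tau>: "\<forall>x\<in>I. 0 < \<tau> * g x"
    using constant_sign[OF conn continuous_on_g[OF I]] by blast
  interpret s: sturm A B "\<lambda>x. \<sigma> * f x" "\<lambda>x. \<sigma> * f' x" "\<lambda>x. \<tau> * g x" "\<lambda>x. \<tau> * g' x" by (rule scaled)
  define N where "N = {s \<in> S. z < s}"
  show False
  proof (cases "N = {}")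
    case True
    then have "I = {z<..}" by (auto simp: I_def N_def)
    moreover have "\<tau> * g x \<le> \<bar>\<tau>\<bar> * M" if "z < x" for x
    proof -
      have "\<tau> * g x \<le> \<bar>\<tau>\<bar> * \<bar>g x\<bar>" using abs_ge_self[of "\<tau> * g x"] by (simp only: abs_mult)
      also have "\<dots> \<le> \<bar>\<tau>\<bar> * M" using M[of x] that z0 by (intro mult_left_mono) auto
      finally show ?thesis .
    qed
    moreover have "z = 0 \<or> \<tau> * g z = 0" using z0 by auto
    ultimately show False using s.no_common_ray[of z "\<bar>\<tau>\<bar> * M"] z0 \<sigma> \<tau> by simp
  next
    case False
    have fin: "finite N" unfolding N_def by (rule finite_subset[OF _ S(2)]) auto
    define b where "b = Min N"
    have b: "b \<in> N" unfolding b_def using fin False by (rule Min_in)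
    have bI: "x \<in> I" if x: "z < x" "x < b" for x
    proof -
      have "x < s" if "s \<in> S" "z < s" for s
        using Min_le[OF fin, of s] that x by (simp add: N_def b_def)
      then show ?thesis using x by (simp add: I_def)
    qed
    have zb: "z < b" "\<tau> * g b = 0" using b S(1) by (simp_all add: N_def)
    have "z = 0 \<or> \<tau> * g z = 0" using z0 by auto
    then show False by (rule s.no_common_interval[OF z0(1) zb(1) _ zb(2)]) (use bI \<sigma> \<tau> in blast)
  qed
qed

end

text \<open>One point is picked in each gap to the right of a member of \<open>insert l S\<close>;
  the left end \<open>l\<close> accounts for the \<open>Suc\<close>. It serves both Rolle's theorem
  for the Legendre polynomials and the Sturm comparison.\<close>

lemma interlacing_card:
  fixes S :: "real set"
  assumes "finite S" "\<And>s. s \<in> S \<Longrightarrow> l < s"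
    and "\<And>z. z \<in> insert l S \<Longrightarrow> \<exists>t>z. P t \<and> (\<forall>s\<in>S. z < s \<longrightarrow> t < s)"
  shows "\<exists>T. finite T \<and> card T = Suc (card S) \<and> (\<forall>t\<in>T. P t)"
proof -
  obtain h where h: "\<And>z. z \<in> insert l S \<Longrightarrow> z < h z \<and> P (h z) \<and> (\<forall>s\<in>S. z < s \<longrightarrow> h z < s)"
    using assms(3) by metis
  have less: "h x < h y" if "x \<in> insert l S" "y \<in> insert l S" "x < y" for x y
  proof -
    have "y \<in> S" using that assms(2) by force
    then have "h x < y" using h[OF that(1)] that by blast
    then show ?thesis using h[OF that(2)] by linarith
  qed
  have "inj_on h (insert l S)"
    by (rule inj_onI) (metis less less_irrefl linorder_neqE_linordered_idom)
  moreover have "l \<notin> S" using assms(2) by blast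
  ultimately have "card (h ` insert l S) = Suc (card S)" using assms(1) by (simp add: card_image)
  then show ?thesis using h assms(1) by (intro exI[of _ "h ` insert l S"]) blast
qed

text \<open>The recursion for the derivative results from differentiating the one for \<open>P\<^sub>j\<^sub>+\<^sub>1\<close> and inserting
  the Legendre equation of \<open>P\<^sub>j\<close>.\<close>

fun legendre legendre' :: "nat \<Rightarrow> real \<Rightarrow> real" where
  "legendre 0 s = 1"
| "legendre (Suc j) s = s * legendre j s - (1 - s\<^sup>2) * legendre' j s / (real j + 1)"
| "legendre' 0 s = 0"
| "legendre' (Suc j) s = (real j + 1) * legendre j s + s * legendre' j s"

text \<open>Both halves are needed in one induction: the derivative of P_(j+1) uses the equation of
  P_j, and the equation of P_(j+1) follows by the product rule from both.\<close>

lemma legendre_ode: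
  "(legendre j has_real_derivative legendre' j s) (at s) \<and>
   ((\<lambda>s. (1 - s\<^sup>2) * legendre' j s) has_real_derivative - (real j * (real j + 1)) * legendre j s) (at s)"
proof (induction j arbitrary: s)
  case 0
  have "legendre 0 = (\<lambda>s. 1)" "legendre' 0 = (\<lambda>s. 0)" by (auto simp: fun_eq_iff)
  then show ?case by simp
next
  case (Suc j)
  define p where "p = legendre j s"
  define d where "d = legendre' j s"
  define n where "n = real j"
  have n: "n + 1 \<noteq> 0" by (simp add: n_def add_nonneg_eq_0_iff)
  have P: "(legendre j has_real_derivative d) (at s)" using Suc by (simp add: d_def)
  have D: "((\<lambda>s. (1 - s\<^sup>2) * legendre' j s) has_real_derivative - (n * (n + 1)) * p) (at s)"
    using Suc by (simp add: p_def n_def)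
  have fP: "legendre (Suc j) = (\<lambda>s. s * legendre j s - (1 - s\<^sup>2) * legendre' j s / (n + 1))"
    by (auto simp: fun_eq_iff n_def)
  have "(legendre (Suc j) has_real_derivative (1 * p + d * s) - (- (n * (n + 1)) * p) / (n + 1)) (at s)"
    unfolding fP using DERIV_diff[OF DERIV_mult[OF DERIV_ident P] DERIV_cdivide[OF D, of "n + 1"]]
    by (simp add: p_def)
  moreover have "(1 * p + d * s) - (- (n * (n + 1)) * p) / (n + 1) = legendre' (Suc j) s"
  proof -
    have "(- (n * (n + 1)) * p) / (n + 1) = - (n * p)" using n by simp
    then have "(1 * p + d * s) - (- (n * (n + 1)) * p) / (n + 1) = (n + 1) * p + s * d"
      by (simp add: algebra_simps)
    then show ?thesis by (simp add: p_def d_def n_def)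
  qed
  ultimately have 1: "(legendre (Suc j) has_real_derivative legendre' (Suc j) s) (at s)" by (simp only:)
  have fD: "(\<lambda>s. (1 - s\<^sup>2) * legendre' (Suc j) s) =
      (\<lambda>s. (n + 1) * ((1 - s\<^sup>2) * legendre j s) + s * ((1 - s\<^sup>2) * legendre' j s))"
    by (auto simp: fun_eq_iff n_def algebra_simps)
  have sq: "((\<lambda>s. 1 - s\<^sup>2) has_real_derivative - 2 * s) (at s)" by (auto intro!: derivative_eq_intros)
  have "((\<lambda>s. (1 - s\<^sup>2) * legendre' (Suc j) s) has_real_derivative
      (n + 1) * (- 2 * s * p + d * (1 - s\<^sup>2)) + (1 * ((1 - s\<^sup>2) * d) + - (n * (n + 1)) * p * s)) (at s)"
    unfolding fD
    using DERIV_add[OF DERIV_cmult[OF DERIV_mult[OF sq P], of "n + 1"] DERIV_mult[OF DERIV_ident D]]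
    by (simp add: p_def d_def)
  moreover have "(n + 1) * (- 2 * s * p + d * (1 - s\<^sup>2)) + (1 * ((1 - s\<^sup>2) * d) + - (n * (n + 1)) * p * s)
      = - ((n + 1) * (n + 2)) * (s * p - (1 - s\<^sup>2) * d / (n + 1))"
  proof -
    have "- ((n + 1) * (n + 2)) * (u - e / (n + 1)) = - ((n + 1) * (n + 2)) * u + (n + 2) * e" for u e
    proof -
      have "(n + 1) * (n + 2) * (e / (n + 1)) = (n + 2) * e" using n by simp
      then show ?thesis by (simp only: right_diff_distrib minus_mult_left[symmetric])
    qed
    moreover have "(n + 1) * (- 2 * s * p + d * (1 - s\<^sup>2)) + (1 * ((1 - s\<^sup>2) * d) + - (n * (n + 1)) * p * s)
        = - ((n + 1) * (n + 2)) * (s * p) + (n + 2) * ((1 - s\<^sup>2) * d)"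
      by (simp add: algebra_simps)
    ultimately show ?thesis by (simp only:)
  qed
  moreover have "- (real (Suc j) * (real (Suc j) + 1)) * legendre (Suc j) s
      = - ((n + 1) * (n + 2)) * (s * p - (1 - s\<^sup>2) * d / (n + 1))"
    by (simp add: n_def p_def d_def add.commute)
  ultimately show ?case using 1 by (simp only:)
qed

lemmas DERIV_legendre = legendre_ode[THEN conjunct1]

lemma legendre_1 [simp]: "legendre j 1 = 1"
  by (induction j) auto

lemma legendre_poly: "\<exists>p q. \<forall>s. legendre j s = poly p s \<and> legendre' j s = poly q s"
proof (induction j)
  case 0
  show ?case by (rule exI[of _ 1], rule exI[of _ 0]) simp
next
  case (Suc j)
  then obtain p q where pq: "\<forall>s. legendre j s = poly p s \<and> legendre' j s = poly q s" by blast
  define P where "P = [:0, 1:] * p - smult (1 / (real j + 1)) ([:1, 0, -1:] * q)"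
  define D where "D = smult (real j + 1) p + [:0, 1:] * q"
  have "legendre (Suc j) s = poly P s" "legendre' (Suc j) s = poly D s" for s
    using pq by (simp_all add: P_def D_def power2_eq_square algebra_simps diff_divide_distrib)
  then show ?case by blast
qed

lemma finite_legendre_zeros: "finite {s. legendre j s = 0}"
proof -
  obtain p where p: "\<forall>s. legendre j s = poly p s" using legendre_poly[of j] by blast
  have "poly p 1 = 1" using p legendre_1[of j] by metis
  then have "p \<noteq> 0" by auto
  then have "finite {s. poly p s = 0}" by (rule poly_roots_finite)
  then show ?thesis using p by simp
qed

text \<open>Rolle for \<open>(1 - s\<^sup>2)\<^bsup>j+1\<^esup> P\<^sub>j\<^sup>2\<close>, whose derivative is \<open>-2 (j + 1) (1 - s\<^sup>2)\<^sup>j P\<^sub>j P\<^sub>j\<^sub>+\<^sub>1\<close>.\<close>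

lemma card_legendre_zeros: "j \<le> card {s. -1 < s \<and> s < 1 \<and> legendre j s = 0}"
proof (induction j)
  case (Suc j)
  define S where "S = {s. -1 < s \<and> s < 1 \<and> legendre j s = 0}"
  have finS: "finite S" unfolding S_def by (rule finite_subset[OF _ finite_legendre_zeros[of j]]) auto
  have "\<exists>T. finite T \<and> card T = Suc (card S) \<and> (\<forall>t\<in>T. -1 < t \<and> t < 1 \<and> legendre (Suc j) t = 0)"
  proof (rule interlacing_card[OF finS])
    show "- 1 < s" if "s \<in> S" for s using that by (simp add: S_def)
    fix z assume z: "z \<in> insert (- 1) S"
    \<comment> \<open>A gap reaches from \<open>z\<close> to the next zero of P_j, or to 1 if there
      is none. \<open>F\<close> vanishes at the zeros of P_j and, by its first factor, at -1 and 1,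
      so Rolle applies to every gap.\<close>
    define N where "N = insert 1 {s \<in> S. z < s}"
    have finN: "finite N" using finS by (simp add: N_def)
    define b where "b = Min N"
    have bN: "b \<in> N" unfolding b_def using finN by (intro Min_in) (auto simp: N_def)
    have z1: "- 1 \<le> z" "z < 1" using z by (auto simp: S_def)
    have b1: "z < b" "b \<le> 1" using bN z1 by (auto simp: N_def S_def)
    define F where "F s = (1 - s\<^sup>2) ^ Suc j * (legendre j s)\<^sup>2" for s
    have "F z = 0" using z by (auto simp: F_def S_def)
    moreover have "F b = 0" using bN by (auto simp: F_def N_def S_def)
    moreover have dF: "(F has_real_derivative
        - 2 * (real j + 1) * (1 - s\<^sup>2) ^ j * legendre j s * legendre (Suc j) s) (at s)" for s
    proof -
      have n: "real j + 1 \<noteq> 0" by (simp add: add_nonneg_eq_0_iff)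
      have "((\<lambda>s. (1 - s\<^sup>2) ^ Suc j) has_real_derivative (real j + 1) * (- 2 * s) * (1 - s\<^sup>2) ^ j) (at s)"
        by (auto intro!: derivative_eq_intros simp del: power_Suc)
      moreover have "((\<lambda>s. (legendre j s)\<^sup>2) has_real_derivative 2 * legendre j s * legendre' j s) (at s)"
        unfolding power2_eq_square using DERIV_mult[OF DERIV_legendre[of j s] DERIV_legendre[of j s]] by (simp add: mult.assoc)
      ultimately have "(F has_real_derivative ((real j + 1) * (- 2 * s) * (1 - s\<^sup>2) ^ j) * (legendre j s)\<^sup>2
          + (2 * legendre j s * legendre' j s) * (1 - s\<^sup>2) ^ Suc j) (at s)"
        unfolding F_def[abs_def] by (rule DERIV_mult)
      moreover have "(m * (- 2 * s) * u) * p\<^sup>2 + (2 * p * d) * (v * u) = - 2 * m * u * p * (s * p - v * d / m)"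
        if "m \<noteq> 0" for m u v p d :: real
        using that by (simp add: field_simps power2_eq_square)
      from this[OF n, of "(1 - s\<^sup>2) ^ j" "legendre j s" "legendre' j s" "1 - s\<^sup>2"]
      have "((real j + 1) * (- 2 * s) * (1 - s\<^sup>2) ^ j) * (legendre j s)\<^sup>2
          + (2 * legendre j s * legendre' j s) * (1 - s\<^sup>2) ^ Suc j
          = - 2 * (real j + 1) * (1 - s\<^sup>2) ^ j * legendre j s * legendre (Suc j) s"
        by simp
      ultimately show ?thesis by (simp only:)
    qed
    moreover have "continuous_on {z..b} F"
      using dF DERIV_isCont continuous_at_imp_continuous_on by blast
    ultimately obtain t where t: "z < t" "t < b" "(F has_real_derivative 0) (at t)"
      using Rolle[of z b F] b1 by (metis real_differentiable_def)
    have t1: "- 1 < t" "t < 1" using t z1 b1 by simp_all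
    have "legendre j t \<noteq> 0"
    proof
      assume "legendre j t = 0"
      then have "t \<in> N" using t t1 by (simp add: N_def S_def)
      then have "b \<le> t" unfolding b_def using finN by (rule Min_le[rotated])
      then show False using t by simp
    qed
    moreover have "1 - t\<^sup>2 \<noteq> 0" using t1 by (auto simp: power2_eq_1_iff)
    moreover have "- 2 * (real j + 1) * (1 - t\<^sup>2) ^ j * legendre j t * legendre (Suc j) t = 0"
      using DERIV_unique[OF dF[of t] t(3)] .
    moreover have "real j + 1 \<noteq> 0" by (simp add: add_nonneg_eq_0_iff)
    ultimately have "legendre (Suc j) t = 0" by (simp only: mult_eq_0_iff power_eq_0_iff) simp
    moreover have "t < s" if "s \<in> S" "z < s" for s
    proof -
      have "b \<le> s" unfolding b_def using finN that by (intro Min_le) (auto simp: N_def)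
      then show ?thesis using t by simp
    qed
    ultimately show "\<exists>t>z. (- 1 < t \<and> t < 1 \<and> legendre (Suc j) t = 0) \<and> (\<forall>s\<in>S. z < s \<longrightarrow> t < s)"
      using t t1 by blast
  qed
  then obtain T where T: "card T = Suc (card S)" "T \<subseteq> {s. -1 < s \<and> s < 1 \<and> legendre (Suc j) s = 0}" by blast
  have "finite {s. -1 < s \<and> s < 1 \<and> legendre (Suc j) s = 0}"
    by (rule finite_subset[OF _ finite_legendre_zeros[of "Suc j"]]) auto
  then have "card T \<le> card {s. -1 < s \<and> s < 1 \<and> legendre (Suc j) s = 0}" using T(2) by (rule card_mono)
  then show ?case using Suc T(1) by (simp add: S_def)
qed simp

text \<open>The point of \<open>A\<close> nearest to 0 on the segment from 0 to \<open>a0\<close>: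
  points slightly closer to 0 lie outside A. It is nonzero and has the sign of
  \<open>a0\<close>.\<close>

lemma boundary_point_towards_0:
  fixes A :: "real set"
  assumes "closed A" "a0 \<in> A" "0 \<notin> A"
  shows "\<exists>a\<in>A. 0 < a * a0 \<and> \<not> (\<forall>\<^sub>F b in nhds a. b \<in> A)"
proof -
  define T where "T = {0..1} \<inter> (\<lambda>t. t * a0) -` A"
  have "compact T" unfolding T_def
    by (intro compact_Int_closed compact_Icc closed_vimage assms(1) continuous_intros)
  moreover have "1 \<in> T" using assms(2) by (simp add: T_def)
  ultimately obtain t where t: "t \<in> T" "\<forall>s\<in>T. t \<le> s" using compact_attains_inf[of T] by blast
  have "t \<noteq> 0" using t(1) assms(3) by (auto simp: T_def)
  then have t01: "0 < t" "t \<le> 1" "t * a0 \<in> A" using t(1) by (auto simp: T_def)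
  have "a0 \<noteq> 0" using assms by auto
  then have "0 < t * a0 * a0" using t01(1) by (auto simp: mult.assoc zero_less_mult_iff)
  moreover have "\<not> (\<forall>\<^sub>F b in nhds (t * a0). b \<in> A)"
  proof
    assume ev: "\<forall>\<^sub>F b in nhds (t * a0). b \<in> A"
    have "((\<lambda>s. s * a0) \<longlongrightarrow> t * a0) (at_left t)" by (intro tendsto_intros)
    from eventually_compose_filterlim[OF ev this]
    obtain c where c: "c < t" "\<And>s. c < s \<Longrightarrow> s < t \<Longrightarrow> s * a0 \<in> A"
      unfolding eventually_at_left_field by blast
    obtain s where "max c 0 < s" "s < t" using dense[of "max c 0" t] c(1) t01 by auto
    then have "s \<in> T" using c(2)[of s] t01 by (simp add: T_def)
    then show False using t(2) \<open>s < t\<close> by force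
  qed
  ultimately show ?thesis using t01(3) by blast
qed

section \<open>Counting the parameters of regular solutions\<close>

context shooting
begin

text \<open>At \<open>a = 0\<close> the potential is \<open>\<mu>\<close> / (1 + x)^2 since
  \<open>expquot 0 = 1\<close>. The transplanted P_k satisfies the same equation with k(k+1) for
  \<open>\<mu>\<close> and has at least k zeros on the half-line, so \<open>Y 0\<close> has at least
  k + 1.\<close>

lemma zero_notin_atmost:
  assumes k: "real k * (real k + 1) < \<mu>"
  shows "0 \<notin> atmost k"
proof
  assume 0: "0 \<in> atmost k"
  \<comment> \<open>The map x -> (1 - x)/(1 + x), which takes the half-line to (-1, 1] and is its
    own inverse. With x = |.|^2 it is the height coordinate of stereographic projection.\<close>
  define \<sigma> where "\<sigma> x = 2 / (1 + x) - 1" for x :: real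
  define g where "g x = legendre k (\<sigma> x)" for x
  define g' where "g' x = legendre' k (\<sigma> x) * - (2 / (1 + x)\<^sup>2)" for x
  have d\<sigma>: "(\<sigma> has_real_derivative - (2 / (1 + x)\<^sup>2)) (at x)" if "0 \<le> x" for x
  proof -
    have "-1 < x" using that by simp
    from DERIV_diff[OF DERIV_cmult[OF DERIV_reciprocal_plus1[OF this], of 2] DERIV_const[of 1]]
    show ?thesis by (simp add: \<sigma>_def[abs_def])
  qed
  have \<sigma>_range: "-1 < \<sigma> x" "\<sigma> x \<le> 1" if "0 \<le> x" for x
    using that by (simp_all add: \<sigma>_def pos_divide_le_eq)
  have sq: "1 - (\<sigma> x)\<^sup>2 = 4 * x / (1 + x)\<^sup>2" if "-1 < x" for x
  proof -
    define y where "y = 1 + x"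
    have y: "y \<noteq> 0" using that by (simp add: y_def)
    have "1 - (2 / y - 1)\<^sup>2 = (2 * 2 / y - 2\<^sup>2 / y\<^sup>2)" by (simp add: power2_diff power_divide)
    also have "\<dots> = 4 * (y - 1) / y\<^sup>2" using y by (simp add: power2_eq_square diff_divide_distrib)
    finally show ?thesis unfolding y_def by (simp add: \<sigma>_def)
  qed
  define h where "h s = (1 - s\<^sup>2) * legendre' k s" for s
  have xg': "- (1 / 2) * h (\<sigma> x) = x * g' x" if "-1 < x" for x
    using sq[OF that] by (simp add: g'_def h_def)
  interpret sturm \<mu> "real k * (real k + 1)" "Y 0" "V 0" g g'
  proof
    fix x :: real assume x: "0 \<le> x"
    show "(Y 0 has_real_derivative V 0 x) (at x)" using deriv_Y[OF x] .
    show "((\<lambda>x. x * V 0 x) has_real_derivative - (\<mu> / (1 + x)\<^sup>2) * Y 0 x) (at x)"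
      using deriv_Q[OF x, of 0] by simp
    show "(g has_real_derivative g' x) (at x)"
      unfolding g_def g'_def by (rule DERIV_chain2[OF DERIV_legendre d\<sigma>[OF x]])
    have dh: "(h has_real_derivative - (real k * (real k + 1)) * legendre k s) (at s)" for s
      unfolding h_def using legendre_ode by blast
    have "((\<lambda>x. - (1 / 2) * h (\<sigma> x)) has_real_derivative
        - (1 / 2) * (- (real k * (real k + 1)) * legendre k (\<sigma> x) * - (2 / (1 + x)\<^sup>2))) (at x)"
      by (rule DERIV_cmult[OF DERIV_chain2[OF dh d\<sigma>[OF x]]])
    moreover have "- (1 / 2) * (- (real k * (real k + 1)) * legendre k (\<sigma> x) * - (2 / (1 + x)\<^sup>2))
        = - (real k * (real k + 1) / (1 + x)\<^sup>2) * g x"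
      by (simp add: g_def)
    ultimately have "((\<lambda>x. - (1 / 2) * h (\<sigma> x)) has_real_derivative
        - (real k * (real k + 1) / (1 + x)\<^sup>2) * g x) (at x)" by (simp only:)
    then show "((\<lambda>x. x * g' x) has_real_derivative - (real k * (real k + 1) / (1 + x)\<^sup>2) * g x) (at x)"
      by (rule has_field_derivative_transform_within_open[of _ _ _ "{-1<..}"]) (use x xg' in auto)
  qed (rule k)
  define S where "S = {x. 0 < x \<and> g x = 0}"
  define Z where "Z = {s. -1 < s \<and> s < 1 \<and> legendre k s = 0}"
  have inv: "\<sigma> (\<sigma> s) = s" if "-1 < s" for s
    using that by (simp add: \<sigma>_def add_divide_distrib)
  have finZ: "finite Z" unfolding Z_def by (rule finite_subset[OF _ finite_legendre_zeros[of k]]) auto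
  have SZ: "S = \<sigma> ` Z"
  proof (intro equalityI subsetI)
    fix x assume "x \<in> S"
    then have x: "0 < x" "legendre k (\<sigma> x) = 0" by (simp_all add: S_def g_def)
    moreover have "\<sigma> x < 1" using x by (simp add: \<sigma>_def pos_divide_less_eq)
    ultimately have "\<sigma> x \<in> Z" using \<sigma>_range[of x] by (simp add: Z_def)
    moreover have "\<sigma> (\<sigma> x) = x" using inv[of x] x(1) by linarith
    ultimately show "x \<in> \<sigma> ` Z" by (metis imageI)
  next
    fix x assume "x \<in> \<sigma> ` Z"
    then obtain s where s: "x = \<sigma> s" "-1 < s" "s < 1" "legendre k s = 0" by (auto simp: Z_def)
    have "1 < 2 / (1 + s)" using s(2,3) by (subst pos_less_divide_eq) simp_all
    then have "0 < x" unfolding s(1) \<sigma>_def by linarith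
    moreover have "\<sigma> x = s" unfolding s(1) by (rule inv[OF s(2)])
    ultimately show "x \<in> S" using s(4) unfolding S_def g_def by blast
  qed
  have "inj_on \<sigma> Z"
  proof (rule inj_on_inverseI)
    show "\<sigma> (\<sigma> s) = s" if "s \<in> Z" for s using that by (intro inv) (simp add: Z_def)
  qed
  then have cardS: "k \<le> card S" using card_legendre_zeros[of k] by (simp add: SZ card_image flip: Z_def)
  have finS: "finite S" using finZ by (simp add: SZ)
  have "continuous_on {-1..1} (legendre k)"
    using DERIV_legendre DERIV_isCont continuous_at_imp_continuous_on by blast
  then have "bounded (legendre k ` {-1..1})"
    by (intro compact_imp_bounded compact_continuous_image compact_Icc)
  then obtain M where M: "\<forall>s\<in>{-1..1}. \<bar>legendre k s\<bar> \<le> M"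
    by (auto simp: bounded_real)
  have gM: "\<bar>g x\<bar> \<le> M" if "0 \<le> x" for x
    using M \<sigma>_range[OF that] by (simp add: g_def)
  have "\<exists>T. finite T \<and> card T = Suc (card S) \<and> (\<forall>t\<in>T. 0 \<le> t \<and> Y 0 t = 0)"
  proof (rule interlacing_card[OF finS])
    show "0 < s" if "s \<in> S" for s using that by (simp add: S_def)
    fix z assume z: "z \<in> insert 0 S"
    then have "0 \<le> z" by (auto simp: S_def)
    moreover obtain t where "z < t" "Y 0 t = 0" "\<forall>s\<in>S. z < s \<longrightarrow> t < s"
      using zero_before_next[OF S_def finS gM z] by blast
    ultimately show "\<exists>t>z. (0 \<le> t \<and> Y 0 t = 0) \<and> (\<forall>s\<in>S. z < s \<longrightarrow> t < s)"
      by (intro exI[of _ t]) simp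
  qed
  then obtain T where T: "card T = Suc (card S)" "T \<subseteq> zeros 0" by (auto simp: zeros_def)
  then have "card T \<le> card (zeros 0)" using 0 by (intro card_mono) (simp_all add: atmost_def)
  then show False using 0 T cardS by (simp add: atmost_def)
qed

text \<open>Zeros are lost only at infinity, one at a time, and only at regular solutions.\<close>

lemma boundary_regular:
  assumes a: "a \<in> atmost m" "a \<noteq> 0" "0 < m" and bd: "\<not> (\<forall>\<^sub>F b in nhds a. b \<in> atmost m)"
  shows "(R a \<longlongrightarrow> 0) at_top" "a \<notin> atmost (m - 1)"
proof -
  show "(R a \<longlongrightarrow> 0) at_top" using eventually_atmost_same[OF a(1,2)] bd by blast
  show "a \<notin> atmost (m - 1)" using eventually_atmost_Suc[of a "m - 1"] a bd by auto
qed

text \<open>The boundary point found between \<open>a0\<close> and 0 has exactly \<open>m\<close>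
  zeros, and its sign is that of \<open>a0\<close>.\<close>

lemma exists_regular:
  assumes "a0 \<in> atmost m" "0 \<notin> atmost m" "0 < m"
  shows "\<exists>a. 0 < a * a0 \<and> a \<in> atmost m \<and> a \<notin> atmost (m - 1) \<and> (R a \<longlongrightarrow> 0) at_top"
proof -
  obtain a where a: "a \<in> atmost m" "0 < a * a0" "\<not> (\<forall>\<^sub>F b in nhds a. b \<in> atmost m)"
    using boundary_point_towards_0[OF closed_atmost assms(1,2)] by blast
  have "a \<noteq> 0" using a(2) by auto
  then show ?thesis using boundary_regular[OF a(1) _ assms(3) a(3)] a by blast
qed

text \<open>The angle ends between \<open>level 3\<close> = -7 pi/2 and \<open>level 2\<close> = -5
  pi/2, where the cosine is negative. For \<open>a < 0\<close> this makes W positive at infinity, as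
  \<open>reflect\<close> requires.\<close>

lemma sign_after_three_zeros:
  assumes "a \<in> atmost 3" "a \<notin> atmost 2"
  shows "\<exists>X>0. \<forall>x\<ge>X. Y a x < 0"
proof -
  obtain X where X: "0 \<le> X" "ang a X < level 2" using assms(2) by (auto simp: atmost_iff not_le)
  have "Y a x < 0" if x: "X + 1 \<le> x" for x
  proof -
    have x0: "0 \<le> x" using x X by simp
    have "level 3 \<le> ang a (x + 1)" using assms(1) x0 by (simp add: atmost_iff)
    also have "\<dots> < ang a x" using x0 by (intro ang_strict_decreasing) auto
    finally have 1: "level 3 < ang a x" .
    have "ang a x < ang a X" using x X by (intro ang_strict_decreasing) auto
    then have 2: "ang a x < level 2" using X by simp
    have "0 < cos (ang a x + 3 * pi)"
      using 1 2 by (intro cos_gt_zero_pi) (simp_all add: level_def)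
    moreover have "cos (ang a x + 3 * pi) = - cos (ang a x)"
    proof -
      have "cos (ang a x + 3 * pi) = cos ((ang a x + pi) + 2 * pi)" by (rule arg_cong) simp
      then show ?thesis by (simp only: cos_periodic cos_periodic_pi)
    qed
    ultimately have "cos (ang a x) < 0" by simp
    then show ?thesis
      using polar[OF x0, of a] real_sqrt_gt_zero[OF Y_Q_nonzero[OF x0, of a]] by (metis mult_pos_neg)
  qed
  then show ?thesis using X by (intro exI[of _ "X + 1"]) simp
qed

text \<open>Parameters of equal sign are told apart by their numbers of zeros. There are k-1
  negative ones, for m = 2, ..., k, and k-2 positive ones, for m = 3, ..., k; for k = 2 the positive
  family is empty.\<close>

theorem card_regular:
  assumes k: "2 \<le> k" and mu: "real k * (real k + 1) < \<mu>"
  shows "\<exists>A. finite A \<and> 2 * k - 3 \<le> card A \<and> (\<forall>a\<in>A. a \<noteq> 0 \<and> (R a \<longlongrightarrow> 0) at_top)"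
proof -
  have zero: "0 \<notin> atmost m" if "m \<le> k" for m
    using zero_notin_atmost[OF mu] atmost_mono[OF that] by blast
  obtain a0 where a0: "a0 < 0" "a0 \<in> atmost 2" using exists_negative_atmost_2 by blast
  define reg where "reg m a \<longleftrightarrow> a \<in> atmost m \<and> a \<notin> atmost (m - 1) \<and> (R a \<longlongrightarrow> 0) at_top" for m a
  have ex_neg: "\<exists>a. a < 0 \<and> reg m a" if m: "2 \<le> m" "m \<le> k" for m
  proof -
    have "a0 \<in> atmost m" using a0(2) atmost_mono[OF m(1)] by blast
    then show ?thesis
      using exists_regular[OF _ zero[OF m(2)], of a0] m a0(1) unfolding reg_def by (auto simp: zero_less_mult_iff)
  qed
  define f where "f m = (SOME a. a < 0 \<and> reg m a)" for m
  have f: "f m < 0" "reg m (f m)" if "2 \<le> m" "m \<le> k" for m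
    using someI_ex[OF ex_neg[OF that]] by (simp_all add: f_def)
  have ex_pos: "\<exists>a. 0 < a \<and> reg m a" if m: "3 \<le> m" "m \<le> k" for m
  proof -
    \<comment> \<open>The inverse of the negative three-zero solution starts at some b > 0 and has
      at most three zeros, so it is a seed in \<open>atmost m\<close> for every m >= 3.\<close>
    have "f 3 < 0" "reg 3 (f 3)" using f[of 3] m by simp_all
    then have f3: "f 3 < 0" "f 3 \<in> atmost 3" "f 3 \<notin> atmost 2" "(R (f 3) \<longlongrightarrow> 0) at_top"
      by (simp_all add: reg_def)
    obtain X where X: "0 < X" "\<forall>x\<ge>X. Y (f 3) x < 0" using sign_after_three_zeros[OF f3(2,3)] by blast
    have "0 < W (f 3) x" if "X \<le> x" for x
      using X(2) that f3(1) by (simp add: W_def mult_neg_neg)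
    then obtain b where b: "0 < b" "b \<in> atmost 3"
      using reflect[OF f3(2) less_imp_neq[OF f3(1)] f3(4) X(1)] by blast
    then have "b \<in> atmost m" using atmost_mono[OF m(1)] by blast
    then show ?thesis
      using exists_regular[OF _ zero[OF m(2)], of b] m b(1) unfolding reg_def by (auto simp: zero_less_mult_iff)
  qed
  define g where "g m = (SOME a. 0 < a \<and> reg m a)" for m
  have g: "0 < g m" "reg m (g m)" if "3 \<le> m" "m \<le> k" for m
    using someI_ex[OF ex_pos[OF that]] by (simp_all add: g_def)
  have distinct: "a \<noteq> b" if "m < n" "reg m a" "reg n b" for a b m n
  proof -
    have "m \<le> n - 1" using that(1) by simp
    then have "a \<in> atmost (n - 1)" using atmost_mono that(2) unfolding reg_def by blast
    then show ?thesis using that(3) unfolding reg_def by blast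
  qed
  have "inj_on f {2..k}"
  proof (rule linorder_inj_onI')
    fix m n assume "m \<in> {2..k}" "n \<in> {2..k}" "m < n"
    then show "f m \<noteq> f n" using distinct f(2) by simp
  qed
  then have cf: "card (f ` {2..k}) = k - 1" using k by (simp add: card_image)
  have "inj_on g {3..k}"
  proof (rule linorder_inj_onI')
    fix m n assume "m \<in> {3..k}" "n \<in> {3..k}" "m < n"
    then show "g m \<noteq> g n" using distinct g(2) by simp
  qed
  then have cg: "card (g ` {3..k}) = k - 2" by (simp add: card_image)
  have "f ` {2..k} \<inter> g ` {3..k} = {}"
  proof -
    have "x < 0" if "x \<in> f ` {2..k}" for x using that f(1) by auto
    moreover have "0 < x" if "x \<in> g ` {3..k}" for x using that g(1) by auto
    ultimately show ?thesis by fastforce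
  qed
  then have "card (f ` {2..k} \<union> g ` {3..k}) = 2 * k - 3"
    using cf cg k by (simp add: card_Un_disjoint)
  moreover have "a \<noteq> 0 \<and> (R a \<longlongrightarrow> 0) at_top" if a: "a \<in> f ` {2..k} \<union> g ` {3..k}" for a
  proof -
    consider m where "a = f m" "2 \<le> m" "m \<le> k" | m where "a = g m" "3 \<le> m" "m \<le> k"
      using a by auto
    then show ?thesis
    proof cases
      case (1 m)
      then show ?thesis using f[of m] unfolding reg_def by simp
    next
      case (2 m)
      then show ?thesis using g[of m] unfolding reg_def by simp
    qed
  qed
  ultimately show ?thesis by (intro exI[of _ "f ` {2..k} \<union> g ` {3..k}"]) simp
qed

end

section \<open>From radial profiles to solutions in the plane\<close>

text \<open>Profiles are functions of t = |x|^2 rather than of |x|: the inner map is then a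
  polynomial, and no separate condition arises at the origin. Derivatives within [0, oo) suffice
  because t is nonnegative.\<close>

context
  fixes v v1 v2 :: "real \<Rightarrow> real"
  assumes dv: "\<And>t. 0 \<le> t \<Longrightarrow> (v has_real_derivative v1 t) (at t within {0..})"
    and dv1: "\<And>t. 0 \<le> t \<Longrightarrow> (v1 has_real_derivative v2 t) (at t within {0..})"
    and cv2: "continuous_on {0..} v2"
begin

lemma has_derivative_radial:
  fixes x :: "'a::euclidean_space"
  assumes "\<And>t. 0 \<le> t \<Longrightarrow> (f has_real_derivative f' t) (at t within {0..})"
  shows "((\<lambda>x. f (x \<bullet> x)) has_derivative (\<lambda>h. f' (x \<bullet> x) * (2 * (x \<bullet> h)))) (at x)"
proof -
  have "((\<lambda>x. x \<bullet> x) has_derivative (\<lambda>h. 2 * (x \<bullet> h))) (at x)"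
    by (auto intro!: derivative_eq_intros simp: inner_commute)
  moreover have "(f has_derivative (*) (f' (x \<bullet> x))) (at (x \<bullet> x) within range (\<lambda>x::'a. x \<bullet> x))"
    using assms[of "x \<bullet> x"] unfolding has_field_derivative_def
    by (rule has_derivative_subset) auto
  ultimately show ?thesis by (rule has_derivative_in_compose[where s = UNIV])
qed

lemma continuous_on_radial:
  assumes "continuous_on {0..} f"
  shows "continuous_on UNIV (\<lambda>x::'a::euclidean_space. f (x \<bullet> x))"
  by (rule continuous_on_compose2[OF assms]) (auto intro!: continuous_intros)

lemma partial_deriv_radial:
  "partial_deriv b (\<lambda>x::'a::euclidean_space. v (x \<bullet> x)) = (\<lambda>x. 2 * (x \<bullet> b) * v1 (x \<bullet> x))"
proof -
  have "frechet_derivative (\<lambda>x::'a. v (x \<bullet> x)) (at x) = (\<lambda>h. v1 (x \<bullet> x) * (2 * (x \<bullet> h)))" for x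
    by (rule frechet_derivative_at[OF has_derivative_radial[OF dv], symmetric])
  then show ?thesis by (simp add: partial_deriv_def fun_eq_iff mult_ac)
qed

lemma has_derivative_partial_radial:
  "((\<lambda>x::'a::euclidean_space. 2 * (x \<bullet> b) * v1 (x \<bullet> x)) has_derivative
    (\<lambda>h. 2 * (x \<bullet> b) * (v2 (x \<bullet> x) * (2 * (x \<bullet> h))) + 2 * (h \<bullet> b) * v1 (x \<bullet> x))) (at x)"
proof -
  have "((\<lambda>x. 2 * (x \<bullet> b)) has_derivative (\<lambda>h. 2 * (h \<bullet> b))) (at x)"
    by (auto intro!: derivative_eq_intros)
  from has_derivative_mult[OF this has_derivative_radial[OF dv1]] show ?thesis .
qed

lemma partial_deriv2_radial:
  "partial_deriv c (\<lambda>x::'a::euclidean_space. 2 * (x \<bullet> b) * v1 (x \<bullet> x)) =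
    (\<lambda>x. 2 * (x \<bullet> b) * (v2 (x \<bullet> x) * (2 * (x \<bullet> c))) + 2 * (c \<bullet> b) * v1 (x \<bullet> x))"
proof -
  have "frechet_derivative (\<lambda>x::'a. 2 * (x \<bullet> b) * v1 (x \<bullet> x)) (at x) =
      (\<lambda>h. 2 * (x \<bullet> b) * (v2 (x \<bullet> x) * (2 * (x \<bullet> h))) + 2 * (h \<bullet> b) * v1 (x \<bullet> x))" for x
    by (rule frechet_derivative_at[OF has_derivative_partial_radial, symmetric])
  then show ?thesis by (simp add: partial_deriv_def fun_eq_iff)
qed

lemma continuous_v1: "continuous_on {0..} v1"
  using dv1 by (intro DERIV_continuous_on) auto

lemma C2_radial: "C2_fun (\<lambda>x::'a::euclidean_space. v (x \<bullet> x))"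
proof -
  have "C1_fun (\<lambda>x::'a. v (x \<bullet> x))"
    unfolding C1_fun_def partial_deriv_radial
    using has_derivative_radial[OF dv]
    by (auto intro!: continuous_intros continuous_on_radial continuous_v1 simp: differentiable_def)
  moreover have "C1_fun (\<lambda>x::'a. 2 * (x \<bullet> b) * v1 (x \<bullet> x))" for b
    unfolding C1_fun_def partial_deriv2_radial
    using has_derivative_partial_radial[of b]
    by (auto intro!: continuous_intros continuous_on_radial continuous_v1 cv2 simp: differentiable_def)
  ultimately show ?thesis unfolding C2_fun_def partial_deriv_radial by blast
qed

text \<open>In the plane the right side is 4 (t v')' at t = |x|^2, which is the source of the radial
  equation in t.\<close>

lemma laplacian_radial:
  "laplacian (\<lambda>x::'a::euclidean_space. v (x \<bullet> x)) x
     = 2 * real DIM('a) * v1 (x \<bullet> x) + 4 * (x \<bullet> x) * v2 (x \<bullet> x)"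
proof -
  have "laplacian (\<lambda>x::'a. v (x \<bullet> x)) x
      = (\<Sum>b\<in>Basis. 4 * v2 (x \<bullet> x) * ((x \<bullet> b) * (x \<bullet> b)) + 2 * v1 (x \<bullet> x))"
    unfolding laplacian_def partial_deriv_radial partial_deriv2_radial
    by (intro sum.cong refl) (simp add: inner_same_Basis mult_ac)
  also have "\<dots> = 4 * v2 (x \<bullet> x) * (\<Sum>b\<in>Basis. (x \<bullet> b) * (x \<bullet> b)) + real DIM('a) * (2 * v1 (x \<bullet> x))"
    by (simp add: sum.distrib sum_distrib_left)
  also have "(\<Sum>b\<in>Basis. (x \<bullet> b) * (x \<bullet> b)) = x \<bullet> x" by (rule euclidean_inner[symmetric])
  finally show ?thesis by (simp add: mult_ac)
qed

end

text \<open>Polar coordinates in the variable t: the disc where |x|^2 <= a has area pi a, so the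
  image measure of |x|^2 is pi dt on the half-line. It is enough to compare on the sets
  \<open>{..a}\<close>.\<close>

lemma distr_inner_self_plane:
  "distr lborel borel (\<lambda>x::real^2. x \<bullet> x) = density lborel (\<lambda>t. ennreal pi * indicator {0..} t)"
proof (rule measure_eqI_generator_eq[where E = "range atMost" and \<Omega> = UNIV and A = "\<lambda>i. {..real i}"])
  have S: "sets (borel :: real measure) = sigma_sets UNIV (range atMost)"
    by (subst borel_eq_atMost) (simp add: sets_measure_of)
  have E: "emeasure (distr lborel borel (\<lambda>x::real^2. x \<bullet> x)) {..a} = ennreal (pi * max a 0)" for a :: real
  proof -
    have "emeasure (distr lborel borel (\<lambda>x::real^2. x \<bullet> x)) {..a} = emeasure lborel {x::real^2. x \<bullet> x \<le> a}"
      by (subst emeasure_distr) (auto intro!: arg_cong[where f = "emeasure lborel"] borel_measurable_continuous_onI continuous_intros)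
    also have "\<dots> = ennreal (pi * max a 0)"
    proof (cases "0 \<le> a")
      case True
      have "{x::real^2. x \<bullet> x \<le> a} = cball 0 (sqrt a)"
        using True by (auto simp: norm_eq_sqrt_inner)
      then show ?thesis
        using emeasure_cball[of "sqrt a" "0 :: real^2"] True by (simp add: unit_ball_vol_2)
    next
      case False
      then have "{x::real^2. x \<bullet> x \<le> a} = {}" using inner_ge_zero by (auto simp: not_le intro: less_le_trans)
      then show ?thesis using False by simp
    qed
    finally show ?thesis .
  qed
  have F: "emeasure (density lborel (\<lambda>t. ennreal pi * indicator {0..} t)) {..a} = ennreal (pi * max a 0)" for a :: real
  proof -
    have "emeasure (density lborel (\<lambda>t. ennreal pi * indicator {0..} t)) {..a}
        = (\<integral>\<^sup>+t. ennreal pi * indicator {0..a} t \<partial>lborel)"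
      by (subst emeasure_density) (auto intro!: nn_integral_cong simp: indicator_def)
    also have "\<dots> = ennreal pi * emeasure lborel {0..a}"
      by (subst nn_integral_cmult) auto
    also have "\<dots> = ennreal (pi * max a 0)"
      by (cases "0 \<le> a") (auto simp: ennreal_mult)
    finally show ?thesis .
  qed
  show "emeasure (distr lborel borel (\<lambda>x::real^2. x \<bullet> x)) X
      = emeasure (density lborel (\<lambda>t. ennreal pi * indicator {0..} t)) X" if "X \<in> range atMost" for X
    using that E F by auto
  show "emeasure (distr lborel borel (\<lambda>x::real^2. x \<bullet> x)) {..real i} \<noteq> \<infinity>" for i by (simp add: E)
  show "sets (distr lborel borel (\<lambda>x::real^2. x \<bullet> x)) = sigma_sets UNIV (range atMost)"
    unfolding sets_distr by (rule S)
  show "sets (density lborel (\<lambda>t. ennreal pi * indicator {0..} t)) = sigma_sets UNIV (range (atMost :: real \<Rightarrow> _))"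
    unfolding sets_density sets_lborel by (rule S)
  show "Int_stable (range (atMost :: real \<Rightarrow> real set))"
    by (auto simp: Int_stable_def)
  show "(\<Union>i. {..real i}) = UNIV" by (auto intro: real_arch_simple)
qed auto

lemma has_bochner_integral_radial_plane:
  fixes F f :: "real \<Rightarrow> real"
  assumes [measurable]: "f \<in> borel_measurable borel"
    and deriv: "\<And>t. 0 \<le> t \<Longrightarrow> (F has_real_derivative f t) (at t)"
    and nonneg: "\<And>t. 0 \<le> t \<Longrightarrow> 0 \<le> f t"
    and lim: "(F \<longlongrightarrow> T) at_top"
  shows "has_bochner_integral lborel (\<lambda>x::real^2. f (x \<bullet> x)) (pi * (T - F 0))"
proof (rule has_bochner_integral_nn_integral)
  have [measurable]: "(\<lambda>x::real^2. x \<bullet> x) \<in> borel_measurable borel"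
    by (intro borel_measurable_continuous_onI continuous_intros)
  show "(\<lambda>x::real^2. f (x \<bullet> x)) \<in> borel_measurable lborel" by measurable
  show "AE x in lborel. 0 \<le> f ((x::real^2) \<bullet> x)" using nonneg by simp
  have "F 0 \<le> T"
  proof (rule tendsto_lowerbound[OF lim])
    have "F 0 \<le> F y" if "0 \<le> y" for y
      by (rule DERIV_nonneg_imp_nondecreasing[OF that, of F]) (use deriv nonneg in auto)
    then show "\<forall>\<^sub>F y in at_top. F 0 \<le> F y" by (auto simp: eventually_at_top_linorder)
  qed simp
  then show "0 \<le> pi * (T - F 0)" by simp
  have "(\<integral>\<^sup>+x. ennreal (f ((x::real^2) \<bullet> x)) \<partial>lborel) = (\<integral>\<^sup>+t. ennreal (f t) \<partial>distr lborel borel (\<lambda>x::real^2. x \<bullet> x))"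
    by (subst nn_integral_distr) auto
  also have "\<dots> = (\<integral>\<^sup>+t. (ennreal pi * indicator {0..} t) * ennreal (f t) \<partial>lborel)"
    unfolding distr_inner_self_plane by (subst nn_integral_density) auto
  also have "\<dots> = (\<integral>\<^sup>+t. ennreal pi * (ennreal (f t) * indicator {0..} t) \<partial>lborel)"
    by (simp add: mult_ac)
  also have "\<dots> = ennreal pi * (\<integral>\<^sup>+t. ennreal (f t) * indicator {0..} t \<partial>lborel)"
    by (rule nn_integral_cmult) measurable
  also have "(\<integral>\<^sup>+t. ennreal (f t) * indicator {0..} t \<partial>lborel) = ennreal (T - F 0)"
    by (rule nn_integral_FTC_atLeast[OF assms(1) deriv nonneg lim])
  finally show "(\<integral>\<^sup>+x. ennreal (f ((x::real^2) \<bullet> x)) \<partial>lborel) = ennreal (pi * (T - F 0))"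
    using \<open>F 0 \<le> T\<close> by (simp add: ennreal_mult)
qed

text \<open>Division by x at the singular point: V(x) is the mean of G over [0, x], so it may be
  differentiated under the integral. This supplies the second derivative of the profile at the
  origin.\<close>

lemma C1_of_mult_C1:
  fixes V G G' :: "real \<Rightarrow> real"
  assumes cV: "continuous_on UNIV V"
    and dQ: "\<And>x. 0 \<le> x \<Longrightarrow> ((\<lambda>x. x * V x) has_real_derivative G x) (at x)"
    and dG: "\<And>x. 0 \<le> x \<Longrightarrow> (G has_real_derivative G' x) (at x within {0..})"
    and cG': "continuous_on {0..} G'"
  shows "\<exists>V'. continuous_on {0..} V' \<and>
    (\<forall>x\<ge>0. (V has_real_derivative V' x) (at x within {0..}) \<and> V x + x * V' x = G x)"
proof -
  have cG: "continuous_on {0..} G" using dG by (intro DERIV_continuous_on) auto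
  have G0: "V 0 = G 0"
  proof -
    have "((\<lambda>h. ((0 + h) * V (0 + h) - 0 * V 0) / h) \<longlongrightarrow> G 0) (at 0)"
      using dQ[of 0] unfolding DERIV_def by simp
    then have "(V \<longlongrightarrow> G 0) (at 0)"
      by (rule tendsto_cong[THEN iffD1, rotated]) (simp add: eventually_at_filter)
    moreover have "(V \<longlongrightarrow> V 0) (at 0)" using cV by (simp add: continuous_on_def)
    ultimately show ?thesis by (intro tendsto_unique[of "at (0::real)"]) auto
  qed
  have V: "V x = integral (cbox 0 1) (\<lambda>s. G (x * s))" if x: "0 \<le> x" for x
  proof (cases "x = 0")
    case False
    have "((\<lambda>s. x * G (x * s)) has_integral ((x * 1) * V (x * 1) - (x * 0) * V (x * 0))) {0..1}"
    proof (rule fundamental_theorem_of_calculus)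
      fix s :: real assume s: "s \<in> {0..1}"
      have "0 \<le> x * s" using x s by simp
      from DERIV_chain2[where g = "\<lambda>s. x * s" and x = s and s = UNIV and Db = x, OF dQ[OF this]]
      have "((\<lambda>s. (x * s) * V (x * s)) has_real_derivative G (x * s) * x) (at s)"
        by (auto intro!: derivative_eq_intros)
      then show "((\<lambda>s. (x * s) * V (x * s)) has_vector_derivative x * G (x * s)) (at s within {0..1})"
        by (simp add: has_real_derivative_iff_has_vector_derivative[symmetric] mult.commute
            has_field_derivative_at_within)
    qed simp
    from integral_unique[OF this] False show ?thesis by simp
  qed (simp add: G0)
  define V' where "V' x = integral (cbox 0 1) (\<lambda>s. s * G' (x * s))" for x :: real
  have cont: "continuous_on ({0..} \<times> cbox 0 1) (\<lambda>(x, s). s * G' (x * s))"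
    unfolding split_beta
    by (intro continuous_intros continuous_on_compose2[OF cG']) auto
  have dV: "(V has_real_derivative V' x) (at x within {0..})" if x: "0 \<le> x" for x
  proof -
    have "((\<lambda>x. integral (cbox 0 1) (\<lambda>s. G (x * s))) has_field_derivative V' x) (at x within {0..})"
      unfolding V'_def
    proof (rule leibniz_rule_field_derivative[OF _ _ cont])
      fix y s :: real assume y: "y \<in> {0..}" and s: "s \<in> cbox 0 1"
      have sub: "(\<lambda>y. y * s) ` {0..} \<subseteq> {0..}" using s by auto
      have "0 \<le> y * s" using y s by simp
      from DERIV_subset[OF dG[OF this] sub]
      have "(G has_real_derivative G' (y * s)) (at (y * s) within (\<lambda>y. y * s) ` {0..})" .
      moreover have "((\<lambda>y. y * s) has_real_derivative s) (at y within {0..})"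
        by (auto intro!: derivative_eq_intros)
      ultimately have "((G \<circ> (\<lambda>y. y * s)) has_real_derivative G' (y * s) * s) (at y within {0..})"
        by (rule DERIV_image_chain)
      then show "((\<lambda>y. G (y * s)) has_real_derivative s * G' (y * s)) (at y within {0..})"
        by (simp only: o_def mult.commute[of s])
    next
      fix y :: real assume y: "y \<in> {0..}"
      show "(\<lambda>s. G (y * s)) integrable_on cbox 0 1"
        using y by (intro integrable_continuous continuous_on_compose2[OF cG] continuous_intros) auto
    qed (use x in auto)
    then show ?thesis
      by (rule has_field_derivative_transform_within[OF _ zero_less_one]) (use x V in auto)
  qed
  have "continuous_on {0..} V'"
    unfolding V'_def by (rule integral_continuous_on_param[OF cont])
  moreover have "V x + x * V' x = G x" if x: "0 \<le> x" for x
  proof (cases "x = 0")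
    case False
    have "at x within {0..} = at x" using False x by (intro at_within_interior) auto
    then have "((\<lambda>x. x * V x) has_real_derivative 1 * V x + V' x * x) (at x)"
      using DERIV_mult[OF DERIV_ident dV[OF x]] by simp
    from DERIV_unique[OF this dQ[OF x]] show ?thesis by (simp add: mult.commute)
  qed (simp add: G0)
  ultimately show ?thesis using dV by blast
qed

context shooting
begin

lemma radial_profile: "radial (\<lambda>x::real^2. u_star N x + W a ((norm x)\<^sup>2))"
proof -
  define r where "r t = 1 / 2 * ln (2 * (N + 2) / (1 + t\<^sup>2) powr (N + 2)) + W a (t\<^sup>2)" for t
  have "u_star N x + W a ((norm x)\<^sup>2) = r (norm x)" for x
    unfolding u_star_def r_def by (rule refl)
  then show ?thesis unfolding radial_def by (intro exI[of _ r] allI)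
qed

text \<open>In t the force is 2 \<open>\<mu>\<close> e^(2W) / (1 + t)^2, the powers of 1 + t from
  the weight and from \<open>u_star\<close> combining to -2. Its mass is 2 pi \<open>\<mu>\<close>
  minus 4 pi times the limit of R, so R -> 0 is just what the prescribed value needs.\<close>

lemma regular_solution:
  assumes N: "\<mu> = N + 2" and reg: "(R a \<longlongrightarrow> 0) at_top"
  shows "liouville_solution N (2 * pi * (N + 2)) (\<lambda>x. u_star N x + W a ((norm x)\<^sup>2))"
proof -
  define G where "G x = - (\<mu> / 2 / (1 + x)\<^sup>2) * (exp (2 * W a x) - 1)" for x
  define D where "D x = a * V a x" for x
  have dW: "(W a has_real_derivative D x) (at x)" if "0 \<le> x" for x
    using DERIV_cmult[OF deriv_Y[OF that, of a], of a] by (simp add: W_def[abs_def] D_def)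
  have xD: "x * D x = R a x" for x by (simp add: D_def R_def Q_def)
  have dxD: "((\<lambda>x. x * D x) has_real_derivative G x) (at x)" if "0 \<le> x" for x
    using DERIV_R[OF that, of a] unfolding xD G_def .
  define G' where "G' x = - (\<mu> / 2 / (1 + x)\<^sup>2) * (exp (2 * W a x) * (2 * D x))
    + (exp (2 * W a x) - 1) * (\<mu> * (1 / (1 + x)\<^sup>2 * (1 / (1 + x))))" for x
  have dG: "(G has_real_derivative G' x) (at x within {0..})" if x: "0 \<le> x" for x
  proof -
    have d: "((\<lambda>x. 1 / (1 + x)) has_real_derivative - (1 / (1 + x)\<^sup>2)) (at x)"
      using x by (intro DERIV_reciprocal_plus1) simp
    have "((\<lambda>x. - (\<mu> / 2 / (1 + x)\<^sup>2)) has_real_derivative \<mu> * (1 / (1 + x)\<^sup>2 * (1 / (1 + x)))) (at x)"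
      using DERIV_cmult[OF DERIV_mult[OF d d], of "- (\<mu> / 2)"] by (simp add: power2_eq_square mult.assoc)
    moreover have "((\<lambda>x. exp (2 * W a x) - 1) has_real_derivative exp (2 * W a x) * (2 * D x)) (at x)"
      by (auto intro!: derivative_eq_intros dW[OF x])
    ultimately have "((\<lambda>x. - (\<mu> / 2 / (1 + x)\<^sup>2) * (exp (2 * W a x) - 1)) has_real_derivative
        \<mu> * (1 / (1 + x)\<^sup>2 * (1 / (1 + x))) * (exp (2 * W a x) - 1)
        + exp (2 * W a x) * (2 * D x) * - (\<mu> / 2 / (1 + x)\<^sup>2)) (at x)"
      by (rule DERIV_mult)
    moreover have "\<mu> * (1 / (1 + x)\<^sup>2 * (1 / (1 + x))) * (exp (2 * W a x) - 1)
        + exp (2 * W a x) * (2 * D x) * - (\<mu> / 2 / (1 + x)\<^sup>2) = G' x"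
      unfolding G'_def by (simp only: mult.commute add.commute)
    ultimately have "(G has_real_derivative G' x) (at x)"
      unfolding G_def[abs_def] by (simp only:)
    then show ?thesis by (rule has_field_derivative_at_within)
  qed
  have cD: "continuous_on UNIV D" unfolding D_def by (intro continuous_intros)
  have cG': "continuous_on {0..} G'"
    unfolding G'_def by (intro continuous_intros continuous_on_subset[OF cD]) auto
  \<comment> \<open>\<open>D'\<close> is the second derivative of W, continuous up to t = 0.\<close>
  obtain D' where D': "continuous_on {0..} D'"
    "\<And>x. 0 \<le> x \<Longrightarrow> (D has_real_derivative D' x) (at x within {0..})"
    "\<And>x. 0 \<le> x \<Longrightarrow> D x + x * D' x = G x"
    using C1_of_mult_C1[OF cD dxD dG cG'] by blast
  define v where "v x = 1 / 2 * ln (2 * \<mu>) - \<mu> / 2 * ln (1 + x) + W a x" for x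
  define v1 where "v1 x = - (\<mu> / 2 * (1 / (1 + x))) + D x" for x
  define v2 where "v2 x = \<mu> / 2 * (1 / (1 + x)\<^sup>2) + D' x" for x
  have dv: "(v has_real_derivative v1 x) (at x within {0..})" if x: "0 \<le> x" for x
  proof -
    have "((\<lambda>x. ln (1 + x)) has_real_derivative 1 / (1 + x)) (at x)"
      using x by (auto intro!: derivative_eq_intros)
    from DERIV_add[OF DERIV_diff[OF DERIV_const[of "1 / 2 * ln (2 * \<mu>)"] DERIV_cmult[OF this, of "\<mu> / 2"]] dW[OF x]]
    have "(v has_real_derivative v1 x) (at x)" unfolding v_def v1_def by simp
    then show ?thesis by (rule has_field_derivative_at_within)
  qed
  have dv1: "(v1 has_real_derivative v2 x) (at x within {0..})" if x: "0 \<le> x" for x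
  proof -
    have "((\<lambda>x. 1 / (1 + x)) has_real_derivative - (1 / (1 + x)\<^sup>2)) (at x)"
      using x by (intro DERIV_reciprocal_plus1) simp
    then have "((\<lambda>x. 1 / (1 + x)) has_real_derivative - (1 / (1 + x)\<^sup>2)) (at x within {0..})"
      by (rule has_field_derivative_at_within)
    from DERIV_add[OF DERIV_minus[OF DERIV_cmult[OF this, of "\<mu> / 2"]] D'(2)[OF x]]
    show ?thesis unfolding v1_def v2_def by simp
  qed
  have cv2: "continuous_on {0..} v2"
    unfolding v2_def by (intro continuous_intros D') auto
  note rad = dv dv1 cv2
  define f where "f x = 2 * \<mu> / (1 + x)\<^sup>2 * exp (2 * W a x)" for x
  have u: "u_star N x + W a ((norm x)\<^sup>2) = v (x \<bullet> x)" for x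
  proof -
    have p: "0 < 1 + x \<bullet> x" by (simp add: add_pos_nonneg)
    have "ln (2 * \<mu> / (1 + x \<bullet> x) powr \<mu>) = ln (2 * \<mu>) - \<mu> * ln (1 + x \<bullet> x)"
      using mu_pos p by (simp add: ln_div ln_powr)
    then have "u_star N x = 1 / 2 * (ln (2 * \<mu>) - \<mu> * ln (1 + x \<bullet> x))"
      by (simp only: u_star_def power2_norm_eq_inner N[symmetric])
    then show ?thesis by (simp add: v_def power2_norm_eq_inner right_diff_distrib)
  qed
  have force: "(1 + x) powr N * exp (2 * v x) = f x" if x: "0 \<le> x" for x
  proof -
    have p: "0 < 1 + x" using x by simp
    have "exp (2 * v x) = exp (ln (2 * \<mu>) + - (\<mu> * ln (1 + x)) + 2 * W a x)"
      by (rule arg_cong[where f = exp]) (simp add: v_def)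
    also have "\<dots> = exp (ln (2 * \<mu>)) * exp (- (\<mu> * ln (1 + x))) * exp (2 * W a x)"
      by (simp only: exp_add)
    also have "\<dots> = 2 * \<mu> * (1 + x) powr (- \<mu>) * exp (2 * W a x)"
      using mu_pos p by (simp add: powr_def)
    finally have "(1 + x) powr N * exp (2 * v x) = 2 * \<mu> * ((1 + x) powr N * (1 + x) powr (- \<mu>)) * exp (2 * W a x)"
      by (simp add: mult_ac)
    also have "(1 + x) powr N * (1 + x) powr (- \<mu>) = (1 + x) powr (- 2)"
      using p by (simp add: N flip: powr_add)
    also have "\<dots> = 1 / (1 + x)\<^sup>2"
      using p by (simp add: powr_minus_divide)
    finally show ?thesis by (simp add: f_def)
  qed
  have lap: "- (4 * v1 x + 4 * x * v2 x) = f x" if x: "0 \<le> x" for x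
  proof -
    have p: "1 + x \<noteq> 0" using x by simp
    have "v1 x + x * v2 x = (D x + x * D' x) + \<mu> / 2 * (x * (1 / (1 + x)\<^sup>2) - 1 / (1 + x))"
      by (simp add: v1_def v2_def algebra_simps)
    also have "x * (1 / (1 + x)\<^sup>2) - 1 / (1 + x) = - (1 / (1 + x)\<^sup>2)"
    proof -
      have "1 / (1 + x) = (1 + x) / (1 + x)\<^sup>2" using p by (simp add: power2_eq_square)
      then show ?thesis by (simp add: add_divide_distrib)
    qed
    also have "(D x + x * D' x) + \<mu> / 2 * - (1 / (1 + x)\<^sup>2) = - (\<mu> / 2 / (1 + x)\<^sup>2) * exp (2 * W a x)"
      unfolding D'(3)[OF x] G_def by (simp add: algebra_simps diff_divide_distrib)
    finally have "v1 x + x * v2 x = - (\<mu> / 2 / (1 + x)\<^sup>2) * exp (2 * W a x)" .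
    moreover have "- (4 * v1 x + 4 * x * v2 x) = - 4 * (v1 x + x * v2 x)" by (simp add: algebra_simps)
    ultimately show ?thesis by (simp add: f_def)
  qed
  have pde: "- laplacian (\<lambda>x::real^2. v (x \<bullet> x)) x = f (x \<bullet> x)" for x
    using lap[of "x \<bullet> x"] laplacian_radial[OF rad, of x] by simp
  \<comment> \<open>An antiderivative of the force: the first term is the contribution of
    \<open>u_star\<close>, and - 4 R that of the perturbation.\<close>
  define F where "F x = 2 * \<mu> * (x / (1 + x)) - 4 * R a x" for x
  have dF: "(F has_real_derivative f x) (at x)" if x: "0 \<le> x" for x
  proof -
    have "((\<lambda>x. x / (1 + x)) has_real_derivative 1 / (1 + x)\<^sup>2) (at x)"
      using x by (auto intro!: derivative_eq_intros simp: power2_eq_square)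
    from DERIV_diff[OF DERIV_cmult[OF this, of "2 * \<mu>"] DERIV_cmult[OF DERIV_R[OF x, of a], of 4]]
    have "(F has_real_derivative 2 * \<mu> * (1 / (1 + x)\<^sup>2) - 4 * (- (\<mu> / 2 / (1 + x)\<^sup>2) * (exp (2 * W a x) - 1))) (at x)"
      unfolding F_def .
    moreover have "2 * \<mu> * (1 / (1 + x)\<^sup>2) - 4 * (- (\<mu> / 2 / (1 + x)\<^sup>2) * (exp (2 * W a x) - 1)) = f x"
      by (simp add: f_def algebra_simps diff_divide_distrib)
    ultimately show ?thesis by simp
  qed
  have "((\<lambda>x::real. x / (1 + x)) \<longlongrightarrow> 1) at_top"
  proof -
    have "((\<lambda>x::real. 1 - inverse (1 + x)) \<longlongrightarrow> 1 - 0) at_top"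
      by (intro tendsto_intros tendsto_inverse_0_at_top filterlim_tendsto_add_at_top[OF tendsto_const filterlim_ident])
    moreover have "\<forall>\<^sub>F x::real in at_top. 1 - inverse (1 + x) = x / (1 + x)"
      using eventually_gt_at_top[of 0] by eventually_elim (simp add: field_simps)
    ultimately show ?thesis by (simp add: tendsto_cong)
  qed
  then have "(F \<longlongrightarrow> 2 * \<mu> * 1 - 4 * 0) at_top"
    unfolding F_def by (intro tendsto_intros reg)
  then have limF: "(F \<longlongrightarrow> 2 * \<mu>) at_top" by simp
  have "f \<in> borel_measurable borel"
  proof -
    have [measurable]: "W a \<in> borel_measurable borel"
      by (intro borel_measurable_continuous_onI continuous_on_W)
    show ?thesis unfolding f_def by measurable
  qed
  moreover have "0 \<le> f x" for x using mu_pos by (simp add: f_def)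
  ultimately have "has_bochner_integral lborel (\<lambda>x::real^2. f (x \<bullet> x)) (pi * (2 * \<mu> - F 0))"
    by (intro has_bochner_integral_radial_plane dF limF)
  then have int: "has_bochner_integral lborel (\<lambda>x::real^2. f (x \<bullet> x)) (2 * pi * (N + 2))"
    by (simp add: F_def N mult_ac)
  have eq: "(\<lambda>x. u_star N x + W a ((norm x)\<^sup>2)) = (\<lambda>x. v (x \<bullet> x))" by (simp only: u)
  show ?thesis
    unfolding eq unfolding liouville_solution_def power2_norm_eq_inner
    using C2_radial[OF rad] pde int force by simp
qed

end

theorem theorem1:
  fixes k :: nat and N :: real
  assumes "k \<ge> 2" and "N > real k * (real k + 1) - 2"
  shows "\<exists>S :: (real ^ 2 \<Rightarrow> real) set.
           finite S \<and> card S \<ge> 2 * (k - 2) + 2 \<and> u_star N \<in> S \<and>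
           (\<forall>u\<in>S. radial u \<and> liouville_solution N (2 * pi * (N + 2)) u)"
proof -
  have "0 \<le> real k * (real k + 1)" by simp
  then have "0 < N + 2" using assms(2) by linarith
  then obtain Y V where "shooting (N + 2) Y V" using shooting_exists[of "N + 2"] by blast
  then interpret shooting "N + 2" Y V .
  have "real k * (real k + 1) < N + 2" using assms(2) by linarith
  then obtain A where A: "finite A" "2 * k - 3 \<le> card A" "\<forall>a\<in>A. a \<noteq> 0 \<and> (R a \<longlongrightarrow> 0) at_top"
    using card_regular[OF assms(1)] by blast
  define u where "u = (\<lambda>a (x :: real ^ 2). u_star N x + W a ((norm x)\<^sup>2))"
  have reg: "(R a \<longlongrightarrow> 0) at_top" if "a \<in> insert 0 A" for a
    using that A(3) by (auto simp: R_def[abs_def])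
  have rad: "radial (u a)" for a
    unfolding u_def by (rule radial_profile)
  have sol: "liouville_solution N (2 * pi * (N + 2)) (u a)" if "a \<in> insert 0 A" for a
    unfolding u_def by (rule regular_solution[OF refl reg[OF that]])
  have W0: "W 0 t = 0" for t by (simp add: W_def)
  have u0: "u 0 = u_star N" unfolding u_def W0 add_0_right by (rule refl)
  \<comment> \<open>The value at the origin determines the parameter, as
    \<open>W a 0 = a\<close>.\<close>
  have "inj u"
  proof (rule injI)
    fix a b assume "u a = u b"
    then have "u a 0 = u b 0" by (simp only:)
    then show "a = b" unfolding u_def by simp
  qed
  then have "card (u ` insert 0 A) = card (insert 0 A)"
    by (rule card_image[OF inj_on_subset[OF _ subset_UNIV]])
  also have "\<dots> = Suc (card A)" using A(1,3) by (subst card_insert_disjoint) auto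
  \<comment> \<open>2 (k - 2) + 2 = (2k - 3) + 1, where the last unit is the parameter 0, that is
    \<open>u_star N\<close>; the natural subtractions are exact for k >= 2.\<close>
  finally have card: "2 * (k - 2) + 2 \<le> card (u ` insert 0 A)" using A(2) assms(1) by linarith
  show ?thesis
  proof (intro exI conjI ballI)
    show "finite (u ` insert 0 A)" using A(1) by simp
    show "2 * (k - 2) + 2 \<le> card (u ` insert 0 A)" by (rule card)
    show "u_star N \<in> u ` insert 0 A" unfolding u0[symmetric] by (intro imageI insertI1)
    fix w assume "w \<in> u ` insert 0 A"
    then obtain a where "a \<in> insert 0 A" "w = u a" by blast
    then show "radial w" "liouville_solution N (2 * pi * (N + 2)) w" using rad sol by simp_all
  qed
qed

end
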